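(* Let $0<T_{\min}<T_{\max}$ and let $A\in\mathbb{R}^{n\times n}$, $B\in\mathbb{R}^{n\times m}$, $C\in\mathbb{R}^{q\times n}$, $A_J\in\mathbb{R}^{n\times n}$, $B_J\in\mathbb{R}^{n\times m_J}$, $C_J\in\mathbb{R}^{q_J\times n}$ be real matrices defining the impulsive open-loop system $$\begin{pmatrix}\dot x(t)\\ y(t)\end{pmatrix}=\begin{pmatrix}A&B\\ C&0\end{pmatrix}\begin{pmatrix}x(t)\\ u(t)\end{pmatrix},\qquad \begin{pmatrix}x(t_k)\\ y_J(k)\end{pmatrix}=\begin{pmatrix}A_J&B_J\\ C_J&0\end{pmatrix}\begin{pmatrix}x(t_k^-)\\ u_J(k)\end{pmatrix},\qquad t\ge 0,\ k\in\mathbb{N}.$$ Let $U$, $V$, $U_J$ and $V_J$ be basis matrices of $\ker(B^T)$, $\ker(C)$, $\ker(B_J^T)$ and $\ker(C_J)$, respectively. Then there exists a clock-dependent dynamic output-feedback controller (as defined in the context) for this system such that the clock-dependent stability LMIs (as defined in the context) are feasible for the corresponding closed-loop system if and only if there exist continuously differentiable maps $X,Y:[0,T_{\max}]\to\mathbb{S}^n$ satisfying $$\begin{pmatrix}Y(\tau)&I\\ I&X(\tau)\end{pmatrix}\succ 0,$$ $$V^T\begin{pmatrix}I\\ A\end{pmatrix}^T\begin{pmatrix}\dot X(\tau)&X(\tau)\\ X(\tau)&0\end{pmatrix}\begin{pmatrix}I\\ A\end{pmatrix}V\prec 0$$ and $$U^T\begin{pmatrix}-A^T\\ I\end{pmatrix}^T\begin{pmatrix}0&Y(\tau)\\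 Y(\tau)&\dot Y(\tau)\end{pmatrix}\begin{pmatrix}-A^T\\ I\end{pmatrix}U\succ 0$$ for all $\tau\in[0,T_{\max}]$, as well as $$V_J^T\begin{pmatrix}I\\ A_J\end{pmatrix}^T\begin{pmatrix}-X(\tau)&0\\ 0&X(0)\end{pmatrix}\begin{pmatrix}I\\ A_J\end{pmatrix}V_J\prec 0$$ and $$U_J^T\begin{pmatrix}-A_J^T\\ I\end{pmatrix}^T\begin{pmatrix}-Y(\tau)&0\\ 0&Y(0)\end{pmatrix}\begin{pmatrix}-A_J^T\\ I\end{pmatrix}U_J\succ 0$$ for all $\tau\in[T_{\min},T_{\max}]$.
   Context: $\mathbb{S}^n$ is the set of symmetric real $n\times n$ matrices; $\succ 0$ and $\prec 0$ denote positive and negative definiteness of symmetric matrices; a dot over a matrix-valued map denotes its derivative. $f(t^-)$ denotes the limit from the left. A basis matrix of a subspace is a matrix whose columns form a basis of it; if the subspace is $\{0\}$, the matrix is empty and the corresponding inequality is void. Impulse instants are sequences $0=t_0<t_1<t_2<\dots$ with $t_k-t_{k-1}\in[T_{\min},T_{\max}]$ for all $k\in\mathbb{N}$. The clock is $\theta(t):=t-t_k$ for $t\in[t_k,t_{k+1})$, $k\in\mathbb{N}_0$. Clock-dependent dynamic output-feedback controller: a system with some state dimension $n_c$ of the form $$\begin{pmatrix}\dot x_c(t)\\ u(t)\end{pmatrix}=\begin{pmatrix}A^c(\theta(t))&B^c(\theta(t))\\ C^c(\theta(t))&D^c(\theta(t))\end{pmatrix}\begin{pmatrix}x_c(t)\\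 y(t)\end{pmatrix},\qquad \begin{pmatrix}x_c(t_k)\\ u_J(k)\end{pmatrix}=\begin{pmatrix}A_J^c(\theta(t_k^-))&B_J^c(\theta(t_k^-))\\ C_J^c(\theta(t_k^-))&D_J^c(\theta(t_k^-))\end{pmatrix}\begin{pmatrix}x_c(t_k^-)\\ y_J(k)\end{pmatrix}$$ for $t\ge 0$, $k\in\mathbb{N}$, with continuous matrix-valued maps $A^c,B^c,C^c,D^c$ on $[0,T_{\max}]$ and $A^c_J,B^c_J,C^c_J,D^c_J$ on $[T_{\min},T_{\max}]$. Closed-loop system: with $x_{cl}=\begin{pmatrix}x\\ x_c\end{pmatrix}$ it is $\dot x_{cl}(t)=\mathcal{A}(\theta(t))x_{cl}(t)$, $x_{cl}(t_k)=\mathcal{A}_J(\theta(t_k^-))x_{cl}(t_k^-)$, where $$\mathcal{A}=\begin{pmatrix}A+BD^cC&BC^c\\ B^cC&A^c\end{pmatrix},\qquad \mathcal{A}_J=\begin{pmatrix}A_J+B_JD_J^cC_J&B_JC_J^c\\ B_J^cC_J&A_J^c\end{pmatrix}.$$ Clock-dependent stability LMIs: they are feasible for the closed-loop system if there exists a continuously differentiable map $\mathcal{X}:[0,T_{\max}]\to\mathbb{S}^{n+n_c}$ with $\mathcal{X}(\tau)\succ 0$ and $\dot{\mathcal{X}}(\tau)+\mathcal{A}(\tau)^T\mathcal{X}(\tau)+\mathcal{X}(\tau)\mathcal{A}(\tau)\prec 0$ for all $\tau\in[0,T_{\max}]$, and $\mathcal{A}_J(\tau)^T\mathcal{X}(0)\mathcal{A}_J(\tau)-\mathcal{X}(\tau)\prec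 0$ for all $\tau\in[T_{\min},T_{\max}]$. *)

theory Defs
  imports "HOL-Analysis.Derivative" "Jordan_Normal_Form.Matrix_Kernel"
begin

text \<open>
  The controller order is quantified inside the statement, so matrix sizes are given by explicit
  carriers rather than by types. Empty dimensions are allowed throughout.
\<close>

definition pos_def :: "real mat \<Rightarrow> bool" where
  "pos_def M \<longleftrightarrow> square_mat M \<and> M\<^sup>T = M \<and>
    (\<forall>v \<in> carrier_vec (dim_row M). v \<noteq> 0\<^sub>v (dim_row M) \<longrightarrow> v \<bullet> (M *\<^sub>v v) > 0)"

definition neg_def :: "real mat \<Rightarrow> bool" where
  "neg_def M \<longleftrightarrow> square_mat M \<and> M\<^sup>T = M \<and>
    (\<forall>v \<in> carrier_vec (dim_row M). v \<noteq> 0\<^sub>v (dim_row M) \<longrightarrow> v \<bullet> (M *\<^sub>v v) < 0)"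

text \<open>
  The update of the carrier makes \<open>W\<close> a vector space in its own right, as in the library's
  locale \<^locale>\<open>kernel\<close>; linear independence and span are those of real vectors. Distinctness is
  required because \<^term>\<open>set (cols P)\<close> forgets repetitions. For \<open>W = {0}\<close> the matrix \<^term>\<open>P\<close>
  has \<^term>\<open>n\<close> rows and no columns.
\<close>
definition basis_matrix :: "nat \<Rightarrow> real vec set \<Rightarrow> real mat \<Rightarrow> bool" where
  "basis_matrix n W P \<longleftrightarrow> dim_row P = n \<and> distinct (cols P) \<and>
    vectorspace.basis class_ring ((module_vec TYPE(real) n)\<lparr>carrier := W\<rparr>) (set (cols P))"

definition continuous_mat_on :: "real set \<Rightarrow> nat \<Rightarrow> nat \<Rightarrow> (real \<Rightarrow> real mat) \<Rightarrow> bool" where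
  "continuous_mat_on S r c F \<longleftrightarrow> (\<forall>t\<in>S. F t \<in> carrier_mat r c) \<and>
    (\<forall>i<r. \<forall>j<c. continuous_on S (\<lambda>t. F t $$ (i, j)))"

text \<open>Derivatives are relative to \<^term>\<open>S\<close>, hence one-sided at the end points of an interval.\<close>
definition mat_deriv :: "real set \<Rightarrow> (real \<Rightarrow> real mat) \<Rightarrow> real \<Rightarrow> real mat" where
  "mat_deriv S F t = Matrix.mat (dim_row (F t)) (dim_col (F t))
    (\<lambda>(i, j). vector_derivative (\<lambda>s. F s $$ (i, j)) (at t within S))"

definition C1_mat_on :: "real set \<Rightarrow> nat \<Rightarrow> nat \<Rightarrow> (real \<Rightarrow> real mat) \<Rightarrow> bool" where
  "C1_mat_on S r c F \<longleftrightarrow> (\<forall>t\<in>S. F t \<in> carrier_mat r c) \<and>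
    (\<forall>i<r. \<forall>j<c. \<forall>t\<in>S. (\<lambda>s. F s $$ (i, j)) differentiable (at t within S)) \<and>
    continuous_mat_on S r c (mat_deriv S F)"

definition C1_sym_mat_on :: "real set \<Rightarrow> nat \<Rightarrow> (real \<Rightarrow> real mat) \<Rightarrow> bool" where
  "C1_sym_mat_on S n F \<longleftrightarrow> C1_mat_on S n n F \<and> (\<forall>t\<in>S. (F t)\<^sup>T = F t)"

text \<open>
  The data of a controller
  \<open>x\<^sub>c' = A\<^sup>c x\<^sub>c + B\<^sup>c y\<close>, \<open>u = C\<^sup>c x\<^sub>c + D\<^sup>c y\<close> (flow) and
  \<open>x\<^sub>c\<^sup>+ = A\<^sub>J\<^sup>c x\<^sub>c + B\<^sub>J\<^sup>c y\<^sub>J\<close>, \<open>u\<^sub>J = C\<^sub>J\<^sup>c x\<^sub>c + D\<^sub>J\<^sup>c y\<^sub>J\<close> (jumps), as functions of the clock.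
\<close>
record controller =
  order_c :: nat
  A_c :: "real \<Rightarrow> real mat"
  B_c :: "real \<Rightarrow> real mat"
  C_c :: "real \<Rightarrow> real mat"
  D_c :: "real \<Rightarrow> real mat"
  AJ_c :: "real \<Rightarrow> real mat"
  BJ_c :: "real \<Rightarrow> real mat"
  CJ_c :: "real \<Rightarrow> real mat"
  DJ_c :: "real \<Rightarrow> real mat"

definition clock_dependent_controller ::
  "real \<Rightarrow> real \<Rightarrow> nat \<Rightarrow> nat \<Rightarrow> nat \<Rightarrow> nat \<Rightarrow> controller \<Rightarrow> bool" where
  "clock_dependent_controller Tmin Tmax m q mJ qJ K \<longleftrightarrow>
    continuous_mat_on {0..Tmax} (order_c K) (order_c K) (A_c K) \<and>
    continuous_mat_on {0..Tmax} (order_c K) q (B_c K) \<and>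
    continuous_mat_on {0..Tmax} m (order_c K) (C_c K) \<and>
    continuous_mat_on {0..Tmax} m q (D_c K) \<and>
    continuous_mat_on {Tmin..Tmax} (order_c K) (order_c K) (AJ_c K) \<and>
    continuous_mat_on {Tmin..Tmax} (order_c K) qJ (BJ_c K) \<and>
    continuous_mat_on {Tmin..Tmax} mJ (order_c K) (CJ_c K) \<and>
    continuous_mat_on {Tmin..Tmax} mJ qJ (DJ_c K)"

text \<open>
  These result from eliminating \<open>u\<close>, \<open>y = C x\<close> (respectively \<open>u\<^sub>J\<close>, \<open>y\<^sub>J = C\<^sub>J x\<close>) from the
  interconnection; the state is the plant state stacked on top of the controller state.
\<close>
definition closed_loop_flow ::
  "real mat \<Rightarrow> real mat \<Rightarrow> real mat \<Rightarrow> controller \<Rightarrow> real \<Rightarrow> real mat" where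
  "closed_loop_flow A B C K \<tau> =
    four_block_mat (A + B * D_c K \<tau> * C) (B * C_c K \<tau>) (B_c K \<tau> * C) (A_c K \<tau>)"

definition closed_loop_jump ::
  "real mat \<Rightarrow> real mat \<Rightarrow> real mat \<Rightarrow> controller \<Rightarrow> real \<Rightarrow> real mat" where
  "closed_loop_jump AJ BJ CJ K \<tau> =
    four_block_mat (AJ + BJ * DJ_c K \<tau> * CJ) (BJ * CJ_c K \<tau>) (BJ_c K \<tau> * CJ) (AJ_c K \<tau>)"

text \<open>
  For the clock-dependent system of dimension \<open>N\<close> with flow matrix \<open>\<A>\<close> and jump matrix \<open>\<A>\<^sub>J\<close>.
\<close>
definition clock_LMIs_feasible ::
  "real \<Rightarrow> real \<Rightarrow> nat \<Rightarrow> (real \<Rightarrow> real mat) \<Rightarrow> (real \<Rightarrow> real mat) \<Rightarrow> bool" where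
  "clock_LMIs_feasible Tmin Tmax N \<A> \<A>\<^sub>J \<longleftrightarrow>
    (\<exists>\<X>. C1_sym_mat_on {0..Tmax} N \<X> \<and>
      (\<forall>\<tau>\<in>{0..Tmax}. pos_def (\<X> \<tau>)) \<and>
      (\<forall>\<tau>\<in>{0..Tmax}. neg_def
        (mat_deriv {0..Tmax} \<X> \<tau> + (\<A> \<tau>)\<^sup>T * \<X> \<tau> + \<X> \<tau> * \<A> \<tau>)) \<and>
      (\<forall>\<tau>\<in>{Tmin..Tmax}. neg_def ((\<A>\<^sub>J \<tau>)\<^sup>T * \<X> 0 * \<A>\<^sub>J \<tau> - \<X> \<tau>)))"

end

(*
  Write Z for a Lyapunov matrix of the closed loop. For the necessity, the X of the theorem is twice
  the upper left corner of Z and Y is the upper left corner of the inverse of Z. The conditions on X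
  are homogeneous, so the factor 2 costs nothing, and it makes the coupling condition strict.

  For the sufficiency, a controller of order n is found with the Lyapunov matrix
  [[X, W - X], [W - X, X - W]], where W is the inverse of Y. The inequalities for the controller
  gains have the form Q + G^T K C + C^T K^T G < 0, for the jumps after a Schur complement. If Q < 0
  on ker G and on ker C then Q < \<rho> G^T G and Q < \<mu> C^T C for some constants, by Finsler's
  lemma. These are uniform over a compact parameter set, and
  K = - \<rho> \<mu> G (\<rho> G^T G + \<mu> C^T C - Q)^(-1) C^T is then a solution which depends continuously on the
  parameter, so that no selection argument is needed.
*)
theory Submission
  imports Defs "HOL-Analysis.Function_Topology" "Jordan_Normal_Form.DL_Rank"
begin

unbundle no inner_syntax

section \<open>Definite matrices and congruence on a kernel\<close>

text \<open>On two families of vectors the controller is invisible. For x in ker C the state (x, 0)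
  produces no output, so the closed loop acts on it as A does, and the Lyapunov inequality at (x, 0)
  is the one for X. For x in ker B^T no input acts along (x, 0), so the gains drop out at the vector
  v with Z v = (x, 0); the inequality there is the one for Y, with the opposite sign because the
  derivative of the inverse of Z is - Z^(-1) Z' Z^(-1). Elimination is the converse: negativity on
  these families is enough for a gain to exist. The formula for the gain comes from a quadratic
  minimisation in which \<rho> and \<mu> are the penalty weights.

  Without the factor 2 the coupling matrix would only be semidefinite: for a controller of order 0
  and n > 0, Y is the inverse of X and the matrix is singular.

  The jump inequality is quadratic in the gains. The Schur complement makes it affine at the price
  of a second vector w. Young's inequality for a form and its inverse links this shape with the jump
  inequality for Y, in both directions of the theorem.\<close>

lemma scalar_prod_mult_transpose:
  fixes A :: "'a :: comm_semiring_0 mat"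
  assumes "A \<in> carrier_mat nr nc" "x \<in> carrier_vec nc" "y \<in> carrier_vec nr"
  shows "x \<bullet> (A\<^sup>T *\<^sub>v y) = (A *\<^sub>v x) \<bullet> y"
proof -
  have "x \<bullet> (A\<^sup>T *\<^sub>v y) = (A\<^sup>T *\<^sub>v y) \<bullet> x"
    by (rule comm_scalar_prod[of _ nc]) (use assms in auto)
  also have "\<dots> = y \<bullet> (A *\<^sub>v x)"
    by (rule transpose_vec_mult_scalar[OF assms])
  also have "\<dots> = (A *\<^sub>v x) \<bullet> y"
    by (rule comm_scalar_prod[of _ nr]) (use assms in auto)
  finally show ?thesis .
qed

lemma symmetric_scalar_prod:
  fixes S :: "'a :: comm_semiring_0 mat"
  assumes "S \<in> carrier_mat n n" "S\<^sup>T = S" "x \<in> carrier_vec n" "y \<in> carrier_vec n"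
  shows "x \<bullet> (S *\<^sub>v y) = y \<bullet> (S *\<^sub>v x)"
proof -
  have "x \<bullet> (S *\<^sub>v y) = (S *\<^sub>v x) \<bullet> y"
    using scalar_prod_mult_transpose[OF assms(1,3,4)] assms(2) by simp
  also have "\<dots> = y \<bullet> (S *\<^sub>v x)"
    by (rule comm_scalar_prod[of _ n]) (use assms in auto)
  finally show ?thesis .
qed

lemma scalar_prod_self_pos:
  fixes v :: "real vec"
  assumes "v \<in> carrier_vec n" "v \<noteq> 0\<^sub>v n"
  shows "v \<bullet> v > 0"
  using assms conjugate_square_greater_0_vec[of v n] by simp

lemma scalar_prod_self_nonneg: "v \<bullet> v \<ge> 0" for v :: "real vec"
  by (simp add: scalar_prod_def sum_nonneg)

lemma append_vec_eq_zero_iff: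
  assumes "a \<in> carrier_vec n" "b \<in> carrier_vec k"
  shows "a @\<^sub>v b = 0\<^sub>v (n + k) \<longleftrightarrow> a = 0\<^sub>v n \<and> b = 0\<^sub>v k"
proof -
  have "0\<^sub>v (n + k) = 0\<^sub>v n @\<^sub>v (0\<^sub>v k :: 'a vec)" by auto
  then show ?thesis using assms append_vec_eq[of a n "0\<^sub>v n"] by auto
qed

lemma append_vec_cases:
  assumes "v \<in> carrier_vec (n + k)"
  obtains a b where "a \<in> carrier_vec n" "b \<in> carrier_vec k" "v = a @\<^sub>v b"
  using that[of "vec_first v n" "vec_last v k"] vec_first_last_append[OF assms] by simp

lemma pos_def_iff:
  assumes "M \<in> carrier_mat n n"
  shows "pos_def M \<longleftrightarrow> M\<^sup>T = M \<and> (\<forall>v\<in>carrier_vec n. v \<noteq> 0\<^sub>v n \<longrightarrow> v \<bullet> (M *\<^sub>v v) > 0)"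
  using assms by (simp add: pos_def_def)

lemma neg_def_iff:
  assumes "M \<in> carrier_mat n n"
  shows "neg_def M \<longleftrightarrow> M\<^sup>T = M \<and> (\<forall>v\<in>carrier_vec n. v \<noteq> 0\<^sub>v n \<longrightarrow> v \<bullet> (M *\<^sub>v v) < 0)"
  using assms by (simp add: neg_def_def)

text \<open>Translates the library's basis of a module whose carrier is the kernel into matrix
  language: w |-> U w is a linear bijection onto the kernel. Independence gives injectivity and the
  span gives surjectivity; both notions agree with those of the ambient space because the kernel is
  a submodule.\<close>

lemma basis_matrix_kernel:
  assumes M: "M \<in> carrier_mat k n" and U: "basis_matrix n (mat_kernel M) U"
  shows "U \<in> carrier_mat n (dim_col U)"
    and "\<And>w. w \<in> carrier_vec (dim_col U) \<Longrightarrow> U *\<^sub>v w \<in> mat_kernel M"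
    and "\<And>w. w \<in> carrier_vec (dim_col U) \<Longrightarrow> U *\<^sub>v w = 0\<^sub>v n \<Longrightarrow> w = 0\<^sub>v (dim_col U)"
    and "\<And>x. x \<in> mat_kernel M \<Longrightarrow> \<exists>w\<in>carrier_vec (dim_col U). x = U *\<^sub>v w"
proof -
  interpret kernel k n M by unfold_locales (rule M)
  show U': "U \<in> carrier_mat n (dim_col U)"
    using U by (auto simp: basis_matrix_def)
  have dist: "distinct (cols U)" and basis: "Ker.basis (set (cols U))"
    using U by (auto simp: basis_matrix_def)
  have ker: "set (cols U) \<subseteq> mat_kernel M" and span: "Ker.span (set (cols U)) = mat_kernel M"
    and indep: "\<not> Ker.lin_dep (set (cols U))"
    using basis by (auto simp: Ker.basis_def)
  have car: "set (cols U) \<subseteq> carrier_vec n"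
    using ker mat_kernel_carrier[OF M] by auto
  have U_cols: "mat_of_cols n (cols U) = U"
    using U' by auto
  have lc: "NC.lincomb_list c (cols U) = U *\<^sub>v vec (dim_col U) c" for c
    using NC.lincomb_list_as_mat_mult[of "cols U" c] car U_cols by (auto simp: subset_iff)
  show "\<exists>w\<in>carrier_vec (dim_col U). x = U *\<^sub>v w" if "x \<in> mat_kernel M" for x
  proof -
    have "x \<in> NC.span (set (cols U))"
      using that span span_same[OF ker] by auto
    then obtain a where "x = NC.lincomb a (set (cols U))"
      using NC.finite_in_span[OF _ car] by auto
    also have "\<dots> = NC.lincomb_list (\<lambda>i. a (cols U ! i)) (cols U)"
      by (rule NC.lincomb_as_lincomb_list_distinct[OF car dist])
    finally show ?thesis unfolding lc by auto
  qed
  show "w = 0\<^sub>v (dim_col U)" if "w \<in> carrier_vec (dim_col U)" "U *\<^sub>v w = 0\<^sub>v n" for w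
    using NC.lin_depI[OF U' that(1) _ that(2)] dist indep lindep_same[OF ker] by auto
  show "U *\<^sub>v w \<in> mat_kernel M" if w: "w \<in> carrier_vec (dim_col U)" for w
  proof (rule mat_kernelI[OF M])
    show "U *\<^sub>v w \<in> carrier_vec n"
      by (rule mult_mat_vec_carrier[OF U' w])
    have "M * U = 0\<^sub>m k (dim_col U)"
    proof (rule eq_matI)
      fix i j assume "i < dim_row (0\<^sub>m k (dim_col U) :: real mat)" "j < dim_col (0\<^sub>m k (dim_col U) :: real mat)"
      then have ij: "i < k" "j < dim_col U" by simp_all
      have "col U j \<in> set (cols U)"
        using ij(2) by (metis cols_length cols_nth nth_mem)
      then have "M *\<^sub>v col U j = 0\<^sub>v k"
        using ker mat_kernelD(2)[OF M] by blast
      then have "row M i \<bullet> col U j = 0"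
        using ij M by (metis carrier_matD(1) index_mult_mat_vec index_zero_vec(1))
      then show "(M * U) $$ (i, j) = 0\<^sub>m k (dim_col U) $$ (i, j)"
        using ij M by simp
    qed (use M in simp_all)
    then have "(M * U) *\<^sub>v w = 0\<^sub>v k" using w by (auto intro!: eq_vecI)
    then show "M *\<^sub>v (U *\<^sub>v w) = 0\<^sub>v k"
      using assoc_mult_mat_vec[OF M U' w] by simp
  qed
qed

lemma mult_mat_vec_zero:
  fixes A :: "'a :: semiring_0 mat"
  assumes "A \<in> carrier_mat nr nc"
  shows "A *\<^sub>v 0\<^sub>v nc = 0\<^sub>v nr"
  by (rule eq_vecI) (use assms in \<open>auto simp: scalar_prod_def\<close>)

lemma congruence_form:
  fixes U L F :: "real mat"
  assumes U: "U \<in> carrier_mat n r" and L: "L \<in> carrier_mat l n"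
    and F: "F \<in> carrier_mat l l" "F\<^sup>T = F"
  shows "U\<^sup>T * L\<^sup>T * F * L * U \<in> carrier_mat r r"
    and "(U\<^sup>T * L\<^sup>T * F * L * U)\<^sup>T = U\<^sup>T * L\<^sup>T * F * L * U"
    and "\<And>w. w \<in> carrier_vec r \<Longrightarrow> w \<bullet> ((U\<^sup>T * L\<^sup>T * F * L * U) *\<^sub>v w) =
      (L *\<^sub>v (U *\<^sub>v w)) \<bullet> (F *\<^sub>v (L *\<^sub>v (U *\<^sub>v w)))"
proof -
  let ?E = "U\<^sup>T * L\<^sup>T * F * L * U"
  note UT = transpose_carrier_mat[THEN iffD2, OF U]
  note LT = transpose_carrier_mat[THEN iffD2, OF L]
  note LU = mult_carrier_mat[OF L U]
  note FLU = mult_carrier_mat[OF F(1) LU]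
  note UTLT = mult_carrier_mat[OF UT LT]
  note UTLTF = mult_carrier_mat[OF UTLT F(1)]
  show E: "?E \<in> carrier_mat r r"
    by (rule mult_carrier_mat[OF mult_carrier_mat[OF UTLTF L] U])
  have E_eq: "?E = U\<^sup>T * (L\<^sup>T * (F * (L * U)))"
    by (simp only: assoc_mult_mat[OF UTLTF L U] assoc_mult_mat[OF UTLT F(1) LU]
        assoc_mult_mat[OF UT LT FLU])
  show sym: "?E\<^sup>T = ?E"
  proof -
    have E': "?E = (L * U)\<^sup>T * (F * (L * U))"
      by (simp only: E_eq transpose_mult[OF L U] assoc_mult_mat[OF UT LT FLU])
    have LUT: "(L * U)\<^sup>T \<in> carrier_mat r l" using LU by simp
    have "?E\<^sup>T = (F * (L * U))\<^sup>T * (L * U)"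
      by (simp only: E' transpose_mult[OF LUT FLU] transpose_transpose)
    also have "\<dots> = (L * U)\<^sup>T * F * (L * U)"
      by (simp only: transpose_mult[OF F(1) LU] F(2))
    also have "\<dots> = ?E"
      by (simp only: E' assoc_mult_mat[OF LUT F(1) LU])
    finally show ?thesis .
  qed
  show form: "w \<bullet> (?E *\<^sub>v w) = (L *\<^sub>v (U *\<^sub>v w)) \<bullet> (F *\<^sub>v (L *\<^sub>v (U *\<^sub>v w)))"
    if w: "w \<in> carrier_vec r" for w
  proof -
    have Uw: "U *\<^sub>v w \<in> carrier_vec n" and LUw: "L *\<^sub>v (U *\<^sub>v w) \<in> carrier_vec l"
      and FLUw: "F *\<^sub>v (L *\<^sub>v (U *\<^sub>v w)) \<in> carrier_vec l"
      using U L F(1) w by (auto intro!: mult_mat_vec_carrier)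
    have LFw: "L\<^sup>T *\<^sub>v (F *\<^sub>v (L *\<^sub>v (U *\<^sub>v w))) \<in> carrier_vec n"
      by (rule mult_mat_vec_carrier[OF LT FLUw])
    have "?E *\<^sub>v w = U\<^sup>T *\<^sub>v (L\<^sup>T *\<^sub>v (F *\<^sub>v (L *\<^sub>v (U *\<^sub>v w))))"
      by (simp only: E_eq assoc_mult_mat_vec[OF UT mult_carrier_mat[OF LT FLU] w]
          assoc_mult_mat_vec[OF LT FLU w] assoc_mult_mat_vec[OF F(1) LU w]
          assoc_mult_mat_vec[OF L U w])
    then show ?thesis
      by (simp only: scalar_prod_mult_transpose[OF U w LFw]
          scalar_prod_mult_transpose[OF L Uw FLUw])
  qed
qed

text \<open>Nonzero w correspond to nonzero kernel vectors U w, so the compressed matrix is tested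
  on exactly these. If the kernel is {0}, then U has no columns and both sides hold
  vacuously.\<close>

lemma congruence_on_kernel:
  assumes M: "M \<in> carrier_mat k n" and U: "basis_matrix n (mat_kernel M) U"
    and L: "L \<in> carrier_mat l n" and F: "F \<in> carrier_mat l l" "F\<^sup>T = F"
  shows "neg_def (U\<^sup>T * L\<^sup>T * F * L * U) \<longleftrightarrow>
      (\<forall>x\<in>mat_kernel M. x \<noteq> 0\<^sub>v n \<longrightarrow> (L *\<^sub>v x) \<bullet> (F *\<^sub>v (L *\<^sub>v x)) < 0)" (is ?neg)
    and "pos_def (U\<^sup>T * L\<^sup>T * F * L * U) \<longleftrightarrow>
      (\<forall>x\<in>mat_kernel M. x \<noteq> 0\<^sub>v n \<longrightarrow> (L *\<^sub>v x) \<bullet> (F *\<^sub>v (L *\<^sub>v x)) > 0)" (is ?pos)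
proof -
  let ?r = "dim_col U"
  let ?E = "U\<^sup>T * L\<^sup>T * F * L * U"
  note U' = basis_matrix_kernel[OF M U]
  note E = congruence_form(1)[OF U'(1) L F] and sym = congruence_form(2)[OF U'(1) L F]
    and form = congruence_form(3)[OF U'(1) L F]
  \<comment> \<open>The sign condition is a parameter R, so that one argument serves both
    definiteness claims.\<close>
  have all: "(\<forall>w\<in>carrier_vec ?r. w \<noteq> 0\<^sub>v ?r \<longrightarrow> R (w \<bullet> (?E *\<^sub>v w))) \<longleftrightarrow>
      (\<forall>x\<in>mat_kernel M. x \<noteq> 0\<^sub>v n \<longrightarrow> R ((L *\<^sub>v x) \<bullet> (F *\<^sub>v (L *\<^sub>v x))))" (is "?l \<longleftrightarrow> ?r'") for R
  proof
    assume l: ?l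
    show ?r'
    proof (intro ballI impI)
      fix x :: "real vec" assume x: "x \<in> mat_kernel M" "x \<noteq> 0\<^sub>v n"
      obtain w where w: "w \<in> carrier_vec ?r" "x = U *\<^sub>v w" using U'(4)[OF x(1)] by auto
      then have "w \<noteq> 0\<^sub>v ?r" using x(2) mult_mat_vec_zero[OF U'(1)] by metis
      then show "R ((L *\<^sub>v x) \<bullet> (F *\<^sub>v (L *\<^sub>v x)))" using l w form[OF w(1)] by metis
    qed
  next
    assume r: ?r'
    show ?l
    proof (intro ballI impI)
      fix w :: "real vec" assume w: "w \<in> carrier_vec ?r" "w \<noteq> 0\<^sub>v ?r"
      then have "U *\<^sub>v w \<noteq> 0\<^sub>v n" using U'(3) by metis
      then show "R (w \<bullet> (?E *\<^sub>v w))" using r U'(2)[OF w(1)] form[OF w(1)] by metis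
    qed
  qed
  show ?neg unfolding neg_def_iff[OF E] using sym all[of "\<lambda>c. c < 0"] by (simp only: simp_thms)
  show ?pos unfolding pos_def_iff[OF E] using sym all[of "\<lambda>c. c > 0"] by (simp only: simp_thms)
qed

section \<open>Elimination of the controller gain\<close>

text \<open>The adjugate formula makes every entry a polynomial in the entries of M, divided by the
  determinant. Continuity and differentiability of an inverse in a parameter are therefore
  consequences of closure under sums, products and reciprocals.\<close>

definition inv_mat :: "real mat \<Rightarrow> real mat" where
  "inv_mat M = inverse (det M) \<cdot>\<^sub>m adj_mat M"

lemma inv_mat:
  assumes M: "M \<in> carrier_mat n n" and "det M \<noteq> 0"
  shows "inv_mat M \<in> carrier_mat n n" "M * inv_mat M = 1\<^sub>m n" "inv_mat M * M = 1\<^sub>m n"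
proof -
  note adj = adj_mat[OF M]
  show "inv_mat M \<in> carrier_mat n n" using adj(1) by (simp add: inv_mat_def)
  have unit: "inverse (det M) \<cdot>\<^sub>m (det M \<cdot>\<^sub>m 1\<^sub>m n) = 1\<^sub>m n"
    using assms(2) by (intro eq_matI) auto
  show "M * inv_mat M = 1\<^sub>m n"
    by (simp only: inv_mat_def mult_smult_distrib[OF M adj(1)] adj(2) unit)
  show "inv_mat M * M = 1\<^sub>m n"
    by (simp only: inv_mat_def mult_smult_assoc_mat[OF adj(1) M] adj(3) unit)
qed

lemma pos_def_det_nonzero:
  assumes M: "M \<in> carrier_mat n n" and "pos_def M"
  shows "det M \<noteq> 0"
proof
  assume "det M = 0"
  then obtain v where v: "v \<in> carrier_vec n" "v \<noteq> 0\<^sub>v n" "M *\<^sub>v v = 0\<^sub>v n"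
    using det_0_iff_vec_prod_zero_field[OF M] by auto
  have "v \<bullet> (M *\<^sub>v v) > 0"
    using assms(2) v(1,2) unfolding pos_def_iff[OF M] by blast
  then show False
    using v(1,3) by simp
qed

lemma pos_def_inv_mat:
  assumes M: "M \<in> carrier_mat n n" and pd: "pos_def M"
  shows "inv_mat M \<in> carrier_mat n n" "(inv_mat M)\<^sup>T = inv_mat M"
    "x \<in> carrier_vec n \<Longrightarrow> M *\<^sub>v (inv_mat M *\<^sub>v x) = x"
    "x \<in> carrier_vec n \<Longrightarrow> inv_mat M *\<^sub>v (M *\<^sub>v x) = x"
proof -
  let ?N = "inv_mat M"
  note N = inv_mat[OF M pos_def_det_nonzero[OF assms]]
  show "?N \<in> carrier_mat n n" by (rule N)
  have sym: "M\<^sup>T = M" using pd unfolding pos_def_iff[OF M] by blast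
  have NT: "?N\<^sup>T \<in> carrier_mat n n" using N(1) by simp
  have "?N\<^sup>T * M = (M * ?N)\<^sup>T"
    by (simp only: transpose_mult[OF M N(1)] sym)
  then have "?N\<^sup>T * M = 1\<^sub>m n"
    by (simp only: N(2) transpose_one)
  then have "?N = ?N\<^sup>T * M * ?N"
    using N(1) by simp
  also have "\<dots> = ?N\<^sup>T"
    using NT by (simp only: assoc_mult_mat[OF NT M N(1)] N(2) right_mult_one_mat)
  finally show "?N\<^sup>T = ?N" by simp
  show "M *\<^sub>v (?N *\<^sub>v x) = x" if x: "x \<in> carrier_vec n"
    using x by (simp only: assoc_mult_mat_vec[OF M N(1) x, symmetric] N(2) one_mult_mat_vec)
  show "?N *\<^sub>v (M *\<^sub>v x) = x" if x: "x \<in> carrier_vec n"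
    using x by (simp only: assoc_mult_mat_vec[OF N(1) M x, symmetric] N(3) one_mult_mat_vec)
qed

lemma smult_mat_mult_vec:
  fixes A :: "'a :: comm_semiring_0 mat"
  assumes "A \<in> carrier_mat nr nc" "v \<in> carrier_vec nc"
  shows "(k \<cdot>\<^sub>m A) *\<^sub>v v = k \<cdot>\<^sub>v (A *\<^sub>v v)"
  using assms by (intro eq_vecI) auto

lemma smult_transpose: "(k \<cdot>\<^sub>m A)\<^sup>T = k \<cdot>\<^sub>m A\<^sup>T"
  by (intro eq_matI) auto

text \<open>Half the Hessian of the minimisation problem behind the gain. With the constants of
  Finsler's lemma the penalty on G alone already outweighs Q, so the matrix is positive definite and
  invertible.\<close>

definition penalised :: "real \<Rightarrow> real \<Rightarrow> real mat \<Rightarrow> real mat \<Rightarrow> real mat \<Rightarrow> real mat" where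
  "penalised \<rho> \<mu> Q G C = \<rho> \<cdot>\<^sub>m (G\<^sup>T * G) + \<mu> \<cdot>\<^sub>m (C\<^sup>T * C) - Q"

lemma penalised:
  assumes Q: "Q \<in> carrier_mat N N" "Q\<^sup>T = Q" and G: "G \<in> carrier_mat p N" and C: "C \<in> carrier_mat q N"
  shows "penalised \<rho> \<mu> Q G C \<in> carrier_mat N N"
    and "(penalised \<rho> \<mu> Q G C)\<^sup>T = penalised \<rho> \<mu> Q G C"
    and "\<And>x y. x \<in> carrier_vec N \<Longrightarrow> y \<in> carrier_vec N \<Longrightarrow> x \<bullet> (penalised \<rho> \<mu> Q G C *\<^sub>v y) =
      \<rho> * ((G *\<^sub>v x) \<bullet> (G *\<^sub>v y)) + \<mu> * ((C *\<^sub>v x) \<bullet> (C *\<^sub>v y)) - x \<bullet> (Q *\<^sub>v y)"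
proof -
  have GT: "G\<^sup>T \<in> carrier_mat N p" and CT: "C\<^sup>T \<in> carrier_mat N q" using G C by simp_all
  have GG: "G\<^sup>T * G \<in> carrier_mat N N" and CC: "C\<^sup>T * C \<in> carrier_mat N N"
    by (rule mult_carrier_mat[OF GT G], rule mult_carrier_mat[OF CT C])
  have A: "\<rho> \<cdot>\<^sub>m (G\<^sup>T * G) \<in> carrier_mat N N" "\<mu> \<cdot>\<^sub>m (C\<^sup>T * C) \<in> carrier_mat N N"
    using GG CC by simp_all
  show carrier: "penalised \<rho> \<mu> Q G C \<in> carrier_mat N N"
    unfolding penalised_def by (rule minus_carrier_mat[OF Q(1)])
  have "(G\<^sup>T * G)\<^sup>T = G\<^sup>T * G" "(C\<^sup>T * C)\<^sup>T = C\<^sup>T * C"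
    by (simp_all only: transpose_mult[OF GT G] transpose_mult[OF CT C] transpose_transpose)
  then have "(\<rho> \<cdot>\<^sub>m (G\<^sup>T * G))\<^sup>T = \<rho> \<cdot>\<^sub>m (G\<^sup>T * G)" "(\<mu> \<cdot>\<^sub>m (C\<^sup>T * C))\<^sup>T = \<mu> \<cdot>\<^sub>m (C\<^sup>T * C)"
    by (simp_all only: smult_transpose)
  then show "(penalised \<rho> \<mu> Q G C)\<^sup>T = penalised \<rho> \<mu> Q G C"
    unfolding penalised_def using A Q
    by (simp add: transpose_minus[of _ N N] transpose_add[of _ N N])
  fix x y :: "real vec" assume x: "x \<in> carrier_vec N" and y: "y \<in> carrier_vec N"
  have GyC: "G *\<^sub>v y \<in> carrier_vec p" "C *\<^sub>v y \<in> carrier_vec q"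
    using G C y by (auto intro: mult_mat_vec_carrier)
  have g: "G\<^sup>T *\<^sub>v (G *\<^sub>v y) \<in> carrier_vec N" and c: "C\<^sup>T *\<^sub>v (C *\<^sub>v y) \<in> carrier_vec N"
    and Qy: "Q *\<^sub>v y \<in> carrier_vec N"
    by (rule mult_mat_vec_carrier[OF GT GyC(1)], rule mult_mat_vec_carrier[OF CT GyC(2)],
        rule mult_mat_vec_carrier[OF Q(1) y])
  have "penalised \<rho> \<mu> Q G C *\<^sub>v y =
      \<rho> \<cdot>\<^sub>v (G\<^sup>T *\<^sub>v (G *\<^sub>v y)) + \<mu> \<cdot>\<^sub>v (C\<^sup>T *\<^sub>v (C *\<^sub>v y)) - Q *\<^sub>v y"
    by (simp only: penalised_def minus_mult_distrib_mat_vec[OF add_carrier_mat[OF A(2)] Q(1) y]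
        add_mult_distrib_mat_vec[OF A y] smult_mat_mult_vec[OF GG y] smult_mat_mult_vec[OF CC y]
        assoc_mult_mat_vec[OF GT G y] assoc_mult_mat_vec[OF CT C y])
  also have "x \<bullet> \<dots> = x \<bullet> (\<rho> \<cdot>\<^sub>v (G\<^sup>T *\<^sub>v (G *\<^sub>v y))) + x \<bullet> (\<mu> \<cdot>\<^sub>v (C\<^sup>T *\<^sub>v (C *\<^sub>v y))) - x \<bullet> (Q *\<^sub>v y)"
    using x g c Qy by (simp add: scalar_prod_minus_distrib[of _ N] scalar_prod_add_distrib[of _ N] del: scalar_prod_smult_right scalar_prod_smult_distrib)
  also have "\<dots> = \<rho> * ((G *\<^sub>v x) \<bullet> (G *\<^sub>v y)) + \<mu> * ((C *\<^sub>v x) \<bullet> (C *\<^sub>v y)) - x \<bullet> (Q *\<^sub>v y)"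
    by (simp only: scalar_prod_smult_distrib[OF x g] scalar_prod_smult_distrib[OF x c]
        scalar_prod_mult_transpose[OF G x GyC(1)] scalar_prod_mult_transpose[OF C x GyC(2)])
  finally show "x \<bullet> (penalised \<rho> \<mu> Q G C *\<^sub>v y) =
      \<rho> * ((G *\<^sub>v x) \<bullet> (G *\<^sub>v y)) + \<mu> * ((C *\<^sub>v x) \<bullet> (C *\<^sub>v y)) - x \<bullet> (Q *\<^sub>v y)" .
qed

definition elimination_gain :: "real \<Rightarrow> real \<Rightarrow> real mat \<Rightarrow> real mat \<Rightarrow> real mat \<Rightarrow> real mat" where
  "elimination_gain \<rho> \<mu> Q G C = (- \<rho> * \<mu>) \<cdot>\<^sub>m (G * (inv_mat (penalised \<rho> \<mu> Q G C) * C\<^sup>T))"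

text \<open>Write q for the form of Q. For fixed v let h minimise \<rho> |G z|^2 + \<mu> |C (v -
  z)|^2 - q(z) over z. Stationarity reads S h = \<mu> C^T C v with S the penalised matrix, and the
  gain is made so that it sends C v to - \<rho> G h. With r = v - h the mixed terms cancel, and the
  form becomes q(h) - 2 \<rho> |G h|^2 + q(r) - 2 \<mu> |C r|^2, which the two Finsler inequalities
  make negative.\<close>

lemma elimination_pointwise:
  assumes Q: "Q \<in> carrier_mat N N" "Q\<^sup>T = Q" and G: "G \<in> carrier_mat p N" and C: "C \<in> carrier_mat q N"
    and pos: "\<rho> > 0" "\<mu> > 0"
    and hG: "\<And>v. v \<in> carrier_vec N \<Longrightarrow> v \<noteq> 0\<^sub>v N \<Longrightarrow> v \<bullet> (Q *\<^sub>v v) < \<rho> * ((G *\<^sub>v v) \<bullet> (G *\<^sub>v v))"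
    and hC: "\<And>v. v \<in> carrier_vec N \<Longrightarrow> v \<noteq> 0\<^sub>v N \<Longrightarrow> v \<bullet> (Q *\<^sub>v v) < \<mu> * ((C *\<^sub>v v) \<bullet> (C *\<^sub>v v))"
  shows "pos_def (penalised \<rho> \<mu> Q G C)"
    and "\<And>v. v \<in> carrier_vec N \<Longrightarrow> v \<noteq> 0\<^sub>v N \<Longrightarrow>
      v \<bullet> (Q *\<^sub>v v) + 2 * ((G *\<^sub>v v) \<bullet> (elimination_gain \<rho> \<mu> Q G C *\<^sub>v (C *\<^sub>v v))) < 0"
proof -
  let ?S = "penalised \<rho> \<mu> Q G C"
  note S = penalised[OF Q G C, where \<rho>=\<rho> and \<mu>=\<mu>]
  show pd: "pos_def ?S"
    unfolding pos_def_iff[OF S(1)]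
  proof (intro conjI ballI impI S(2))
    fix v :: "real vec" assume v: "v \<in> carrier_vec N" "v \<noteq> 0\<^sub>v N"
    have "0 \<le> \<mu> * ((C *\<^sub>v v) \<bullet> (C *\<^sub>v v))"
      using pos by (simp add: scalar_prod_self_nonneg)
    then show "v \<bullet> (?S *\<^sub>v v) > 0"
      using hG[OF v] S(3)[OF v(1) v(1)] by linarith
  qed
  note H = pos_def_inv_mat[OF S(1) pd]
  let ?H = "inv_mat ?S"
  fix v :: "real vec" assume v: "v \<in> carrier_vec N" "v \<noteq> 0\<^sub>v N"
  have CT: "C\<^sup>T \<in> carrier_mat N q" using C by simp
  have Cv: "C *\<^sub>v v \<in> carrier_vec q" by (rule mult_mat_vec_carrier[OF C v(1)])
  have c: "C\<^sup>T *\<^sub>v (C *\<^sub>v v) \<in> carrier_vec N" by (rule mult_mat_vec_carrier[OF CT Cv])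
  define h where "h = \<mu> \<cdot>\<^sub>v (?H *\<^sub>v (C\<^sup>T *\<^sub>v (C *\<^sub>v v)))"
  have Hc: "?H *\<^sub>v (C\<^sup>T *\<^sub>v (C *\<^sub>v v)) \<in> carrier_vec N" by (rule mult_mat_vec_carrier[OF H(1) c])
  have h: "h \<in> carrier_vec N" unfolding h_def using Hc by simp
  define r where "r = v - h"
  have r: "r \<in> carrier_vec N" unfolding r_def using v h by simp
  have v_eq: "v = h + r" unfolding r_def using v(1) h by (intro eq_vecI) auto
  have Sh: "?S *\<^sub>v h = \<mu> \<cdot>\<^sub>v (C\<^sup>T *\<^sub>v (C *\<^sub>v v))"
    unfolding h_def by (simp only: mult_mat_vec[OF S(1) Hc] H(3)[OF c])
  \<comment> \<open>The stationarity condition of h, tested with an arbitrary z.\<close>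
  have normal: "\<rho> * ((G *\<^sub>v z) \<bullet> (G *\<^sub>v h)) + \<mu> * ((C *\<^sub>v z) \<bullet> (C *\<^sub>v h)) - z \<bullet> (Q *\<^sub>v h) =
      \<mu> * ((C *\<^sub>v z) \<bullet> (C *\<^sub>v v))" if z: "z \<in> carrier_vec N" for z
    using S(3)[OF z h]
    by (simp only: Sh scalar_prod_smult_distrib[OF z c] scalar_prod_mult_transpose[OF C z Cv])
  have gain: "elimination_gain \<rho> \<mu> Q G C *\<^sub>v (C *\<^sub>v v) = (- \<rho>) \<cdot>\<^sub>v (G *\<^sub>v h)"
  proof -
    have "elimination_gain \<rho> \<mu> Q G C *\<^sub>v (C *\<^sub>v v) =
        (- \<rho> * \<mu>) \<cdot>\<^sub>v (G *\<^sub>v (?H *\<^sub>v (C\<^sup>T *\<^sub>v (C *\<^sub>v v))))"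
      unfolding elimination_gain_def
      by (simp only: smult_mat_mult_vec[OF mult_carrier_mat[OF G mult_carrier_mat[OF H(1) CT]] Cv]
          assoc_mult_mat_vec[OF G mult_carrier_mat[OF H(1) CT] Cv] assoc_mult_mat_vec[OF H(1) CT Cv])
    then show ?thesis
      unfolding h_def by (simp add: mult_mat_vec[OF G Hc] smult_smult_assoc)
  qed
  have Gs: "G *\<^sub>v h \<in> carrier_vec p" "G *\<^sub>v r \<in> carrier_vec p"
    and Cs: "C *\<^sub>v h \<in> carrier_vec q" "C *\<^sub>v r \<in> carrier_vec q"
    and Qs: "Q *\<^sub>v h \<in> carrier_vec N" "Q *\<^sub>v r \<in> carrier_vec N"
    using G C Q(1) h r by (auto intro: mult_mat_vec_carrier)
  define gg gr cc cr rr qhh qhr qrr where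
    "gg = (G *\<^sub>v h) \<bullet> (G *\<^sub>v h)" and "gr = (G *\<^sub>v r) \<bullet> (G *\<^sub>v h)" and
    "cc = (C *\<^sub>v h) \<bullet> (C *\<^sub>v h)" and "cr = (C *\<^sub>v h) \<bullet> (C *\<^sub>v r)" and "rr = (C *\<^sub>v r) \<bullet> (C *\<^sub>v r)" and
    "qhh = h \<bullet> (Q *\<^sub>v h)" and "qhr = h \<bullet> (Q *\<^sub>v r)" and "qrr = r \<bullet> (Q *\<^sub>v r)"
  note forms = gg_def gr_def cc_def cr_def rr_def qhh_def qhr_def qrr_def
  have sym: "r \<bullet> (Q *\<^sub>v h) = qhr" "(C *\<^sub>v r) \<bullet> (C *\<^sub>v h) = cr"
    unfolding forms using symmetric_scalar_prod[OF Q r h] comm_scalar_prod[OF Cs(2,1)] by auto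
  have Gv: "G *\<^sub>v v = G *\<^sub>v h + G *\<^sub>v r" and Cv': "C *\<^sub>v v = C *\<^sub>v h + C *\<^sub>v r"
    and Qv: "Q *\<^sub>v v = Q *\<^sub>v h + Q *\<^sub>v r"
    unfolding v_eq using mult_add_distrib_mat_vec[OF G h r] mult_add_distrib_mat_vec[OF C h r]
      mult_add_distrib_mat_vec[OF Q(1) h r] by auto
  have qvv: "v \<bullet> (Q *\<^sub>v v) = qhh + 2 * qhr + qrr"
    unfolding Qv scalar_prod_add_distrib[OF v(1) Qs]
    unfolding v_eq add_scalar_prod_distrib[OF h r Qs(1)] add_scalar_prod_distrib[OF h r Qs(2)] sym
    by (simp add: forms)
  have gain': "(G *\<^sub>v v) \<bullet> (elimination_gain \<rho> \<mu> Q G C *\<^sub>v (C *\<^sub>v v)) = - (\<rho> * gg) - \<rho> * gr"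
    unfolding gain Gv scalar_prod_smult_distrib[OF add_carrier_vec[OF Gs] Gs(1)]
      add_scalar_prod_distrib[OF Gs(1) Gs(2) Gs(1)] forms by (simp add: distrib_left)
  have nh: "\<rho> * gg + \<mu> * cc - qhh = \<mu> * cc + \<mu> * cr"
    using normal[OF h] unfolding Cv' scalar_prod_add_distrib[OF Cs(1) Cs] distrib_left forms .
  have nr: "\<rho> * gr + \<mu> * cr - qhr = \<mu> * cr + \<mu> * rr"
    using normal[OF r] unfolding Cv' scalar_prod_add_distrib[OF Cs(2) Cs] sym distrib_left
    unfolding forms .
  \<comment> \<open>Stationarity with z = r gives \<open>qhr\<close> as \<rho> \<open>gr\<close> -
    \<mu> \<open>rr\<close>, and the \<open>gr\<close> terms then cancel against those from the
    gain.\<close>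
  have "v \<bullet> (Q *\<^sub>v v) + 2 * ((G *\<^sub>v v) \<bullet> (elimination_gain \<rho> \<mu> Q G C *\<^sub>v (C *\<^sub>v v))) =
      (qrr - \<mu> * rr) + (qhh - \<rho> * gg) - \<rho> * gg - \<mu> * rr"
    
  proof -
    have "qhr = \<rho> * gr - \<mu> * rr" using nr by (simp add: algebra_simps)
    then show ?thesis unfolding qvv gain' by (simp add: algebra_simps)
  qed
  moreover have "\<rho> * gg \<ge> 0" "\<mu> * rr \<ge> 0"
    using pos by (auto simp: forms scalar_prod_self_nonneg)
  \<comment> \<open>The Finsler inequalities speak of nonzero vectors only, so each bracket is
    nonpositive, and strictly negative unless its vector vanishes. As v = h + r is nonzero, h and r
    do not both vanish.\<close>
  moreover have "qrr - \<mu> * rr \<le> 0 \<and> (r \<noteq> 0\<^sub>v N \<longrightarrow> qrr - \<mu> * rr < 0)"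
    using hC[OF r] r Q(1) C unfolding forms by (cases "r = 0\<^sub>v N") (auto simp: mult_mat_vec_zero)
  moreover have "qhh - \<rho> * gg \<le> 0 \<and> (h \<noteq> 0\<^sub>v N \<longrightarrow> qhh - \<rho> * gg < 0)"
    using hG[OF h] h Q(1) G unfolding forms by (cases "h = 0\<^sub>v N") (auto simp: mult_mat_vec_zero)
  moreover have "r \<noteq> 0\<^sub>v N \<or> h \<noteq> 0\<^sub>v N"
    using v v_eq by auto
  ultimately show "v \<bullet> (Q *\<^sub>v v) + 2 * ((G *\<^sub>v v) \<bullet> (elimination_gain \<rho> \<mu> Q G C *\<^sub>v (C *\<^sub>v v))) < 0"
    by linarith
qed

section \<open>Finsler's lemma with a constant that is uniform over a compact set\<close>

lemma penalty_constant_compact: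
  fixes f g :: "'a :: topological_space \<Rightarrow> real"
  assumes K: "compact K" and f: "continuous_on K f" and g: "continuous_on K g"
    and nonneg: "\<And>x. x \<in> K \<Longrightarrow> g x \<ge> 0" and neg: "\<And>x. x \<in> K \<Longrightarrow> g x = 0 \<Longrightarrow> f x < 0"
  shows "\<exists>\<rho>>0. \<forall>x\<in>K. f x < \<rho> * g x"
proof -
  \<comment> \<open>Only points with f nonnegative constrain \<rho>, and g is positive at each of
    them.\<close>
  let ?L = "K \<inter> f -` {0..}"
  have L: "compact ?L"
  proof -
    have "closedin (top_of_set K) ?L"
      by (rule continuous_closedin_preimage[OF f]) simp
    then show ?thesis using K closedin_compact by blast
  qed
  show ?thesis
  proof (cases "?L = {}")
    case True
    then have "\<forall>x\<in>K. f x < 1 * g x" using nonneg by force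
    then show ?thesis by (intro exI[of _ 1]) simp
  next
    case False
    have fL: "continuous_on ?L f" and gL: "continuous_on ?L g"
      using f g continuous_on_subset by blast+
    obtain x0 where x0: "x0 \<in> ?L" "\<And>x. x \<in> ?L \<Longrightarrow> g x0 \<le> g x"
      using continuous_attains_inf[OF L False gL] by blast
    obtain x1 where x1: "x1 \<in> ?L" "\<And>x. x \<in> ?L \<Longrightarrow> f x \<le> f x1"
      using continuous_attains_sup[OF L False fL] by blast
    have g0: "g x0 > 0" using x0(1) nonneg[of x0] neg[of x0] by force
    \<comment> \<open>Makes \<rho> times the minimum of g on \<open>?L\<close> equal to the maximum
      of f plus 1. The 1 gives strictness, and keeps \<rho> positive when the maximum of f is
      0.\<close>
    define \<rho> where "\<rho> = (f x1 + 1) / g x0"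
    have f1: "f x1 \<ge> 0" using x1(1) by simp
    have rho: "\<rho> > 0" unfolding \<rho>_def using g0 f1 by simp
    have "f x < \<rho> * g x" if x: "x \<in> K" for x
    proof (cases "f x \<ge> 0")
      case True
      with x have xL: "x \<in> ?L" by simp
      have "f x < f x1 + 1" using x1(2)[OF xL] by simp
      also have "\<dots> = \<rho> * g x0" unfolding \<rho>_def using g0 by simp
      also have "\<dots> \<le> \<rho> * g x" using x0(2)[OF xL] rho by simp
      finally show ?thesis .
    next
      case False
      moreover have "0 \<le> \<rho> * g x" using rho nonneg[OF x] by simp
      ultimately show ?thesis by linarith
    qed
    then show ?thesis using rho by blast
  qed
qed

text \<open>The dimension N is a term and not a type, so the unit sphere is placed in the product
  space of all real sequences, with zeros from N on. It is a closed subset of a cube that is compact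
  by Tychonoff's theorem.\<close>

lemma compact_sphere_coordinates:
  "compact {f :: nat \<Rightarrow> real. (\<forall>i\<ge>N. f i = 0) \<and> (\<Sum>i<N. (f i)\<^sup>2) = 1}" (is "compact ?B")
proof -
  let ?P = "Pi\<^sub>E UNIV (\<lambda>_::nat. {-1..1::real})"
  have "compactin (product_topology (\<lambda>_. euclidean) UNIV) ?P"
    unfolding compactin_PiE by simp
  then have P: "compact ?P"
    by (simp add: euclidean_product_topology)
  have coord: "continuous_on UNIV (\<lambda>f :: nat \<Rightarrow> real. f i)" for i
    by simp
  have "closed (\<Inter>i\<in>{N..}. {f :: nat \<Rightarrow> real. f i = 0})"
    by (intro closed_INT ballI closed_Collect_eq coord continuous_intros)
  moreover have "closed {f :: nat \<Rightarrow> real. (\<Sum>i<N. (f i)\<^sup>2) = 1}"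
    by (intro closed_Collect_eq continuous_intros coord)
  ultimately have "closed ((\<Inter>i\<in>{N..}. {f :: nat \<Rightarrow> real. f i = 0}) \<inter> {f. (\<Sum>i<N. (f i)\<^sup>2) = 1})"
    by (rule closed_Int)
  moreover have "(\<Inter>i\<in>{N..}. {f :: nat \<Rightarrow> real. f i = 0}) \<inter> {f. (\<Sum>i<N. (f i)\<^sup>2) = 1} = ?B"
    by auto
  ultimately have "closed ?B" by simp
  moreover have "?B \<subseteq> ?P"
  proof
    fix f assume f: "f \<in> ?B"
    have "\<bar>f i\<bar> \<le> 1" for i
    proof (cases "i < N")
      case True
      have "(f i)\<^sup>2 \<le> (\<Sum>i<N. (f i)\<^sup>2)"
        by (rule member_le_sum) (use True in auto)
      then show ?thesis using f by (simp add: abs_square_le_1)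
    qed (use f in simp)
    then show "f \<in> ?P" by (auto simp: PiE_iff abs_le_iff minus_le_iff)
  qed
  ultimately show ?thesis using P compact_Int_closed[of ?P ?B] by (simp add: Int_absorb1)
qed

lemma scalar_prod_mat_vec_as_sum:
  fixes M :: "real mat"
  assumes "M \<in> carrier_mat r c" "u \<in> carrier_vec r" "v \<in> carrier_vec c"
  shows "u \<bullet> (M *\<^sub>v v) = (\<Sum>i<r. \<Sum>j<c. u $ i * M $$ (i, j) * v $ j)"
  using assms by (simp add: scalar_prod_def sum_distrib_left atLeast0LessThan mult.assoc)

text \<open>Both sides are homogeneous of degree two in v, so unit vectors suffice. On the compact
  product of S and the unit sphere the hypothesis says that the form of Q is negative wherever the
  square of G v vanishes, and one constant serves all t.\<close>

lemma finsler_uniform: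
  assumes S: "compact S" and Q: "continuous_mat_on S N N Q" and G: "continuous_mat_on S p N G"
    and neg: "\<And>t v. t \<in> S \<Longrightarrow> v \<in> carrier_vec N \<Longrightarrow> v \<noteq> 0\<^sub>v N \<Longrightarrow> G t *\<^sub>v v = 0\<^sub>v p \<Longrightarrow> v \<bullet> (Q t *\<^sub>v v) < 0"
  shows "\<exists>\<rho>>0. \<forall>t\<in>S. \<forall>v\<in>carrier_vec N. v \<noteq> 0\<^sub>v N \<longrightarrow> v \<bullet> (Q t *\<^sub>v v) < \<rho> * ((G t *\<^sub>v v) \<bullet> (G t *\<^sub>v v))"
proof -
  let ?B = "{f :: nat \<Rightarrow> real. (\<forall>i\<ge>N. f i = 0) \<and> (\<Sum>i<N. (f i)\<^sup>2) = 1}"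
  let ?K = "S \<times> ?B"
  let ?q = "\<lambda>x :: real \<times> (nat \<Rightarrow> real). \<Sum>i<N. \<Sum>j<N. snd x i * Q (fst x) $$ (i, j) * snd x j"
  let ?g = "\<lambda>x :: real \<times> (nat \<Rightarrow> real). \<Sum>i<p. (\<Sum>j<N. G (fst x) $$ (i, j) * snd x j)\<^sup>2"
  have Qt: "Q t \<in> carrier_mat N N" and Gt: "G t \<in> carrier_mat p N" if "t \<in> S" for t
    using Q G that by (auto simp: continuous_mat_on_def)
  have coord: "continuous_on ?K (\<lambda>x. snd x i)" for i
    by (rule continuous_on_product_then_coordinatewise) (intro continuous_intros)
  have entry: "continuous_on ?K (\<lambda>x. F (fst x) $$ (i, j))"
    if "continuous_mat_on S r c F" "i < r" "j < c" for F r c i j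
  proof -
    have "continuous_on S (\<lambda>t. F t $$ (i, j))" using that by (simp add: continuous_mat_on_def)
    then show ?thesis
      by (rule continuous_on_compose2) (auto intro: continuous_intros)
  qed
  \<comment> \<open>Vectors enter the compact set as sequences extended by zero; in these
    coordinates the forms are visibly continuous.\<close>
  have q_eq: "v \<bullet> (Q t *\<^sub>v v) = ?q (t, \<lambda>i. if i < N then v $ i else 0)"
    if "t \<in> S" "v \<in> carrier_vec N" for t v
    using scalar_prod_mat_vec_as_sum[OF Qt[OF that(1)] that(2) that(2)] by simp
  have Gv: "(G t *\<^sub>v v) $ i = (\<Sum>j<N. G t $$ (i, j) * v $ j)" if "t \<in> S" "v \<in> carrier_vec N" "i < p" for t v i
    using Gt[OF that(1)] that by (simp add: scalar_prod_def atLeast0LessThan)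
  have g_eq: "(G t *\<^sub>v v) \<bullet> (G t *\<^sub>v v) = ?g (t, \<lambda>i. if i < N then v $ i else 0)"
    if "t \<in> S" "v \<in> carrier_vec N" for t v
  proof -
    have "(G t *\<^sub>v v) \<bullet> (G t *\<^sub>v v) = (\<Sum>i<p. (G t *\<^sub>v v) $ i * (G t *\<^sub>v v) $ i)"
      using Gt[OF that(1)] by (simp add: scalar_prod_def atLeast0LessThan)
    also have "\<dots> = (\<Sum>i<p. (\<Sum>j<N. G t $$ (i, j) * v $ j)\<^sup>2)"
      by (rule sum.cong) (simp_all add: Gv[OF that] power2_eq_square)
    finally show ?thesis by simp
  qed
  have "\<exists>\<rho>>0. \<forall>x\<in>?K. ?q x < \<rho> * ?g x"
  proof (rule penalty_constant_compact)
    show "compact ?K" by (intro compact_Times S compact_sphere_coordinates)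
    show "continuous_on ?K ?q"
      by (intro continuous_on_sum continuous_on_mult coord entry[OF Q]) auto
    show "continuous_on ?K ?g"
      by (intro continuous_on_sum continuous_on_mult continuous_on_power coord entry[OF G]) auto
    show "0 \<le> ?g x" for x by (intro sum_nonneg) simp
    fix x assume x: "x \<in> ?K" and gx: "?g x = 0"
    obtain t f where tf: "x = (t, f)" by (cases x)
    with x have t: "t \<in> S" and f: "\<forall>i\<ge>N. f i = 0" "(\<Sum>i<N. (f i)\<^sup>2) = 1" by auto
    define v where "v = Matrix.vec N f"
    have v: "v \<in> carrier_vec N" and v_f: "(\<lambda>i. if i < N then v $ i else 0) = f"
      using f(1) by (auto simp: v_def fun_eq_iff)
    have "v \<noteq> 0\<^sub>v N"
    proof
      assume "v = 0\<^sub>v N"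
      then have "f i = 0" if "i < N" for i using that unfolding v_def by (metis index_vec index_zero_vec(1))
      then show False using f(2) by simp
    qed
    moreover have "G t *\<^sub>v v = 0\<^sub>v p"
    proof (rule eq_vecI)
      fix i assume "i < dim_vec (0\<^sub>v p :: real vec)"
      then have i: "i < p" by simp
      have "\<forall>i\<in>{..<p}. (\<Sum>j<N. G t $$ (i, j) * f j)\<^sup>2 = 0"
        using gx unfolding tf by (subst (asm) sum_nonneg_eq_0_iff) auto
      then have "(\<Sum>j<N. G t $$ (i, j) * f j) = 0" using i by simp
      then show "(G t *\<^sub>v v) $ i = 0\<^sub>v p $ i" using Gv[OF t v i] i by (simp add: v_def)
    qed (use Gt[OF t] in simp)
    ultimately have "v \<bullet> (Q t *\<^sub>v v) < 0" by (intro neg t v)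
    then show "?q x < 0" using q_eq[OF t v] unfolding v_f tf by simp
  qed
  then obtain \<rho> where \<rho>: "\<rho> > 0" "\<And>x. x \<in> ?K \<Longrightarrow> ?q x < \<rho> * ?g x" by blast
  show ?thesis
  proof (intro exI[of _ \<rho>] conjI \<rho>(1) ballI impI)
    fix t and v :: "real vec" assume t: "t \<in> S" and v: "v \<in> carrier_vec N" "v \<noteq> 0\<^sub>v N"
    define c where "c = v \<bullet> v"
    have c: "c > 0" unfolding c_def by (rule scalar_prod_self_pos[OF v])
    \<comment> \<open>Passing from v to the unit vector u multiplies both sides of the inequality by
      1 / c.\<close>
    define u where "u = (1 / sqrt c) \<cdot>\<^sub>v v"
    have u: "u \<in> carrier_vec N" using v by (simp add: u_def)
    have cc: "1 / sqrt c * (1 / sqrt c) = 1 / c" using c by simp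
    have "(t, \<lambda>i. if i < N then u $ i else 0) \<in> ?K"
    proof -
      have "(\<Sum>i<N. (u $ i)\<^sup>2) = u \<bullet> u"
        using u by (simp add: scalar_prod_def atLeast0LessThan power2_eq_square)
      also have "\<dots> = 1 / c * (v \<bullet> v)"
        using v(1) cc by (simp add: u_def)
      finally show ?thesis using t c by (simp add: c_def)
    qed
    from \<rho>(2)[OF this] have "u \<bullet> (Q t *\<^sub>v u) < \<rho> * ((G t *\<^sub>v u) \<bullet> (G t *\<^sub>v u))"
      unfolding q_eq[OF t u] g_eq[OF t u] .
    moreover have "u \<bullet> (Q t *\<^sub>v u) = 1 / c * (v \<bullet> (Q t *\<^sub>v v))"
      using v(1) Qt[OF t] c unfolding u_def by (simp add: mult_mat_vec[of _ N N])
    moreover have "(G t *\<^sub>v u) \<bullet> (G t *\<^sub>v u) = 1 / c * ((G t *\<^sub>v v) \<bullet> (G t *\<^sub>v v))"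
      using v(1) Gt[OF t] c unfolding u_def by (simp add: mult_mat_vec[of _ p N])
    ultimately show "v \<bullet> (Q t *\<^sub>v v) < \<rho> * ((G t *\<^sub>v v) \<bullet> (G t *\<^sub>v v))"
      using c by (simp add: field_simps)
  qed
qed

section \<open>Matrix-valued functions with entries in a function algebra\<close>

text \<open>Continuity and continuous differentiability on S are both closed under the operations
  from which all matrices here are built, so each matrix operation is treated once for the two of
  them. The rule \<open>cong\<close> is there because the sizes of the matrices, and with them the
  formulas for entries, are only known for parameters in S.\<close>

locale function_algebra =
  fixes S :: "real set" and P :: "(real \<Rightarrow> real) \<Rightarrow> bool"
  assumes cong: "\<And>f g. (\<And>t. t \<in> S \<Longrightarrow> f t = g t) \<Longrightarrow> P g \<Longrightarrow> P f"
    and const: "P (\<lambda>_. c)"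
    and add: "P f \<Longrightarrow> P g \<Longrightarrow> P (\<lambda>t. f t + g t)"
    and mult: "P f \<Longrightarrow> P g \<Longrightarrow> P (\<lambda>t. f t * g t)"
    and inverse: "P f \<Longrightarrow> (\<And>t. t \<in> S \<Longrightarrow> f t \<noteq> 0) \<Longrightarrow> P (\<lambda>t. inverse (f t))"
begin

definition mat_entries :: "nat \<Rightarrow> nat \<Rightarrow> (real \<Rightarrow> real mat) \<Rightarrow> bool" where
  "mat_entries r c F \<longleftrightarrow> (\<forall>t\<in>S. F t \<in> carrier_mat r c) \<and> (\<forall>i<r. \<forall>j<c. P (\<lambda>t. F t $$ (i, j)))"

lemma mat_entriesI:
  assumes "\<And>t. t \<in> S \<Longrightarrow> F t \<in> carrier_mat r c"
    and "\<And>i j t. i < r \<Longrightarrow> j < c \<Longrightarrow> t \<in> S \<Longrightarrow> F t $$ (i, j) = f i j t"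
    and "\<And>i j. i < r \<Longrightarrow> j < c \<Longrightarrow> P (f i j)"
  shows "mat_entries r c F"
  unfolding mat_entries_def
proof (intro conjI ballI allI impI)
  show "F t \<in> carrier_mat r c" if "t \<in> S" for t
    by (rule assms(1)[OF that])
  fix i j assume ij: "i < r" "j < c"
  show "P (\<lambda>t. F t $$ (i, j))"
    by (rule cong[OF assms(2)[OF ij] assms(3)[OF ij]])
qed

lemma mat_entries_carrier: "mat_entries r c F \<Longrightarrow> t \<in> S \<Longrightarrow> F t \<in> carrier_mat r c"
  by (simp add: mat_entries_def)

lemma mat_entries_entry: "mat_entries r c F \<Longrightarrow> i < r \<Longrightarrow> j < c \<Longrightarrow> P (\<lambda>t. F t $$ (i, j))"
  by (simp add: mat_entries_def)

lemma sum:
  assumes "finite I" "\<And>i. i \<in> I \<Longrightarrow> P (f i)"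
  shows "P (\<lambda>t. \<Sum>i\<in>I. f i t)"
  using assms
proof (induction rule: finite_induct)
  case empty
  show ?case using const[of 0] by simp
next
  case (insert x I)
  have "P (\<lambda>t. f x t + (\<Sum>i\<in>I. f i t))"
    by (rule add) (use insert in simp_all)
  then show ?case using insert.hyps by simp
qed

lemma prod:
  assumes "finite I" "\<And>i. i \<in> I \<Longrightarrow> P (f i)"
  shows "P (\<lambda>t. \<Prod>i\<in>I. f i t)"
  using assms
proof (induction rule: finite_induct)
  case empty
  show ?case using const[of 1] by simp
next
  case (insert x I)
  have "P (\<lambda>t. f x t * (\<Prod>i\<in>I. f i t))"
    by (rule mult) (use insert in simp_all)
  then show ?case using insert.hyps by simp
qed

lemma mat_entries_const: "M \<in> carrier_mat r c \<Longrightarrow> mat_entries r c (\<lambda>_. M)"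
  by (simp add: mat_entries_def const)

lemma mat_entries_add:
  assumes "mat_entries r c F" "mat_entries r c G"
  shows "mat_entries r c (\<lambda>t. F t + G t)"
proof (rule mat_entriesI[where f="\<lambda>i j t. F t $$ (i, j) + G t $$ (i, j)"])
  fix t assume "t \<in> S"
  note FG = assms[THEN mat_entries_carrier, OF this]
  show "F t + G t \<in> carrier_mat r c" using FG by simp
  show "(F t + G t) $$ (i, j) = F t $$ (i, j) + G t $$ (i, j)" if "i < r" "j < c" for i j
    using FG that by simp
qed (intro add assms[THEN mat_entries_entry])

lemma mat_entries_smult:
  assumes "P f" "mat_entries r c F"
  shows "mat_entries r c (\<lambda>t. f t \<cdot>\<^sub>m F t)"
proof (rule mat_entriesI[where f="\<lambda>i j t. f t * F t $$ (i, j)"])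
  fix t assume "t \<in> S"
  note F = mat_entries_carrier[OF assms(2) this]
  show "f t \<cdot>\<^sub>m F t \<in> carrier_mat r c" using F by simp
  show "(f t \<cdot>\<^sub>m F t) $$ (i, j) = f t * F t $$ (i, j)" if "i < r" "j < c" for i j
    using F that by simp
qed (intro mult assms(1) mat_entries_entry[OF assms(2)])

lemma mat_entries_uminus:
  assumes "mat_entries r c F"
  shows "mat_entries r c (\<lambda>t. - F t)"
\<comment> \<open>Negation is multiplication by the constant -1, since the locale offers constants
  and products only.\<close>
proof (rule mat_entriesI[where f="\<lambda>i j t. -1 * F t $$ (i, j)"])
  fix t assume "t \<in> S"
  note F = mat_entries_carrier[OF assms this]
  show "- F t \<in> carrier_mat r c" using F by simp
  show "(- F t) $$ (i, j) = -1 * F t $$ (i, j)" if "i < r" "j < c" for i j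
    using F that by simp
qed (intro mult const mat_entries_entry[OF assms])

lemma mat_entries_diff:
  assumes "mat_entries r c F" "mat_entries r c G"
  shows "mat_entries r c (\<lambda>t. F t - G t)"
proof (rule mat_entriesI[where f="\<lambda>i j t. F t $$ (i, j) + -1 * G t $$ (i, j)"])
  fix t assume "t \<in> S"
  note FG = assms[THEN mat_entries_carrier, OF this]
  show "F t - G t \<in> carrier_mat r c" using FG by (simp add: minus_carrier_mat)
  show "(F t - G t) $$ (i, j) = F t $$ (i, j) + -1 * G t $$ (i, j)" if "i < r" "j < c" for i j
    using FG that by simp
qed (intro add mult const assms[THEN mat_entries_entry])

lemma mat_entries_transpose:
  assumes "mat_entries r c F"
  shows "mat_entries c r (\<lambda>t. (F t)\<^sup>T)"
proof (rule mat_entriesI[where f="\<lambda>i j t. F t $$ (j, i)"])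
  fix t assume "t \<in> S"
  note F = mat_entries_carrier[OF assms this]
  show "(F t)\<^sup>T \<in> carrier_mat c r" using F by simp
  show "(F t)\<^sup>T $$ (i, j) = F t $$ (j, i)" if "i < c" "j < r" for i j
    using F that by simp
qed (rule mat_entries_entry[OF assms])

lemma mat_entries_mult:
  assumes "mat_entries r m F" "mat_entries m c G"
  shows "mat_entries r c (\<lambda>t. F t * G t)"
proof (rule mat_entriesI[where f="\<lambda>i j t. \<Sum>k\<in>{0..<m}. F t $$ (i, k) * G t $$ (k, j)"])
  fix t assume "t \<in> S"
  note FG = mat_entries_carrier[OF assms(1) this] mat_entries_carrier[OF assms(2) this]
  show "F t * G t \<in> carrier_mat r c" using FG by simp
  show "(F t * G t) $$ (i, j) = (\<Sum>k\<in>{0..<m}. F t $$ (i, k) * G t $$ (k, j))" if "i < r" "j < c" for i j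
    using FG that by (simp add: scalar_prod_def)
next
  fix i j assume "i < r" "j < c"
  then show "P (\<lambda>t. \<Sum>k\<in>{0..<m}. F t $$ (i, k) * G t $$ (k, j))"
    by (intro sum mult mat_entries_entry[OF assms(1)] mat_entries_entry[OF assms(2)]) auto
qed

lemma mat_entries_four_block:
  assumes "mat_entries r1 c1 F" "mat_entries r1 c2 G" "mat_entries r2 c1 H" "mat_entries r2 c2 J"
  shows "mat_entries (r1 + r2) (c1 + c2) (\<lambda>t. four_block_mat (F t) (G t) (H t) (J t))"
proof (rule mat_entriesI[where f="\<lambda>i j t. if i < r1 then if j < c1 then F t $$ (i, j) else G t $$ (i, j - c1)
    else if j < c1 then H t $$ (i - r1, j) else J t $$ (i - r1, j - c1)"])
  fix t assume t: "t \<in> S"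
  note FJ = mat_entries_carrier[OF assms(1) t] mat_entries_carrier[OF assms(4) t]
  show "four_block_mat (F t) (G t) (H t) (J t) \<in> carrier_mat (r1 + r2) (c1 + c2)"
    by (rule four_block_carrier_mat[OF FJ])
  show "four_block_mat (F t) (G t) (H t) (J t) $$ (i, j) =
      (if i < r1 then if j < c1 then F t $$ (i, j) else G t $$ (i, j - c1)
       else if j < c1 then H t $$ (i - r1, j) else J t $$ (i - r1, j - c1))"
    if "i < r1 + r2" "j < c1 + c2" for i j
    using FJ that by (auto simp: index_mat_four_block)
next
  fix i j assume "i < r1 + r2" "j < c1 + c2"
  then show "P (\<lambda>t. if i < r1 then if j < c1 then F t $$ (i, j) else G t $$ (i, j - c1)
       else if j < c1 then H t $$ (i - r1, j) else J t $$ (i - r1, j - c1))"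
    using mat_entries_entry[OF assms(1)] mat_entries_entry[OF assms(2)]
      mat_entries_entry[OF assms(3)] mat_entries_entry[OF assms(4)]
    by (cases "i < r1"; cases "j < c1") auto
qed

text \<open>The index maps are arbitrary, which covers minors, where one row and one column are
  skipped, as well as the blocks cut out of a gain and the corner of a Lyapunov matrix.\<close>

lemma mat_entries_submatrix:
  assumes "mat_entries r c F" and "\<And>i. i < r' \<Longrightarrow> a i < r" and "\<And>j. j < c' \<Longrightarrow> b j < c"
  shows "mat_entries r' c' (\<lambda>t. Matrix.mat r' c' (\<lambda>(i, j). F t $$ (a i, b j)))"
proof (rule mat_entriesI[where f="\<lambda>i j t. F t $$ (a i, b j)"])
  fix i j assume "i < r'" "j < c'"
  then show "P (\<lambda>t. F t $$ (a i, b j))"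
    by (intro mat_entries_entry[OF assms(1)] assms(2,3))
qed simp_all

lemma det:
  assumes "mat_entries n n F"
  shows "P (\<lambda>t. det (F t))"
proof (rule cong)
  fix t assume "t \<in> S"
  then show "det (F t) = (\<Sum>p\<in>{p. p permutes {0..<n}}. signof p * (\<Prod>i\<in>{0..<n}. F t $$ (i, p i)))"
    using det_def'[OF mat_entries_carrier[OF assms]] by simp
next
  show "P (\<lambda>t. \<Sum>p\<in>{p. p permutes {0..<n}}. signof p * (\<Prod>i\<in>{0..<n}. F t $$ (i, p i)))"
  proof (intro sum mult prod const)
    fix p i assume p: "p \<in> {p. p permutes {0..<n}}" and i: "i \<in> {0..<n}"
    from p have "p permutes {0..<n}" by simp
    from permutes_in_image[OF this, of i] i have "p i \<in> {0..<n}" by simp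
    with i show "P (\<lambda>t. F t $$ (i, p i))" by (intro mat_entries_entry[OF assms]) auto
  qed (auto intro: finite_permutations)
qed

lemma mat_entries_adj_mat:
  assumes "mat_entries n n F"
  shows "mat_entries n n (\<lambda>t. adj_mat (F t))"
\<comment> \<open>Entry (i, j) of the adjugate is the cofactor at (j, i), so the index maps skip row
  j and column i.\<close>
proof (rule mat_entriesI[where f="\<lambda>i j t. (-1) ^ (j + i) *
    det (Matrix.mat (n - 1) (n - 1) (\<lambda>(k, l). F t $$ (if k < j then k else Suc k, if l < i then l else Suc l)))"])
  fix t assume "t \<in> S"
  note F = mat_entries_carrier[OF assms this]
  show "adj_mat (F t) \<in> carrier_mat n n" by (rule adj_mat(1)[OF F])
  fix i j assume ij: "i < n" "j < n"
  have "mat_delete (F t) j i =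
      Matrix.mat (n - 1) (n - 1) (\<lambda>(k, l). F t $$ (if k < j then k else Suc k, if l < i then l else Suc l))"
    using F by (auto simp: mat_delete_def)
  then show "adj_mat (F t) $$ (i, j) = (-1) ^ (j + i) *
      det (Matrix.mat (n - 1) (n - 1) (\<lambda>(k, l). F t $$ (if k < j then k else Suc k, if l < i then l else Suc l)))"
    using F ij by (simp add: adj_mat_def cofactor_def)
next
  fix i j assume "i < n" "j < n"
  then have "mat_entries (n - 1) (n - 1) (\<lambda>t. Matrix.mat (n - 1) (n - 1)
      (\<lambda>(k, l). F t $$ (if k < j then k else Suc k, if l < i then l else Suc l)))"
    by (intro mat_entries_submatrix[OF assms, of "n - 1" "\<lambda>k. if k < j then k else Suc k"
          "n - 1" "\<lambda>l. if l < i then l else Suc l"]) auto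
  from mult[OF const det[OF this]]
  show "P (\<lambda>t. (-1) ^ (j + i) * det (Matrix.mat (n - 1) (n - 1)
      (\<lambda>(k, l). F t $$ (if k < j then k else Suc k, if l < i then l else Suc l))))" .
qed

lemma mat_entries_inv:
  assumes "mat_entries n n F" and "\<And>t. t \<in> S \<Longrightarrow> det (F t) \<noteq> 0"
  shows "mat_entries n n (\<lambda>t. inv_mat (F t))"
  unfolding inv_mat_def
  by (rule mat_entries_smult[OF inverse[OF det[OF assms(1)] assms(2)] mat_entries_adj_mat[OF assms(1)]])

end

section \<open>Continuity and continuous differentiability as function algebras\<close>

interpretation cont: function_algebra S "continuous_on S" for S
proof
  fix f g assume "\<And>t. t \<in> S \<Longrightarrow> f t = g t" "continuous_on S g"
  then show "continuous_on S f" by (metis continuous_on_cong)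
qed (simp_all add: continuous_on_add continuous_on_mult continuous_on_inverse)

text \<open>The derivative is an existential witness, so the closure properties need nothing but the
  differentiation rules. On a nondegenerate interval the witness is unique there, which is what
  links it to \<open>mat_deriv\<close>.\<close>

definition C1_on :: "real set \<Rightarrow> (real \<Rightarrow> real) \<Rightarrow> bool" where
  "C1_on S f \<longleftrightarrow> (\<exists>f'. continuous_on S f' \<and> (\<forall>t\<in>S. (f has_real_derivative f' t) (at t within S)))"

lemma C1_on_imp_continuous_on: "C1_on S f \<Longrightarrow> continuous_on S f"
  unfolding C1_on_def by (metis DERIV_continuous_on)

interpretation C1: function_algebra S "C1_on S" for S
proof
  fix f g assume eq: "\<And>t. t \<in> S \<Longrightarrow> f t = g t" and "C1_on S g"
  then obtain g' where g': "continuous_on S g'" "\<And>t. t \<in> S \<Longrightarrow> (g has_real_derivative g' t) (at t within S)"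
    unfolding C1_on_def by auto
  have "(f has_real_derivative g' t) (at t within S)" if t: "t \<in> S" for t
    using g'(2)[OF t] by (rule has_field_derivative_transform_within[where d=1]) (simp_all add: t eq)
  then show "C1_on S f"
    unfolding C1_on_def using g'(1) by auto
next
  show "C1_on S (\<lambda>_. c)" for c
    unfolding C1_on_def by (intro exI[of _ "\<lambda>_. 0"]) auto
next
  fix f g assume fg: "C1_on S f" "C1_on S g"
  then obtain f' g' where f': "continuous_on S f'" "\<And>t. t \<in> S \<Longrightarrow> (f has_real_derivative f' t) (at t within S)"
    and g': "continuous_on S g'" "\<And>t. t \<in> S \<Longrightarrow> (g has_real_derivative g' t) (at t within S)"
    unfolding C1_on_def by auto
  note fg = fg[THEN C1_on_imp_continuous_on]
  show "C1_on S (\<lambda>t. f t + g t)"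
    unfolding C1_on_def
    by (rule exI[of _ "\<lambda>t. f' t + g' t"]) (auto intro!: continuous_on_add DERIV_add f' g')
  show "C1_on S (\<lambda>t. f t * g t)"
    unfolding C1_on_def
    by (rule exI[of _ "\<lambda>t. f' t * g t + g' t * f t"])
      (auto intro!: continuous_on_add continuous_on_mult DERIV_mult f' g' fg)
next
  fix f assume f: "C1_on S f" and nz: "\<And>t. t \<in> S \<Longrightarrow> f t \<noteq> 0"
  then obtain f' where f': "continuous_on S f'" "\<And>t. t \<in> S \<Longrightarrow> (f has_real_derivative f' t) (at t within S)"
    unfolding C1_on_def by auto
  show "C1_on S (\<lambda>t. inverse (f t))"
    unfolding C1_on_def
    by (rule exI[of _ "\<lambda>t. - (inverse (f t) * f' t * inverse (f t))"])
      (auto intro!: continuous_on_minus continuous_on_mult continuous_on_inverse DERIV_inverse' f' C1_on_imp_continuous_on[OF f] nz)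
qed

lemma continuous_mat_on_iff: "continuous_mat_on S r c F \<longleftrightarrow> cont.mat_entries S r c F"
  by (simp add: continuous_mat_on_def cont.mat_entries_def)

lemma mat_deriv_carrier:
  assumes "F t \<in> carrier_mat r c"
  shows "mat_deriv S F t \<in> carrier_mat r c"
  unfolding mat_deriv_def carrier_matD[OF assms] by (rule mat_carrier)

lemma C1_mat_on_has_derivative:
  assumes "C1_mat_on S r c F" "t \<in> S" "i < r" "j < c"
  shows "((\<lambda>s. F s $$ (i, j)) has_real_derivative mat_deriv S F t $$ (i, j)) (at t within S)"
proof -
  have carrier: "F t \<in> carrier_mat r c"
    and diff: "(\<lambda>s. F s $$ (i, j)) differentiable (at t within S)"
    using assms by (simp_all add: C1_mat_on_def)
  have "mat_deriv S F t $$ (i, j) = vector_derivative (\<lambda>s. F s $$ (i, j)) (at t within S)"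
    using carrier assms(3,4) by (simp add: mat_deriv_def)
  then show ?thesis
    using vector_derivative_works[THEN iffD1, OF diff]
    by (simp only: has_real_derivative_iff_has_vector_derivative)
qed

text \<open>With a < b the derivative within the interval is unique even at the end points, so the
  continuous witness in \<open>C1_on\<close> coincides with the \<open>vector_derivative\<close>
  that \<open>mat_deriv\<close> selects.\<close>

lemma C1_mat_on_iff:
  assumes "a < b"
  shows "C1_mat_on {a..b} r c F \<longleftrightarrow> C1.mat_entries {a..b} r c F"
proof
  assume F: "C1_mat_on {a..b} r c F"
  then have F': "continuous_mat_on {a..b} r c (mat_deriv {a..b} F)"
    by (simp add: C1_mat_on_def)
  show "C1.mat_entries {a..b} r c F"
    unfolding C1.mat_entries_def
  proof (intro conjI ballI allI impI)
    fix i j assume ij: "i < r" "j < c"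
    show "C1_on {a..b} (\<lambda>t. F t $$ (i, j))"
      unfolding C1_on_def
      using F' C1_mat_on_has_derivative[OF F _ ij] ij
      by (intro exI[of _ "\<lambda>t. mat_deriv {a..b} F t $$ (i, j)"]) (auto simp: continuous_mat_on_def)
  qed (use F in \<open>auto simp: C1_mat_on_def\<close>)
next
  assume F: "C1.mat_entries {a..b} r c F"
  note carrier = C1.mat_entries_carrier[OF F]
  have entry: "(\<lambda>s. F s $$ (i, j)) differentiable (at t within {a..b})"
      "continuous_on {a..b} (\<lambda>t. mat_deriv {a..b} F t $$ (i, j))"
    if ij: "i < r" "j < c" and t: "t \<in> {a..b}" for i j t
  proof -
    obtain f' where f': "continuous_on {a..b} f'"
      "\<And>t. t \<in> {a..b} \<Longrightarrow> ((\<lambda>s. F s $$ (i, j)) has_real_derivative f' t) (at t within {a..b})"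
      using C1.mat_entries_entry[OF F ij] unfolding C1_on_def by blast
    show "(\<lambda>s. F s $$ (i, j)) differentiable (at t within {a..b})"
      using f'(2)[OF t] real_differentiable_def by blast
    have "mat_deriv {a..b} F t $$ (i, j) = f' t" if t: "t \<in> {a..b}" for t
      using carrier[OF t] ij vector_derivative_within_closed_interval[OF assms t] f'(2)[OF t]
      by (simp add: mat_deriv_def has_real_derivative_iff_has_vector_derivative)
    then show "continuous_on {a..b} (\<lambda>t. mat_deriv {a..b} F t $$ (i, j))"
      by (rule cont.cong[OF _ f'(1)])
  qed
  show "C1_mat_on {a..b} r c F"
    unfolding C1_mat_on_def continuous_mat_on_def
  proof (intro conjI ballI allI impI)
    fix t assume t: "t \<in> {a..b}"
    show "F t \<in> carrier_mat r c" by (rule carrier[OF t])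
    then show "mat_deriv {a..b} F t \<in> carrier_mat r c" by (rule mat_deriv_carrier)
  next
    fix i j assume ij: "i < r" "j < c"
    show "(\<lambda>s. F s $$ (i, j)) differentiable (at t within {a..b})" if "t \<in> {a..b}" for t
      by (rule entry(1)[OF ij that])
    show "continuous_on {a..b} (\<lambda>t. mat_deriv {a..b} F t $$ (i, j))"
      by (rule entry(2)[OF ij, of a]) (use assms in simp)
  qed
qed

lemma bilinear_form_has_derivative:
  assumes F: "C1_mat_on S r c F" and t: "t \<in> S" and uv: "u \<in> carrier_vec r" "v \<in> carrier_vec c"
  shows "((\<lambda>s. u \<bullet> (F s *\<^sub>v v)) has_real_derivative u \<bullet> (mat_deriv S F t *\<^sub>v v)) (at t within S)"
proof -
  have carrier: "F s \<in> carrier_mat r c" if "s \<in> S" for s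
    using F that by (simp add: C1_mat_on_def)
  have "((\<lambda>s. \<Sum>i<r. \<Sum>j<c. u $ i * F s $$ (i, j) * v $ j) has_real_derivative
      (\<Sum>i<r. \<Sum>j<c. u $ i * mat_deriv S F t $$ (i, j) * v $ j)) (at t within S)"
    by (intro DERIV_sum DERIV_cmult DERIV_cmult_right C1_mat_on_has_derivative[OF F t]) auto
  then have "((\<lambda>s. \<Sum>i<r. \<Sum>j<c. u $ i * F s $$ (i, j) * v $ j) has_real_derivative
      u \<bullet> (mat_deriv S F t *\<^sub>v v)) (at t within S)"
    by (simp add: scalar_prod_mat_vec_as_sum[OF mat_deriv_carrier[of F t, OF carrier[OF t]] uv])
  then show ?thesis
    by (rule has_field_derivative_transform_within[where d=1])
      (simp_all add: t scalar_prod_mat_vec_as_sum[OF carrier uv])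
qed

text \<open>The identities between derivatives below arise by differentiating one function in two
  ways and comparing the results with this fact, end points included.\<close>

lemma has_real_derivative_unique_Icc:
  assumes "a < b" "t \<in> {a..b}" "(f has_real_derivative d) (at t within {a..b})"
    "(f has_real_derivative e) (at t within {a..b})"
  shows "d = e"
  using assms vector_derivative_within_closed_interval
  by (metis has_real_derivative_iff_has_vector_derivative)

lemma mat_deriv_mult:
  assumes ab: "a < b" and F: "C1_mat_on {a..b} r m F" and G: "C1_mat_on {a..b} m c G" and t: "t \<in> {a..b}"
  shows "mat_deriv {a..b} (\<lambda>s. F s * G s) t = mat_deriv {a..b} F t * G t + F t * mat_deriv {a..b} G t"
proof -
  let ?S = "{a..b}"
  have FG: "C1_mat_on ?S r c (\<lambda>s. F s * G s)"
    using F G C1.mat_entries_mult by (simp add: C1_mat_on_iff[OF ab])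
  have Fs: "F s \<in> carrier_mat r m" and Gs: "G s \<in> carrier_mat m c" if "s \<in> ?S" for s
    using F G that by (auto simp: C1_mat_on_def)
  note F' = mat_deriv_carrier[of F t, OF Fs[OF t], where S="?S"] and G' = mat_deriv_carrier[of G t, OF Gs[OF t], where S="?S"]
  show ?thesis
  proof (rule eq_matI)
    fix i j assume "i < dim_row (mat_deriv ?S F t * G t + F t * mat_deriv ?S G t)"
      "j < dim_col (mat_deriv ?S F t * G t + F t * mat_deriv ?S G t)"
    then have ij: "i < r" "j < c" using Fs[OF t] G' by auto
    have entry: "(F s * G s) $$ (i, j) = (\<Sum>k\<in>{0..<m}. F s $$ (i, k) * G s $$ (k, j))"
      if "s \<in> ?S" for s
      using Fs[OF that] Gs[OF that] ij by (simp add: scalar_prod_def)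
    have "((\<lambda>s. \<Sum>k\<in>{0..<m}. F s $$ (i, k) * G s $$ (k, j)) has_real_derivative
        (\<Sum>k\<in>{0..<m}. mat_deriv ?S F t $$ (i, k) * G t $$ (k, j) + mat_deriv ?S G t $$ (k, j) * F t $$ (i, k)))
        (at t within ?S)"
      by (intro DERIV_sum DERIV_mult C1_mat_on_has_derivative[OF F t] C1_mat_on_has_derivative[OF G t] ij) auto
    then have "((\<lambda>s. (F s * G s) $$ (i, j)) has_real_derivative
        (\<Sum>k\<in>{0..<m}. mat_deriv ?S F t $$ (i, k) * G t $$ (k, j) + mat_deriv ?S G t $$ (k, j) * F t $$ (i, k)))
        (at t within ?S)"
      by (rule has_field_derivative_transform_within[where d=1])
        (simp_all only: entry t zero_less_one)
    then have "mat_deriv ?S (\<lambda>s. F s * G s) t $$ (i, j) =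
        (\<Sum>k\<in>{0..<m}. mat_deriv ?S F t $$ (i, k) * G t $$ (k, j) + mat_deriv ?S G t $$ (k, j) * F t $$ (i, k))"
      using has_real_derivative_unique_Icc[OF ab t C1_mat_on_has_derivative[OF FG t ij]] by blast
    also have "\<dots> = (mat_deriv ?S F t * G t + F t * mat_deriv ?S G t) $$ (i, j)"
      using Fs[OF t] Gs[OF t] F' G' ij by (simp add: scalar_prod_def sum.distrib mult.commute)
    finally show "mat_deriv ?S (\<lambda>s. F s * G s) t $$ (i, j) =
      (mat_deriv ?S F t * G t + F t * mat_deriv ?S G t) $$ (i, j)" .
  qed (use Fs[OF t] Gs[OF t] F' G' in \<open>auto simp: mat_deriv_def\<close>)
qed

section \<open>Uniform elimination over a compact parameter set\<close>

lemma continuous_elimination: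
  fixes Q G C :: "real \<Rightarrow> real mat"
  assumes S: "compact S" and Q: "continuous_mat_on S N N Q" and sym: "\<And>t. t \<in> S \<Longrightarrow> (Q t)\<^sup>T = Q t"
    and G: "continuous_mat_on S p N G" and C: "continuous_mat_on S q N C"
    and hG: "\<And>t (v :: real vec). t \<in> S \<Longrightarrow> v \<in> carrier_vec N \<Longrightarrow> v \<noteq> 0\<^sub>v N \<Longrightarrow> G t *\<^sub>v v = 0\<^sub>v p \<Longrightarrow> v \<bullet> (Q t *\<^sub>v v) < 0"
    and hC: "\<And>t (v :: real vec). t \<in> S \<Longrightarrow> v \<in> carrier_vec N \<Longrightarrow> v \<noteq> 0\<^sub>v N \<Longrightarrow> C t *\<^sub>v v = 0\<^sub>v q \<Longrightarrow> v \<bullet> (Q t *\<^sub>v v) < 0"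
  shows "\<exists>K. continuous_mat_on S p q K \<and> (\<forall>t\<in>S. \<forall>v\<in>carrier_vec N. v \<noteq> 0\<^sub>v N \<longrightarrow>
      v \<bullet> (Q t *\<^sub>v v) + 2 * ((G t *\<^sub>v v) \<bullet> (K t *\<^sub>v (C t *\<^sub>v v))) < 0)"
proof -
  have "\<exists>\<rho>>0. \<forall>t\<in>S. \<forall>v\<in>carrier_vec N. v \<noteq> 0\<^sub>v N \<longrightarrow>
      v \<bullet> (Q t *\<^sub>v v) < \<rho> * ((G t *\<^sub>v v) \<bullet> (G t *\<^sub>v v))"
    by (rule finsler_uniform[OF S Q G]) (rule hG)
  then obtain \<rho> where rho_pos: "\<rho> > 0" and rho_all: "\<forall>t\<in>S. \<forall>v\<in>carrier_vec N. v \<noteq> 0\<^sub>v N \<longrightarrow>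
      v \<bullet> (Q t *\<^sub>v v) < \<rho> * ((G t *\<^sub>v v) \<bullet> (G t *\<^sub>v v))"
    by (elim exE conjE)
  note \<rho> = rho_pos rho_all[THEN bspec, THEN bspec, THEN mp]
  have "\<exists>\<mu>>0. \<forall>t\<in>S. \<forall>v\<in>carrier_vec N. v \<noteq> 0\<^sub>v N \<longrightarrow>
      v \<bullet> (Q t *\<^sub>v v) < \<mu> * ((C t *\<^sub>v v) \<bullet> (C t *\<^sub>v v))"
    by (rule finsler_uniform[OF S Q C]) (rule hC)
  then obtain \<mu> where mu_pos: "\<mu> > 0" and mu_all: "\<forall>t\<in>S. \<forall>v\<in>carrier_vec N. v \<noteq> 0\<^sub>v N \<longrightarrow>
      v \<bullet> (Q t *\<^sub>v v) < \<mu> * ((C t *\<^sub>v v) \<bullet> (C t *\<^sub>v v))"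
    by (elim exE conjE)
  note \<mu> = mu_pos mu_all[THEN bspec, THEN bspec, THEN mp]
  note entries = Q[unfolded continuous_mat_on_iff] G[unfolded continuous_mat_on_iff] C[unfolded continuous_mat_on_iff]
  note carriers = cont.mat_entries_carrier[OF entries(1)] cont.mat_entries_carrier[OF entries(2)]
    cont.mat_entries_carrier[OF entries(3)]
  have pd: "pos_def (penalised \<rho> \<mu> (Q t) (G t) (C t))" if t: "t \<in> S" for t
    by (rule elimination_pointwise(1)[OF carriers(1)[OF t] sym[OF t] carriers(2)[OF t] carriers(3)[OF t]
          \<rho>(1) \<mu>(1) \<rho>(2)[OF t] \<mu>(2)[OF t]])
  have neg: "v \<bullet> (Q t *\<^sub>v v) + 2 * ((G t *\<^sub>v v) \<bullet> (elimination_gain \<rho> \<mu> (Q t) (G t) (C t) *\<^sub>v (C t *\<^sub>v v))) < 0"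
    if t: "t \<in> S" and v: "v \<in> carrier_vec N" "v \<noteq> 0\<^sub>v N" for t and v :: "real vec"
    by (rule elimination_pointwise(2)[OF carriers(1)[OF t] sym[OF t] carriers(2)[OF t] carriers(3)[OF t]
          \<rho>(1) \<mu>(1) \<rho>(2)[OF t] \<mu>(2)[OF t] v])
  let ?S = "\<lambda>t. penalised \<rho> \<mu> (Q t) (G t) (C t)"
  have S_entries: "cont.mat_entries S N N ?S"
    unfolding penalised_def
    by (rule cont.mat_entries_diff[OF cont.mat_entries_add[OF
          cont.mat_entries_smult[OF cont.const cont.mat_entries_mult[OF cont.mat_entries_transpose[OF entries(2)] entries(2)]]
          cont.mat_entries_smult[OF cont.const cont.mat_entries_mult[OF cont.mat_entries_transpose[OF entries(3)] entries(3)]]]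
        entries(1)])
  have det: "det (?S t) \<noteq> 0" if t: "t \<in> S" for t
    by (rule pos_def_det_nonzero[OF cont.mat_entries_carrier[OF S_entries t]])
      (rule pd[OF t])
  have "cont.mat_entries S p q (\<lambda>t. elimination_gain \<rho> \<mu> (Q t) (G t) (C t))"
    unfolding elimination_gain_def
    by (rule cont.mat_entries_smult[OF cont.const cont.mat_entries_mult[OF entries(2)
          cont.mat_entries_mult[OF cont.mat_entries_inv[OF S_entries det] cont.mat_entries_transpose[OF entries(3)]]]])
  then have "continuous_mat_on S p q (\<lambda>t. elimination_gain \<rho> \<mu> (Q t) (G t) (C t))"
    by (simp only: continuous_mat_on_iff)
  then show ?thesis
    using neg by (intro exI conjI ballI impI)
qed

section \<open>Elimination for the jump inequality\<close>

lemma append_vec_empty: "v \<in> carrier_vec 0 \<Longrightarrow> x @\<^sub>v v = x"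
  by (rule eq_vecI) auto

lemma scalar_prod_append_zero:
  fixes a b x :: "real vec"
  assumes "a \<in> carrier_vec n" "b \<in> carrier_vec k" "x \<in> carrier_vec n"
  shows "(a @\<^sub>v b) \<bullet> (x @\<^sub>v 0\<^sub>v k) = a \<bullet> x" "(x @\<^sub>v 0\<^sub>v k) \<bullet> (a @\<^sub>v b) = x \<bullet> a"
  using scalar_prod_append[OF assms(1,2,3), of "0\<^sub>v k"] scalar_prod_append[OF assms(3) _ assms(1,2), of "0\<^sub>v k"] assms(2)
  by simp_all

lemma two_block_form:
  fixes R P M :: "real mat"
  assumes R: "R \<in> carrier_mat n n" and M: "M \<in> carrier_mat k n" and P: "P \<in> carrier_mat k k"
    and a: "a \<in> carrier_vec n" and b: "b \<in> carrier_vec k"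
  shows "(a @\<^sub>v b) \<bullet> (four_block_mat R M\<^sup>T M P *\<^sub>v (a @\<^sub>v b)) =
    a \<bullet> (R *\<^sub>v a) + 2 * (b \<bullet> (M *\<^sub>v a)) + b \<bullet> (P *\<^sub>v b)"
proof -
  have MT: "M\<^sup>T \<in> carrier_mat n k" using M by simp
  note car = mult_mat_vec_carrier[OF R a] mult_mat_vec_carrier[OF MT b] mult_mat_vec_carrier[OF M a]
    mult_mat_vec_carrier[OF P b]
  have "a \<bullet> (M\<^sup>T *\<^sub>v b) = b \<bullet> (M *\<^sub>v a)"
    using scalar_prod_mult_transpose[OF M a b] comm_scalar_prod[OF car(3) b] by (rule trans)
  then show ?thesis
    by (simp add: four_block_mat_mult_vec[OF R MT M P a b]
        scalar_prod_append[OF a b add_carrier_vec[OF car(1,2)] add_carrier_vec[OF car(3,4)]]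
        scalar_prod_add_distrib[OF a car(1,2)] scalar_prod_add_distrib[OF b car(3,4)])
qed

lemma pos_def_form_nonneg:
  fixes M :: "real mat" and v :: "real vec"
  assumes "M \<in> carrier_mat n n" "pos_def M" "v \<in> carrier_vec n"
  shows "v \<bullet> (M *\<^sub>v v) \<ge> 0" "v \<noteq> 0\<^sub>v n \<Longrightarrow> v \<bullet> (M *\<^sub>v v) > 0"
proof -
  show pos: "v \<bullet> (M *\<^sub>v v) > 0" if "v \<noteq> 0\<^sub>v n"
    using assms(2,3) that unfolding pos_def_iff[OF assms(1)] by blast
  show "v \<bullet> (M *\<^sub>v v) \<ge> 0"
  proof (cases "v = 0\<^sub>v n")
    case True
    then show ?thesis using assms(1) by (simp add: mult_mat_vec_zero)
  next
    case False
    then show ?thesis using pos by simp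
  qed
qed

lemma pos_def_symmetric: "pos_def M \<Longrightarrow> M\<^sup>T = M"
  by (simp add: pos_def_def)

text \<open>Let T be A + G^T K C. The inequality T^T P T < R is quadratic in K, but the requirement
  2 (P w)^T T v < v^T R v + w^T P w for all w is affine in K and gives it back at w = T v. So the
  elimination runs on pairs (v, w). The hypothesis on ker C is the original inequality without gain.
  The one for G P w = 0 stays in the doubled form, because that is the form in which the dual
  inequality for Y can be brought in.\<close>

lemma continuous_jump_elimination:
  fixes P A G C :: "real mat" and R :: "real \<Rightarrow> real mat"
  assumes S: "compact S" and P: "P \<in> carrier_mat N N" "pos_def P"
    and R: "continuous_mat_on S N N R" "\<And>t. t \<in> S \<Longrightarrow> pos_def (R t)"
    and A: "A \<in> carrier_mat N N" and G: "G \<in> carrier_mat p N" and C: "C \<in> carrier_mat q N"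
    and hC: "\<And>t (v :: real vec). t \<in> S \<Longrightarrow> v \<in> carrier_vec N \<Longrightarrow> v \<noteq> 0\<^sub>v N \<Longrightarrow> C *\<^sub>v v = 0\<^sub>v q \<Longrightarrow>
      (A *\<^sub>v v) \<bullet> (P *\<^sub>v (A *\<^sub>v v)) < v \<bullet> (R t *\<^sub>v v)"
    and hG: "\<And>t (v :: real vec) (w :: real vec). t \<in> S \<Longrightarrow> v \<in> carrier_vec N \<Longrightarrow> w \<in> carrier_vec N \<Longrightarrow> w \<noteq> 0\<^sub>v N \<Longrightarrow>
      G *\<^sub>v (P *\<^sub>v w) = 0\<^sub>v p \<Longrightarrow> 2 * ((P *\<^sub>v w) \<bullet> (A *\<^sub>v v)) < v \<bullet> (R t *\<^sub>v v) + w \<bullet> (P *\<^sub>v w)"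
  shows "\<exists>K. continuous_mat_on S p q K \<and>
      (\<forall>t\<in>S. \<forall>v\<in>carrier_vec N. \<forall>w\<in>carrier_vec N. v \<noteq> 0\<^sub>v N \<longrightarrow>
        2 * ((P *\<^sub>v w) \<bullet> (A *\<^sub>v v) + (G *\<^sub>v (P *\<^sub>v w)) \<bullet> (K t *\<^sub>v (C *\<^sub>v v))) <
        v \<bullet> (R t *\<^sub>v v) + w \<bullet> (P *\<^sub>v w))"
proof -
  let ?Q = "\<lambda>t. four_block_mat (- R t) (P * A)\<^sup>T (P * A) (- P)"
  \<comment> \<open>Blocks without rows complete the block rows [0, G P] and [C, 0] to the
    four-block format; this is where the dimensions p + 0 and q + 0 come from.\<close>
  let ?G = "four_block_mat (0\<^sub>m p N) (G * P) (0\<^sub>m 0 N) (0\<^sub>m 0 N)"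
  let ?C = "four_block_mat C (0\<^sub>m q N) (0\<^sub>m 0 N) (0\<^sub>m 0 N)"
  have PA: "P * A \<in> carrier_mat N N" by (rule mult_carrier_mat[OF P(1) A])
  have PAT: "(P * A)\<^sup>T \<in> carrier_mat N N" using PA by simp
  have GP: "G * P \<in> carrier_mat p N" by (rule mult_carrier_mat[OF G P(1)])
  have mP: "- P \<in> carrier_mat N N" using P(1) by simp
  have Rt: "R t \<in> carrier_mat N N" if "t \<in> S" for t
    using R(1) that by (simp add: continuous_mat_on_def)
  have Z: "0\<^sub>m p N \<in> carrier_mat p N" "0\<^sub>m q N \<in> carrier_mat q N" "0\<^sub>m 0 N \<in> carrier_mat 0 N" by simp_all
  have Psym: "P\<^sup>T = P" by (rule pos_def_symmetric[OF P(2)])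
  have Qcont: "continuous_mat_on S (N + N) (N + N) ?Q"
    unfolding continuous_mat_on_iff
    by (intro cont.mat_entries_four_block cont.mat_entries_uminus cont.mat_entries_const PA PAT P(1)
        R(1)[unfolded continuous_mat_on_iff])
  have Gcar: "?G \<in> carrier_mat (p + 0) (N + N)" and Ccar: "?C \<in> carrier_mat (q + 0) (N + N)"
    by (rule four_block_carrier_mat[OF Z(1,3)], rule four_block_carrier_mat[OF C Z(3)])
  have GCcont: "continuous_mat_on S (p + 0) (N + N) (\<lambda>_. ?G)" "continuous_mat_on S (q + 0) (N + N) (\<lambda>_. ?C)"
    unfolding continuous_mat_on_iff by (rule cont.mat_entries_const[OF Gcar], rule cont.mat_entries_const[OF Ccar])
  have sym: "(?Q t)\<^sup>T = ?Q t" if t: "t \<in> S" for t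
  proof -
    have mR: "- R t \<in> carrier_mat N N" using Rt[OF t] by simp
    have "(- R t)\<^sup>T = - R t" "(- P)\<^sup>T = - P"
      using pos_def_symmetric[OF R(2)[OF t]] Psym by (simp_all add: transpose_uminus)
    then show ?thesis
      by (simp only: transpose_four_block_mat[OF mR PAT PA mP] transpose_transpose)
  qed
  have form: "(v @\<^sub>v w) \<bullet> (?Q t *\<^sub>v (v @\<^sub>v w)) =
      2 * ((P *\<^sub>v w) \<bullet> (A *\<^sub>v v)) - v \<bullet> (R t *\<^sub>v v) - w \<bullet> (P *\<^sub>v w)"
    if t: "t \<in> S" and v: "v \<in> carrier_vec N" and w: "w \<in> carrier_vec N" for t and v w :: "real vec"
  proof -
    have mR: "- R t \<in> carrier_mat N N" using Rt[OF t] by simp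
    have Av: "A *\<^sub>v v \<in> carrier_vec N" by (rule mult_mat_vec_carrier[OF A v])
    have "w \<bullet> ((P * A) *\<^sub>v v) = (P *\<^sub>v w) \<bullet> (A *\<^sub>v v)"
      using scalar_prod_mult_transpose[OF P(1) w Av] by (simp only: assoc_mult_mat_vec[OF P(1) A v] Psym)
    moreover have "v \<bullet> (- R t *\<^sub>v v) = - (v \<bullet> (R t *\<^sub>v v))" "w \<bullet> (- P *\<^sub>v w) = - (w \<bullet> (P *\<^sub>v w))"
      using Rt[OF t] P(1) v w by simp_all
    ultimately show ?thesis
      by (simp add: two_block_form[OF mR PA mP v w])
  qed
  have Gvw: "?G *\<^sub>v (v @\<^sub>v w) = G *\<^sub>v (P *\<^sub>v w)" and Cvw: "?C *\<^sub>v (v @\<^sub>v w) = C *\<^sub>v v"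
    if v: "v \<in> carrier_vec N" and w: "w \<in> carrier_vec N" for v w :: "real vec"
  proof -
    have GPw: "G *\<^sub>v (P *\<^sub>v w) \<in> carrier_vec p" and Cv: "C *\<^sub>v v \<in> carrier_vec q"
      by (rule mult_mat_vec_carrier[OF G mult_mat_vec_carrier[OF P(1) w]], rule mult_mat_vec_carrier[OF C v])
    have zero: "0\<^sub>m p N *\<^sub>v v = 0\<^sub>v p" "0\<^sub>m q N *\<^sub>v w = 0\<^sub>v q"
      using v w by (auto intro!: eq_vecI)
    have e: "0\<^sub>m 0 N *\<^sub>v v + 0\<^sub>m 0 N *\<^sub>v w \<in> carrier_vec 0"
      by (rule add_carrier_vec[OF mult_mat_vec_carrier[OF Z(3) v] mult_mat_vec_carrier[OF Z(3) w]])
    show "?G *\<^sub>v (v @\<^sub>v w) = G *\<^sub>v (P *\<^sub>v w)"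
      using GPw by (simp only: four_block_mat_mult_vec[OF Z(1) GP Z(3) Z(3) v w] append_vec_empty[OF e]
          zero left_zero_vec assoc_mult_mat_vec[OF G P(1) w])
    show "?C *\<^sub>v (v @\<^sub>v w) = C *\<^sub>v v"
      using Cv by (simp only: four_block_mat_mult_vec[OF C Z(2) Z(3) Z(3) v w] append_vec_empty[OF e]
          zero right_zero_vec)
  qed
  have "\<exists>K. continuous_mat_on S (p + 0) (q + 0) K \<and> (\<forall>t\<in>S. \<forall>V\<in>carrier_vec (N + N). V \<noteq> 0\<^sub>v (N + N) \<longrightarrow>
      V \<bullet> (?Q t *\<^sub>v V) + 2 * ((?G *\<^sub>v V) \<bullet> (K t *\<^sub>v (?C *\<^sub>v V))) < 0)"
  proof (rule continuous_elimination[OF S Qcont sym GCcont])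
    fix t and V :: "real vec" assume t: "t \<in> S" and V: "V \<in> carrier_vec (N + N)" "V \<noteq> 0\<^sub>v (N + N)"
    obtain v w :: "real vec" where v: "v \<in> carrier_vec N" and w: "w \<in> carrier_vec N" and Veq: "V = v @\<^sub>v w"
      using append_vec_cases[OF V(1)] .
    have nz: "\<not> (v = 0\<^sub>v N \<and> w = 0\<^sub>v N)"
      using V(2) append_vec_eq_zero_iff[OF v w] Veq by blast
    have vR: "v \<bullet> (R t *\<^sub>v v) \<ge> 0" "v \<noteq> 0\<^sub>v N \<Longrightarrow> v \<bullet> (R t *\<^sub>v v) > 0"
      by (rule pos_def_form_nonneg[OF Rt[OF t] R(2)[OF t] v])+
    have wP: "w \<bullet> (P *\<^sub>v w) \<ge> 0" "w \<noteq> 0\<^sub>v N \<Longrightarrow> w \<bullet> (P *\<^sub>v w) > 0"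
      by (rule pos_def_form_nonneg[OF P w])+
    have Pw: "P *\<^sub>v w \<in> carrier_vec N" and Av: "A *\<^sub>v v \<in> carrier_vec N"
      by (rule mult_mat_vec_carrier[OF P(1) w], rule mult_mat_vec_carrier[OF A v])
    show "V \<bullet> (?Q t *\<^sub>v V) < 0" if "?G *\<^sub>v V = 0\<^sub>v (p + 0)"
    \<comment> \<open>The hypothesis \<open>hG\<close> speaks of nonzero w. For w = 0 the form is -
      v^T R v with v nonzero.\<close>
    proof (cases "w = 0\<^sub>v N")
      case True
      then have "P *\<^sub>v w = 0\<^sub>v N" by (simp only: mult_mat_vec_zero[OF P(1)])
      then have "(P *\<^sub>v w) \<bullet> (A *\<^sub>v v) = 0" using Av by simp
      then show ?thesis
        using form[OF t v w] vR(2) wP(1) nz True unfolding Veq by linarith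
    next
      case False
      have "G *\<^sub>v (P *\<^sub>v w) = 0\<^sub>v p" using that unfolding Veq Gvw[OF v w] by simp
      from hG[OF t v w False this] show ?thesis
        unfolding Veq form[OF t v w] by linarith
    qed
    show "V \<bullet> (?Q t *\<^sub>v V) < 0" if "?C *\<^sub>v V = 0\<^sub>v (q + 0)"
    proof (cases "v = 0\<^sub>v N")
      case True
      then have "A *\<^sub>v v = 0\<^sub>v N" by (simp only: mult_mat_vec_zero[OF A])
      then have "(P *\<^sub>v w) \<bullet> (A *\<^sub>v v) = 0" using Pw by simp
      then show ?thesis
        using form[OF t v w] vR(1) wP(2) nz True unfolding Veq by linarith
    next
      case False
      let ?u = "A *\<^sub>v v"
      have "C *\<^sub>v v = 0\<^sub>v q" using that unfolding Veq Cvw[OF v w] by simp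
      note less = hC[OF t v False this]
      have d: "w - ?u \<in> carrier_vec N" using w Av by simp
      have Pu: "P *\<^sub>v ?u \<in> carrier_vec N" by (rule mult_mat_vec_carrier[OF P(1) Av])
      \<comment> \<open>Completing the square: 2 (P w)^T A v is at most w^T P w + (A v)^T P (A v),
        and the last term is below v^T R v by \<open>hC\<close>.\<close>
      have "0 \<le> (w - ?u) \<bullet> (P *\<^sub>v (w - ?u))"
        by (rule pos_def_form_nonneg(1)[OF P d])
      also have "\<dots> = w \<bullet> (P *\<^sub>v w) - w \<bullet> (P *\<^sub>v ?u) - (?u \<bullet> (P *\<^sub>v w) - ?u \<bullet> (P *\<^sub>v ?u))"
        by (simp add: mult_minus_distrib_mat_vec[OF P(1) w Av] minus_scalar_prod_distrib[OF w Av]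
            scalar_prod_minus_distrib[OF w Pw Pu] scalar_prod_minus_distrib[OF Av Pw Pu]
            minus_scalar_prod_distrib[OF w Av minus_carrier_vec[OF Pw Pu]])
      also have "w \<bullet> (P *\<^sub>v ?u) = (P *\<^sub>v w) \<bullet> ?u"
        using scalar_prod_mult_transpose[OF P(1) w Av] Psym by simp
      also have "?u \<bullet> (P *\<^sub>v w) = (P *\<^sub>v w) \<bullet> ?u"
        by (rule comm_scalar_prod[OF Av Pw])
      finally show ?thesis
        unfolding Veq form[OF t v w] using less by linarith
    qed
  qed
  then obtain K where K: "continuous_mat_on S (p + 0) (q + 0) K"
    and K_all: "\<forall>t\<in>S. \<forall>V\<in>carrier_vec (N + N). V \<noteq> 0\<^sub>v (N + N) \<longrightarrow>
      V \<bullet> (?Q t *\<^sub>v V) + 2 * ((?G *\<^sub>v V) \<bullet> (K t *\<^sub>v (?C *\<^sub>v V))) < 0"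
    by (elim exE conjE)
  note KV = K_all[THEN bspec, THEN bspec, THEN mp]
  show ?thesis
  proof (intro exI conjI ballI impI)
    show "continuous_mat_on S p q K" using K by simp
    fix t and v w :: "real vec"
    assume t: "t \<in> S" and w: "w \<in> carrier_vec N" and v: "v \<in> carrier_vec N" "v \<noteq> 0\<^sub>v N"
    have "v @\<^sub>v w \<noteq> 0\<^sub>v (N + N)"
      using append_vec_eq_zero_iff[OF v(1) w] v(2) by blast
    from KV[OF t append_carrier_vec[OF v(1) w] this]
    show "2 * ((P *\<^sub>v w) \<bullet> (A *\<^sub>v v) + (G *\<^sub>v (P *\<^sub>v w)) \<bullet> (K t *\<^sub>v (C *\<^sub>v v))) <
        v \<bullet> (R t *\<^sub>v v) + w \<bullet> (P *\<^sub>v w)"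
      unfolding form[OF t v(1) w] Gvw[OF v(1) w] Cvw[OF v(1) w] by (simp only: distrib_left)
  qed
qed

section \<open>The closed loop\<close>

text \<open>The gains are frozen at one clock value, so that \<open>closed_loop_flow\<close> and
  \<open>closed_loop_jump\<close> are both instances and share one set of lemmas.\<close>

definition closed_loop ::
  "real mat \<Rightarrow> real mat \<Rightarrow> real mat \<Rightarrow> real mat \<Rightarrow> real mat \<Rightarrow> real mat \<Rightarrow> real mat \<Rightarrow> real mat" where
  "closed_loop A B C Ac Bc Cc Dc = four_block_mat (A + B * Dc * C) (B * Cc) (Bc * C) Ac"

context
  fixes A B C Ac Bc Cc Dc :: "real mat" and n m q k :: nat
  assumes plant: "A \<in> carrier_mat n n" "B \<in> carrier_mat n m" "C \<in> carrier_mat q n"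
    and gains: "Ac \<in> carrier_mat k k" "Bc \<in> carrier_mat k q" "Cc \<in> carrier_mat m k" "Dc \<in> carrier_mat m q"
begin

lemma closed_loop_blocks:
  "A + B * Dc * C \<in> carrier_mat n n" "B * Cc \<in> carrier_mat n k" "Bc * C \<in> carrier_mat k n"
proof -
  note BDC = mult_carrier_mat[OF mult_carrier_mat[OF plant(2) gains(4)] plant(3)]
  show "A + B * Dc * C \<in> carrier_mat n n" by (rule add_carrier_mat[OF BDC])
  show "B * Cc \<in> carrier_mat n k" by (rule mult_carrier_mat[OF plant(2) gains(3)])
  show "Bc * C \<in> carrier_mat k n" by (rule mult_carrier_mat[OF gains(2) plant(3)])
qed

lemma closed_loop_carrier: "closed_loop A B C Ac Bc Cc Dc \<in> carrier_mat (n + k) (n + k)"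
  unfolding closed_loop_def by (rule four_block_carrier_mat[OF closed_loop_blocks(1) gains(1)])

lemma closed_loop_mult_vec:
  assumes a: "a \<in> carrier_vec n" and b: "b \<in> carrier_vec k"
  shows "closed_loop A B C Ac Bc Cc Dc *\<^sub>v (a @\<^sub>v b) =
    (A *\<^sub>v a + B *\<^sub>v (Cc *\<^sub>v b + Dc *\<^sub>v (C *\<^sub>v a))) @\<^sub>v (Ac *\<^sub>v b + Bc *\<^sub>v (C *\<^sub>v a))"
proof -
  note Ca = mult_mat_vec_carrier[OF plant(3) a]
  note BD = mult_carrier_mat[OF plant(2) gains(4)]
  note Aa = mult_mat_vec_carrier[OF plant(1) a]
  note DCa = mult_mat_vec_carrier[OF gains(4) Ca]
  note Ccb = mult_mat_vec_carrier[OF gains(3) b]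
  note BDCa = mult_mat_vec_carrier[OF plant(2) DCa]
  note BCcb = mult_mat_vec_carrier[OF plant(2) Ccb]
  have "(A + B * Dc * C) *\<^sub>v a + (B * Cc) *\<^sub>v b = A *\<^sub>v a + B *\<^sub>v (Dc *\<^sub>v (C *\<^sub>v a)) + B *\<^sub>v (Cc *\<^sub>v b)"
    by (simp only: add_mult_distrib_mat_vec[OF plant(1) mult_carrier_mat[OF BD plant(3)] a]
        assoc_mult_mat_vec[OF BD plant(3) a] assoc_mult_mat_vec[OF plant(2) gains(4) Ca]
        assoc_mult_mat_vec[OF plant(2) gains(3) b])
  also have "\<dots> = A *\<^sub>v a + (B *\<^sub>v (Cc *\<^sub>v b) + B *\<^sub>v (Dc *\<^sub>v (C *\<^sub>v a)))"
    by (simp only: assoc_add_vec[OF Aa BDCa BCcb] comm_add_vec[OF BDCa BCcb])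
  also have "\<dots> = A *\<^sub>v a + B *\<^sub>v (Cc *\<^sub>v b + Dc *\<^sub>v (C *\<^sub>v a))"
    by (simp only: mult_add_distrib_mat_vec[OF plant(2) Ccb DCa])
  finally have 1: "(A + B * Dc * C) *\<^sub>v a + (B * Cc) *\<^sub>v b = A *\<^sub>v a + B *\<^sub>v (Cc *\<^sub>v b + Dc *\<^sub>v (C *\<^sub>v a))" .
  have 2: "(Bc * C) *\<^sub>v a + Ac *\<^sub>v b = Ac *\<^sub>v b + Bc *\<^sub>v (C *\<^sub>v a)"
    by (simp only: assoc_mult_mat_vec[OF gains(2) plant(3) a]
        comm_add_vec[OF mult_mat_vec_carrier[OF gains(2) Ca] mult_mat_vec_carrier[OF gains(1) b]])
  show ?thesis
    unfolding closed_loop_def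
    by (simp only: four_block_mat_mult_vec[OF closed_loop_blocks(1,2,3) gains(1) a b] 1 2)
qed

lemma closed_loop_scalar_prod:
  assumes a: "a \<in> carrier_vec n" and b: "b \<in> carrier_vec k"
    and z1: "z1 \<in> carrier_vec n" and z2: "z2 \<in> carrier_vec k"
  shows "(z1 @\<^sub>v z2) \<bullet> (closed_loop A B C Ac Bc Cc Dc *\<^sub>v (a @\<^sub>v b)) =
    z1 \<bullet> (A *\<^sub>v a) + (B\<^sup>T *\<^sub>v z1) \<bullet> (Cc *\<^sub>v b + Dc *\<^sub>v (C *\<^sub>v a)) + z2 \<bullet> (Ac *\<^sub>v b + Bc *\<^sub>v (C *\<^sub>v a))"
proof -
  note Ca = mult_mat_vec_carrier[OF plant(3) a]
  note Aa = mult_mat_vec_carrier[OF plant(1) a]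
  note u = add_carrier_vec[OF mult_mat_vec_carrier[OF gains(3) b] mult_mat_vec_carrier[OF gains(4) Ca]]
  note Bu = mult_mat_vec_carrier[OF plant(2) u]
  note xc = add_carrier_vec[OF mult_mat_vec_carrier[OF gains(1) b] mult_mat_vec_carrier[OF gains(2) Ca]]
  show ?thesis
    by (simp only: closed_loop_mult_vec[OF a b] scalar_prod_append[OF z1 z2 add_carrier_vec[OF Aa Bu] xc]
        scalar_prod_add_distrib[OF z1 Aa Bu] transpose_vec_mult_scalar[OF plant(2) u z1])
qed

end

text \<open>
  Viewing the controller gains as one matrix acting from \<open>(x\<^sub>c, y)\<close> to \<open>(x\<^sub>c', u)\<close>, the maps
  \<open>(x, x\<^sub>c) \<mapsto> (x\<^sub>c, y)\<close> and, transposed, \<open>(x\<^sub>c', u) \<mapsto> (x, x\<^sub>c)\<close> are of this form.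
\<close>
definition channel :: "nat \<Rightarrow> real mat \<Rightarrow> real mat" where
  "channel n M = four_block_mat (0\<^sub>m n n) (1\<^sub>m n) M (0\<^sub>m (dim_row M) n)"

lemma channel_carrier: "M \<in> carrier_mat k n \<Longrightarrow> channel n M \<in> carrier_mat (n + k) (n + n)"
  by (simp add: channel_def)

lemma channel_mult_vec:
  assumes M: "M \<in> carrier_mat k n" and a: "a \<in> carrier_vec n" and b: "b \<in> carrier_vec n"
  shows "channel n M *\<^sub>v (a @\<^sub>v b) = b @\<^sub>v (M *\<^sub>v a)"
proof -
  have Z: "0\<^sub>m n n \<in> carrier_mat n n" "1\<^sub>m n \<in> carrier_mat n n" "0\<^sub>m k n \<in> carrier_mat k n"
    by simp_all
  have zero: "0\<^sub>m n n *\<^sub>v a = 0\<^sub>v n" "0\<^sub>m k n *\<^sub>v b = 0\<^sub>v k"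
    using a b by (auto intro!: eq_vecI)
  show ?thesis
    using mult_mat_vec_carrier[OF M a] b
    by (simp only: channel_def carrier_matD(1)[OF M] four_block_mat_mult_vec[OF Z(1,2) M Z(3) a b] zero
        left_zero_vec right_zero_vec one_mult_mat_vec)
qed

text \<open>Identifies the vectors on which the elimination tests its hypotheses: the controller
  part vanishes and the plant part lies in the kernel named in the theorem.\<close>

lemma channel_eq_zero:
  assumes M: "M \<in> carrier_mat k n" and a: "a \<in> carrier_vec n" and b: "b \<in> carrier_vec n"
    and "channel n M *\<^sub>v (a @\<^sub>v b) = 0\<^sub>v (n + k)"
  shows "b = 0\<^sub>v n" "a \<in> mat_kernel M"
proof -
  have "b = 0\<^sub>v n \<and> M *\<^sub>v a = 0\<^sub>v k"
    using assms(4) append_vec_eq_zero_iff[OF b mult_mat_vec_carrier[OF M a]]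
    by (simp only: channel_mult_vec[OF M a b])
  then show "b = 0\<^sub>v n" "a \<in> mat_kernel M"
    using mat_kernelI[OF M a] by blast+
qed

lemma split_gain:
  assumes K: "continuous_mat_on S (n + m) (n + q) K"
  obtains Ac Bc Cc Dc where "continuous_mat_on S n n Ac" "continuous_mat_on S n q Bc"
    "continuous_mat_on S m n Cc" "continuous_mat_on S m q Dc"
    "\<And>t. t \<in> S \<Longrightarrow> K t = four_block_mat (Ac t) (Bc t) (Cc t) (Dc t)"
proof -
  let ?sub = "\<lambda>r c i0 j0 t. Matrix.mat r c (\<lambda>(i, j). K t $$ (i0 + i, j0 + j))"
  note K' = K[unfolded continuous_mat_on_iff]
  have sub: "continuous_mat_on S r c (?sub r c i0 j0)" if "i0 + r \<le> n + m" "j0 + c \<le> n + q" for r c i0 j0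
    unfolding continuous_mat_on_iff
    by (rule cont.mat_entries_submatrix[OF K', of r "\<lambda>i. i0 + i" c "\<lambda>j. j0 + j"]) (use that in simp_all)
  have eq: "K t = four_block_mat (?sub n n 0 0 t) (?sub n q 0 n t) (?sub m n n 0 t) (?sub m q n n t)"
    if t: "t \<in> S" for t
    using cont.mat_entries_carrier[OF K' t] by (intro eq_matI) (auto simp: Let_def)
  show ?thesis
  proof (rule that)
    show "continuous_mat_on S n n (?sub n n 0 0)" "continuous_mat_on S n q (?sub n q 0 n)"
      "continuous_mat_on S m n (?sub m n n 0)" "continuous_mat_on S m q (?sub m q n n)"
      by (rule sub; simp)+
    fix t assume "t \<in> S"
    then show "K t = four_block_mat (?sub n n 0 0 t) (?sub n q 0 n t) (?sub m n n 0 t) (?sub m q n n t)"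
      by (rule eq)
  qed
qed

text \<open>The closed loop is affine in the stacked gain, which is the shape that the elimination
  can solve. The controller state has the plant dimension n here, in accordance with
  \<open>channel\<close>.\<close>

lemma closed_loop_as_channel:
  fixes n m q :: nat
  assumes plant: "A \<in> carrier_mat n n" "B \<in> carrier_mat n m" "C \<in> carrier_mat q n"
    and gains: "Ac \<in> carrier_mat n n" "Bc \<in> carrier_mat n q" "Cc \<in> carrier_mat m n" "Dc \<in> carrier_mat m q"
    and z: "z \<in> carrier_vec (n + n)" and v: "v \<in> carrier_vec (n + n)"
  shows "z \<bullet> (closed_loop A B C Ac Bc Cc Dc *\<^sub>v v) =
    z \<bullet> (four_block_mat A (0\<^sub>m n n) (0\<^sub>m n n) (0\<^sub>m n n) *\<^sub>v v) +
    (channel n B\<^sup>T *\<^sub>v z) \<bullet> (four_block_mat Ac Bc Cc Dc *\<^sub>v (channel n C *\<^sub>v v))"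
proof -
  obtain a b where a: "a \<in> carrier_vec n" and b: "b \<in> carrier_vec n" and v_eq: "v = a @\<^sub>v b"
    using append_vec_cases[OF v] .
  obtain z1 z2 where z1: "z1 \<in> carrier_vec n" and z2: "z2 \<in> carrier_vec n" and z_eq: "z = z1 @\<^sub>v z2"
    using append_vec_cases[OF z] .
  have BT: "B\<^sup>T \<in> carrier_mat m n" using plant(2) by simp
  note Ca = mult_mat_vec_carrier[OF plant(3) a] and Bz = mult_mat_vec_carrier[OF BT z1]
  note car = mult_mat_vec_carrier[OF gains(1) b] mult_mat_vec_carrier[OF gains(2) Ca]
    mult_mat_vec_carrier[OF gains(3) b] mult_mat_vec_carrier[OF gains(4) Ca]
  have Z: "(0\<^sub>m n n :: real mat) \<in> carrier_mat n n" by simp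
  note Aa = mult_mat_vec_carrier[OF plant(1) a]
  have zero: "(0\<^sub>m n n :: real mat) *\<^sub>v a = 0\<^sub>v n" "(0\<^sub>m n n :: real mat) *\<^sub>v b = 0\<^sub>v n"
    using a b by (auto intro!: eq_vecI)
  have "z \<bullet> (four_block_mat A (0\<^sub>m n n) (0\<^sub>m n n) (0\<^sub>m n n) *\<^sub>v v) = z1 \<bullet> (A *\<^sub>v a)"
    using Aa unfolding v_eq z_eq
    by (simp add: four_block_mat_mult_vec[OF plant(1) Z Z Z a b] zero scalar_prod_append_zero[OF z1 z2 Aa])
  moreover have "(channel n B\<^sup>T *\<^sub>v z) \<bullet> (four_block_mat Ac Bc Cc Dc *\<^sub>v (channel n C *\<^sub>v v)) =
      z2 \<bullet> (Ac *\<^sub>v b + Bc *\<^sub>v (C *\<^sub>v a)) + (B\<^sup>T *\<^sub>v z1) \<bullet> (Cc *\<^sub>v b + Dc *\<^sub>v (C *\<^sub>v a))"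
    unfolding v_eq z_eq
    by (simp only: channel_mult_vec[OF BT z1 z2] channel_mult_vec[OF plant(3) a b]
        four_block_mat_mult_vec[OF gains b Ca]
        scalar_prod_append[OF z2 Bz add_carrier_vec[OF car(1,2)] add_carrier_vec[OF car(3,4)]])
  ultimately show ?thesis
    unfolding v_eq z_eq closed_loop_scalar_prod[OF plant gains a b z1 z2] by linarith
qed

section \<open>The matrix inequalities as quadratic forms\<close>

lemma lyapunov_form:
  fixes D X A :: "real mat"
  assumes D: "D \<in> carrier_mat n n" "D\<^sup>T = D" and X: "X \<in> carrier_mat n n" "X\<^sup>T = X" and A: "A \<in> carrier_mat n n"
  shows "D + A\<^sup>T * X + X * A \<in> carrier_mat n n" "(D + A\<^sup>T * X + X * A)\<^sup>T = D + A\<^sup>T * X + X * A"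
    and "v \<in> carrier_vec n \<Longrightarrow>
      v \<bullet> ((D + A\<^sup>T * X + X * A) *\<^sub>v v) = v \<bullet> (D *\<^sub>v v) + 2 * ((X *\<^sub>v v) \<bullet> (A *\<^sub>v v))"
proof -
  have AT: "A\<^sup>T \<in> carrier_mat n n" using A by simp
  note AX = mult_carrier_mat[OF AT X(1)] and XA = mult_carrier_mat[OF X(1) A]
  note DAX = add_carrier_mat[OF AX, of D]
  show "D + A\<^sup>T * X + X * A \<in> carrier_mat n n" by (rule add_carrier_mat[OF XA])
  have "(D + A\<^sup>T * X + X * A)\<^sup>T = D + X * A + A\<^sup>T * X"
    by (simp only: transpose_add[OF DAX XA] transpose_add[OF D(1) AX] transpose_mult[OF AT X(1)]
        transpose_mult[OF X(1) A] transpose_transpose D(2) X(2))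
  then show "(D + A\<^sup>T * X + X * A)\<^sup>T = D + A\<^sup>T * X + X * A"
    by (simp only: assoc_add_mat[OF D(1) XA AX] comm_add_mat[OF XA AX] assoc_add_mat[OF D(1) AX XA])
  assume v: "v \<in> carrier_vec n"
  note Xv = mult_mat_vec_carrier[OF X(1) v] and Av = mult_mat_vec_carrier[OF A v]
    and Dv = mult_mat_vec_carrier[OF D(1) v]
  note AXv = mult_mat_vec_carrier[OF AT Xv] and XAv = mult_mat_vec_carrier[OF X(1) Av]
  have "(A *\<^sub>v v) \<bullet> (X *\<^sub>v v) = (X *\<^sub>v v) \<bullet> (A *\<^sub>v v)"
    by (rule comm_scalar_prod[OF Av Xv])
  moreover have "v \<bullet> (X *\<^sub>v (A *\<^sub>v v)) = (X *\<^sub>v v) \<bullet> (A *\<^sub>v v)"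
    using scalar_prod_mult_transpose[OF X(1) v Av] X(2) by simp
  ultimately show "v \<bullet> ((D + A\<^sup>T * X + X * A) *\<^sub>v v) = v \<bullet> (D *\<^sub>v v) + 2 * ((X *\<^sub>v v) \<bullet> (A *\<^sub>v v))"
    by (simp only: add_mult_distrib_mat_vec[OF DAX XA v] add_mult_distrib_mat_vec[OF D(1) AX v]
        assoc_mult_mat_vec[OF AT X(1) v] assoc_mult_mat_vec[OF X(1) A v]
        scalar_prod_add_distrib[OF v add_carrier_vec[OF Dv AXv] XAv] scalar_prod_add_distrib[OF v Dv AXv]
        scalar_prod_mult_transpose[OF A v Xv])
qed

lemma stein_form:
  fixes P R A :: "real mat"
  assumes P: "P \<in> carrier_mat n n" "P\<^sup>T = P" and R: "R \<in> carrier_mat n n" "R\<^sup>T = R" and A: "A \<in> carrier_mat n n"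
  shows "A\<^sup>T * P * A - R \<in> carrier_mat n n" "(A\<^sup>T * P * A - R)\<^sup>T = A\<^sup>T * P * A - R"
    and "v \<in> carrier_vec n \<Longrightarrow>
      v \<bullet> ((A\<^sup>T * P * A - R) *\<^sub>v v) = (A *\<^sub>v v) \<bullet> (P *\<^sub>v (A *\<^sub>v v)) - v \<bullet> (R *\<^sub>v v)"
proof -
  have AT: "A\<^sup>T \<in> carrier_mat n n" using A by simp
  note ATP = mult_carrier_mat[OF AT P(1)] and PA = mult_carrier_mat[OF P(1) A]
  note APA = mult_carrier_mat[OF ATP A]
  show "A\<^sup>T * P * A - R \<in> carrier_mat n n" by (rule minus_carrier_mat[OF R(1)])
  have "(A\<^sup>T * P * A)\<^sup>T = A\<^sup>T * P * A"
    by (simp only: transpose_mult[OF ATP A] transpose_mult[OF AT P(1)] transpose_transpose P(2))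
      (rule assoc_mult_mat[OF AT P(1) A, symmetric])
  then show "(A\<^sup>T * P * A - R)\<^sup>T = A\<^sup>T * P * A - R"
    by (simp only: transpose_minus[OF APA R(1)] R(2))
  assume v: "v \<in> carrier_vec n"
  note Av = mult_mat_vec_carrier[OF A v]
  note PAv = mult_mat_vec_carrier[OF P(1) Av]
  show "v \<bullet> ((A\<^sup>T * P * A - R) *\<^sub>v v) = (A *\<^sub>v v) \<bullet> (P *\<^sub>v (A *\<^sub>v v)) - v \<bullet> (R *\<^sub>v v)"
    by (simp only: minus_mult_distrib_mat_vec[OF APA R(1) v] assoc_mult_mat_vec[OF ATP A v]
        assoc_mult_mat_vec[OF AT P(1) Av]
        scalar_prod_minus_distrib[OF v mult_mat_vec_carrier[OF AT PAv] mult_mat_vec_carrier[OF R(1) v]]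
        scalar_prod_mult_transpose[OF A v PAv])
qed

lemma append_rows_mult_vec_form:
  fixes F11 F12 F22 L1 L2 :: "real mat"
  assumes F: "F11 \<in> carrier_mat n n" "F11\<^sup>T = F11" "F12 \<in> carrier_mat n n" "F12\<^sup>T = F12" "F22 \<in> carrier_mat n n" "F22\<^sup>T = F22"
    and L: "L1 \<in> carrier_mat n n" "L2 \<in> carrier_mat n n"
  shows "L1 @\<^sub>r L2 \<in> carrier_mat (n + n) n"
    and "four_block_mat F11 F12 F12 F22 \<in> carrier_mat (n + n) (n + n)"
    and "(four_block_mat F11 F12 F12 F22)\<^sup>T = four_block_mat F11 F12 F12 F22"
    and "x \<in> carrier_vec n \<Longrightarrow>
      ((L1 @\<^sub>r L2) *\<^sub>v x) \<bullet> (four_block_mat F11 F12 F12 F22 *\<^sub>v ((L1 @\<^sub>r L2) *\<^sub>v x)) =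
      (L1 *\<^sub>v x) \<bullet> (F11 *\<^sub>v (L1 *\<^sub>v x)) + 2 * ((L2 *\<^sub>v x) \<bullet> (F12 *\<^sub>v (L1 *\<^sub>v x))) + (L2 *\<^sub>v x) \<bullet> (F22 *\<^sub>v (L2 *\<^sub>v x))"
proof -
  show "L1 @\<^sub>r L2 \<in> carrier_mat (n + n) n" by (rule carrier_append_rows[OF L])
  show "four_block_mat F11 F12 F12 F22 \<in> carrier_mat (n + n) (n + n)"
    by (rule four_block_carrier_mat[OF F(1,5)])
  show "(four_block_mat F11 F12 F12 F22)\<^sup>T = four_block_mat F11 F12 F12 F22"
    by (simp only: transpose_four_block_mat[OF F(1,3,3,5)] F)
  assume x: "x \<in> carrier_vec n"
  note L1x = mult_mat_vec_carrier[OF L(1) x] and L2x = mult_mat_vec_carrier[OF L(2) x]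
  show "((L1 @\<^sub>r L2) *\<^sub>v x) \<bullet> (four_block_mat F11 F12 F12 F22 *\<^sub>v ((L1 @\<^sub>r L2) *\<^sub>v x)) =
      (L1 *\<^sub>v x) \<bullet> (F11 *\<^sub>v (L1 *\<^sub>v x)) + 2 * ((L2 *\<^sub>v x) \<bullet> (F12 *\<^sub>v (L1 *\<^sub>v x))) + (L2 *\<^sub>v x) \<bullet> (F22 *\<^sub>v (L2 *\<^sub>v x))"
    using two_block_form[OF F(1,3,5) L1x L2x] by (simp only: mat_mult_append[OF L x] F(4))
qed

lemma block_form_on_kernel:
  assumes M: "M \<in> carrier_mat k n" and U: "basis_matrix n (mat_kernel M) U"
    and F: "F11 \<in> carrier_mat n n" "F11\<^sup>T = F11" "F12 \<in> carrier_mat n n" "F12\<^sup>T = F12" "F22 \<in> carrier_mat n n" "F22\<^sup>T = F22"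
    and A: "A \<in> carrier_mat n n"
  shows "neg_def (U\<^sup>T * (1\<^sub>m n @\<^sub>r A)\<^sup>T * four_block_mat F11 F12 F12 F22 * (1\<^sub>m n @\<^sub>r A) * U) \<longleftrightarrow>
      (\<forall>x\<in>mat_kernel M. x \<noteq> 0\<^sub>v n \<longrightarrow>
        x \<bullet> (F11 *\<^sub>v x) + 2 * ((A *\<^sub>v x) \<bullet> (F12 *\<^sub>v x)) + (A *\<^sub>v x) \<bullet> (F22 *\<^sub>v (A *\<^sub>v x)) < 0)" (is ?primal)
    and "pos_def (U\<^sup>T * (- A\<^sup>T @\<^sub>r 1\<^sub>m n)\<^sup>T * four_block_mat F11 F12 F12 F22 * (- A\<^sup>T @\<^sub>r 1\<^sub>m n) * U) \<longleftrightarrow>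
      (\<forall>x\<in>mat_kernel M. x \<noteq> 0\<^sub>v n \<longrightarrow>
        (A\<^sup>T *\<^sub>v x) \<bullet> (F11 *\<^sub>v (A\<^sup>T *\<^sub>v x)) - 2 * ((A\<^sup>T *\<^sub>v x) \<bullet> (F12 *\<^sub>v x)) + x \<bullet> (F22 *\<^sub>v x) > 0)" (is ?dual)
proof -
  have I: "1\<^sub>m n \<in> carrier_mat n n" by simp
  have AT: "A\<^sup>T \<in> carrier_mat n n" and mAT: "- A\<^sup>T \<in> carrier_mat n n" using A by simp_all
  have ker: "x \<in> carrier_vec n" if "x \<in> mat_kernel M" for x
    by (rule mat_kernelD(1)[OF M that])
  note P = append_rows_mult_vec_form[OF F I A]
  note D = append_rows_mult_vec_form[OF F mAT I]
  have primal: "((1\<^sub>m n @\<^sub>r A) *\<^sub>v x) \<bullet> (four_block_mat F11 F12 F12 F22 *\<^sub>v ((1\<^sub>m n @\<^sub>r A) *\<^sub>v x)) =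
      x \<bullet> (F11 *\<^sub>v x) + 2 * ((A *\<^sub>v x) \<bullet> (F12 *\<^sub>v x)) + (A *\<^sub>v x) \<bullet> (F22 *\<^sub>v (A *\<^sub>v x))"
    if "x \<in> mat_kernel M" for x
    using ker[OF that] by (simp only: P(4) one_mult_mat_vec)
  show ?primal
    unfolding congruence_on_kernel(1)[OF M U P(1,2,3)]
    by (intro ball_cong refl imp_cong) (simp only: primal)
  have dual: "((- A\<^sup>T @\<^sub>r 1\<^sub>m n) *\<^sub>v x) \<bullet> (four_block_mat F11 F12 F12 F22 *\<^sub>v ((- A\<^sup>T @\<^sub>r 1\<^sub>m n) *\<^sub>v x)) =
      (A\<^sup>T *\<^sub>v x) \<bullet> (F11 *\<^sub>v (A\<^sup>T *\<^sub>v x)) - 2 * ((A\<^sup>T *\<^sub>v x) \<bullet> (F12 *\<^sub>v x)) + x \<bullet> (F22 *\<^sub>v x)"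
    if "x \<in> mat_kernel M" for x
  proof -
    note x = ker[OF that]
    note ATx = mult_mat_vec_carrier[OF AT x]
    note F11A = mult_mat_vec_carrier[OF F(1) ATx] and F12A = mult_mat_vec_carrier[OF F(3) ATx]
    have neg: "- A\<^sup>T *\<^sub>v x = (-1) \<cdot>\<^sub>v (A\<^sup>T *\<^sub>v x)"
      using AT x by (intro eq_vecI) auto
    have sF11: "(-1 \<cdot>\<^sub>v (A\<^sup>T *\<^sub>v x)) \<bullet> (-1 \<cdot>\<^sub>v (F11 *\<^sub>v (A\<^sup>T *\<^sub>v x))) = (A\<^sup>T *\<^sub>v x) \<bullet> (F11 *\<^sub>v (A\<^sup>T *\<^sub>v x))"
      using ATx F11A by simp
    have sF12: "x \<bullet> (-1 \<cdot>\<^sub>v (F12 *\<^sub>v (A\<^sup>T *\<^sub>v x))) = - (x \<bullet> (F12 *\<^sub>v (A\<^sup>T *\<^sub>v x)))"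
      using x F12A by simp
    have "x \<bullet> (F12 *\<^sub>v (A\<^sup>T *\<^sub>v x)) = (A\<^sup>T *\<^sub>v x) \<bullet> (F12 *\<^sub>v x)"
      by (rule symmetric_scalar_prod[OF F(3,4) x ATx])
    then show ?thesis
      unfolding D(4)[OF x] one_mult_mat_vec[OF x] neg mult_mat_vec[OF F(1) ATx] mult_mat_vec[OF F(3) ATx] sF11 sF12
      by linarith
  qed
  show ?dual
    unfolding congruence_on_kernel(2)[OF M U D(1,2,3)]
    by (intro ball_cong refl imp_cong) (simp only: dual)
qed

section \<open>Derivatives of quadratic forms and the coupling condition\<close>

lemma C1_mat_on_carrier: "C1_mat_on S r c F \<Longrightarrow> t \<in> S \<Longrightarrow> F t \<in> carrier_mat r c"
  by (simp add: C1_mat_on_def)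

lemma C1_mat_on_continuous:
  assumes "a < b" "C1_mat_on {a..b} r c F"
  shows "continuous_mat_on {a..b} r c F"
proof -
  have F: "C1.mat_entries {a..b} r c F"
    using assms C1_mat_on_iff by blast
  show ?thesis
    unfolding continuous_mat_on_iff cont.mat_entries_def
    using C1.mat_entries_carrier[OF F] C1_on_imp_continuous_on[OF C1.mat_entries_entry[OF F]] by blast
qed

lemma mat_deriv_symmetric:
  assumes ab: "a < b" and F: "C1_mat_on {a..b} n n F" and sym: "\<And>t. t \<in> {a..b} \<Longrightarrow> (F t)\<^sup>T = F t"
    and t: "t \<in> {a..b}"
  shows "(mat_deriv {a..b} F t)\<^sup>T = mat_deriv {a..b} F t"
proof (rule eq_matI)
  note car = mat_deriv_carrier[of F t, OF C1_mat_on_carrier[OF F t], where S="{a..b}"]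
  fix i j assume "i < dim_row (mat_deriv {a..b} F t)" "j < dim_col (mat_deriv {a..b} F t)"
  then have ij: "i < n" "j < n" using car by simp_all
  have swap: "F s $$ (j, i) = F s $$ (i, j)" if "s \<in> {a..b}" for s
  proof -
    have "F s $$ (j, i) = (F s)\<^sup>T $$ (i, j)"
      using C1_mat_on_carrier[OF F that] ij by simp
    then show ?thesis by (simp only: sym[OF that])
  qed
  have "((\<lambda>s. F s $$ (i, j)) has_real_derivative mat_deriv {a..b} F t $$ (j, i)) (at t within {a..b})"
    using C1_mat_on_has_derivative[OF F t ij(2,1)]
    by (rule has_field_derivative_transform_within[where d=1]) (simp_all only: t swap zero_less_one)
  then have "mat_deriv {a..b} F t $$ (j, i) = mat_deriv {a..b} F t $$ (i, j)"
    by (rule has_real_derivative_unique_Icc[OF ab t _ C1_mat_on_has_derivative[OF F t ij]])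
  then show "(mat_deriv {a..b} F t)\<^sup>T $$ (i, j) = mat_deriv {a..b} F t $$ (i, j)"
    using car ij by simp
next
  note car = mat_deriv_carrier[of F t, OF C1_mat_on_carrier[OF F t], where S="{a..b}"]
  show "dim_row (mat_deriv {a..b} F t)\<^sup>T = dim_row (mat_deriv {a..b} F t)"
    "dim_col (mat_deriv {a..b} F t)\<^sup>T = dim_col (mat_deriv {a..b} F t)"
    using car by simp_all
qed

text \<open>Transfers an identity of values to derivatives while the vectors stay fixed. The
  derivative of a block or corner matrix is thus never computed blockwise; it suffices to compare
  values along the interval.\<close>

lemma bilinear_form_deriv_cong:
  fixes u v x y :: "real vec"
  assumes ab: "a < b" and F: "C1_mat_on {a..b} r c F" and G: "C1_mat_on {a..b} k l G" and t: "t \<in> {a..b}"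
    and uv: "u \<in> carrier_vec r" "v \<in> carrier_vec c" and xy: "x \<in> carrier_vec k" "y \<in> carrier_vec l"
    and eq: "\<And>s. s \<in> {a..b} \<Longrightarrow> u \<bullet> (F s *\<^sub>v v) = d * (x \<bullet> (G s *\<^sub>v y))"
  shows "u \<bullet> (mat_deriv {a..b} F t *\<^sub>v v) = d * (x \<bullet> (mat_deriv {a..b} G t *\<^sub>v y))"
proof -
  have "((\<lambda>s. d * (x \<bullet> (G s *\<^sub>v y))) has_real_derivative d * (x \<bullet> (mat_deriv {a..b} G t *\<^sub>v y))) (at t within {a..b})"
    by (rule DERIV_cmult[OF bilinear_form_has_derivative[OF G t xy]])
  then have "((\<lambda>s. u \<bullet> (F s *\<^sub>v v)) has_real_derivative d * (x \<bullet> (mat_deriv {a..b} G t *\<^sub>v y))) (at t within {a..b})"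
    by (rule has_field_derivative_transform_within[where d=1]) (simp_all only: t eq zero_less_one)
  then show ?thesis
    by (rule has_real_derivative_unique_Icc[OF ab t bilinear_form_has_derivative[OF F t uv]])
qed

lemma C1_inv_mat:
  assumes ab: "a < b" and Y: "C1_mat_on {a..b} n n Y" and pd: "\<And>t. t \<in> {a..b} \<Longrightarrow> pos_def (Y t)"
  shows "C1_mat_on {a..b} n n (\<lambda>t. inv_mat (Y t))"
proof -
  have Y': "C1.mat_entries {a..b} n n Y" using Y by (simp only: C1_mat_on_iff[OF ab])
  have "C1.mat_entries {a..b} n n (\<lambda>t. inv_mat (Y t))"
    by (rule C1.mat_entries_inv[OF Y']) (rule pos_def_det_nonzero[OF C1.mat_entries_carrier[OF Y'] pd])
  then show ?thesis by (simp only: C1_mat_on_iff[OF ab])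
qed

text \<open>With W the inverse of Y, W' = - W Y' W, hence Y W' Y = - Y'. It is obtained from the
  constancy of Y W between x and z = Y(t) x, where z is frozen at time t and only the matrices
  vary.\<close>

lemma inv_mat_deriv_form:
  fixes x :: "real vec"
  assumes ab: "a < b" and Y: "C1_mat_on {a..b} n n Y" and pd: "\<And>t. t \<in> {a..b} \<Longrightarrow> pos_def (Y t)"
    and t: "t \<in> {a..b}" and x: "x \<in> carrier_vec n"
  shows "(Y t *\<^sub>v x) \<bullet> (mat_deriv {a..b} (\<lambda>t. inv_mat (Y t)) t *\<^sub>v (Y t *\<^sub>v x)) =
    - (x \<bullet> (mat_deriv {a..b} Y t *\<^sub>v x))"
proof -
  let ?S = "{a..b}" and ?W = "\<lambda>t. inv_mat (Y t)"
  note W = C1_inv_mat[OF ab Y pd]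
  have YW: "C1_mat_on ?S n n (\<lambda>s. Y s * ?W s)"
    using C1.mat_entries_mult[OF Y[unfolded C1_mat_on_iff[OF ab]] W[unfolded C1_mat_on_iff[OF ab]]]
    by (simp only: C1_mat_on_iff[OF ab])
  note Yt = C1_mat_on_carrier[OF Y t] and Wt = C1_mat_on_carrier[OF W t]
  note Y't = mat_deriv_carrier[of Y t, OF Yt, where S="?S"]
  note W't = mat_deriv_carrier[of ?W t, OF Wt, where S="?S"]
  define z where "z = Y t *\<^sub>v x"
  have z: "z \<in> carrier_vec n" unfolding z_def by (rule mult_mat_vec_carrier[OF Yt x])
  have Wz: "?W t *\<^sub>v z = x"
    unfolding z_def by (rule pos_def_inv_mat(4)[OF Yt pd[OF t] x])
  have const: "x \<bullet> ((Y s * ?W s) *\<^sub>v z) = x \<bullet> z" if s: "s \<in> ?S" for s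
    using inv_mat(2)[OF C1_mat_on_carrier[OF Y s] pos_def_det_nonzero[OF C1_mat_on_carrier[OF Y s] pd[OF s]]] z
    by simp
  have product: "mat_deriv ?S (\<lambda>s. Y s * ?W s) t = mat_deriv ?S Y t * ?W t + Y t * mat_deriv ?S ?W t"
    by (rule mat_deriv_mult[OF ab Y W t])
  have "((\<lambda>s. x \<bullet> ((Y s * ?W s) *\<^sub>v z)) has_real_derivative 0) (at t within ?S)"
    by (rule has_field_derivative_transform_within[where d=1 and f="\<lambda>_. x \<bullet> z"])
      (simp_all only: t const zero_less_one DERIV_const)
  then have "0 = x \<bullet> (mat_deriv ?S (\<lambda>s. Y s * ?W s) t *\<^sub>v z)"
    by (rule has_real_derivative_unique_Icc[OF ab t _ bilinear_form_has_derivative[OF YW t x z]])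
  also have "mat_deriv ?S (\<lambda>s. Y s * ?W s) t *\<^sub>v z = mat_deriv ?S Y t *\<^sub>v x + Y t *\<^sub>v (mat_deriv ?S ?W t *\<^sub>v z)"
    by (simp only: product add_mult_distrib_mat_vec[OF mult_carrier_mat[OF Y't Wt] mult_carrier_mat[OF Yt W't] z]
        assoc_mult_mat_vec[OF Y't Wt z] assoc_mult_mat_vec[OF Yt W't z] Wz)
  also have "x \<bullet> \<dots> = x \<bullet> (mat_deriv ?S Y t *\<^sub>v x) + x \<bullet> (Y t *\<^sub>v (mat_deriv ?S ?W t *\<^sub>v z))"
    by (rule scalar_prod_add_distrib[OF x mult_mat_vec_carrier[OF Y't x] mult_mat_vec_carrier[OF Yt mult_mat_vec_carrier[OF W't z]]])
  also have "x \<bullet> (Y t *\<^sub>v (mat_deriv ?S ?W t *\<^sub>v z)) = z \<bullet> (mat_deriv ?S ?W t *\<^sub>v z)"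
    using scalar_prod_mult_transpose[OF Yt x mult_mat_vec_carrier[OF W't z]]
    unfolding z_def by (simp only: pos_def_symmetric[OF pd[OF t]])
  finally show ?thesis unfolding z_def by linarith
qed

section \<open>The block Lyapunov matrix and the coupling condition\<close>

lemma minus_vec_eq_zero:
  fixes a b :: "real vec"
  assumes a: "a \<in> carrier_vec n" and b: "b \<in> carrier_vec n" and zero: "a - b = 0\<^sub>v n"
  shows "b = a"
proof (rule eq_vecI)
  show "dim_vec b = dim_vec a" using a b by simp
  fix i assume i: "i < dim_vec a"
  have "(a - b) $ i = 0" unfolding zero using i a by simp
  then show "b $ i = a $ i" using i a b by simp
qed

text \<open>The Schur complement of the lower right block is X - (W - X) (X - W)^(-1) (W - X) = W,
  so with W the inverse of Y the upper left corner of the inverse is Y, as the necessity part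
  demands. Taking the off-diagonal block to be minus the lower right one fixes the coordinates of
  the controller state so that the inverse sends (x, 0) to (Y x, Y x).\<close>

definition lyapunov_block :: "real mat \<Rightarrow> real mat \<Rightarrow> real mat" where
  "lyapunov_block X W = four_block_mat X (W - X) (W - X) (X - W)"

text \<open>In the coordinates a and a - b the matrix is block diagonal with blocks W and X - W,
  from which its positivity can be read off.\<close>

lemma lyapunov_block_form:
  fixes X W :: "real mat" and a b :: "real vec"
  assumes X: "X \<in> carrier_mat n n" "X\<^sup>T = X" and W: "W \<in> carrier_mat n n" "W\<^sup>T = W"
  shows "lyapunov_block X W \<in> carrier_mat (n + n) (n + n)" "(lyapunov_block X W)\<^sup>T = lyapunov_block X W"
    and "a \<in> carrier_vec n \<Longrightarrow> b \<in> carrier_vec n \<Longrightarrow>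
      (a @\<^sub>v b) \<bullet> (lyapunov_block X W *\<^sub>v (a @\<^sub>v b)) = a \<bullet> (W *\<^sub>v a) + (a - b) \<bullet> ((X - W) *\<^sub>v (a - b))"
proof -
  note WX = minus_carrier_mat[OF X(1), of W] and XW = minus_carrier_mat[OF W(1), of X]
  have sym: "(W - X)\<^sup>T = W - X" "(X - W)\<^sup>T = X - W"
    by (simp_all only: transpose_minus[OF W(1) X(1)] transpose_minus[OF X(1) W(1)] X(2) W(2))
  show "lyapunov_block X W \<in> carrier_mat (n + n) (n + n)"
    unfolding lyapunov_block_def by (rule four_block_carrier_mat[OF X(1) XW])
  show "(lyapunov_block X W)\<^sup>T = lyapunov_block X W"
    unfolding lyapunov_block_def by (simp only: transpose_four_block_mat[OF X(1) WX WX XW] sym X(2))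
  assume a: "a \<in> carrier_vec n" and b: "b \<in> carrier_vec n"
  note Xa = mult_mat_vec_carrier[OF X(1) a] and Xb = mult_mat_vec_carrier[OF X(1) b]
    and Wa = mult_mat_vec_carrier[OF W(1) a] and Wb = mult_mat_vec_carrier[OF W(1) b]
  have ab: "a - b \<in> carrier_vec n" using a b by simp
  have cross: "a \<bullet> (X *\<^sub>v b) = b \<bullet> (X *\<^sub>v a)" "a \<bullet> (W *\<^sub>v b) = b \<bullet> (W *\<^sub>v a)"
    by (rule symmetric_scalar_prod[OF X a b], rule symmetric_scalar_prod[OF W a b])
  have quad: "(a - b) \<bullet> (M *\<^sub>v (a - b)) = a \<bullet> (M *\<^sub>v a) - a \<bullet> (M *\<^sub>v b) - (b \<bullet> (M *\<^sub>v a) - b \<bullet> (M *\<^sub>v b))"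
    if M: "M \<in> carrier_mat n n" for M
  proof -
    note Ma = mult_mat_vec_carrier[OF M a] and Mb = mult_mat_vec_carrier[OF M b]
    show ?thesis
      by (simp only: mult_minus_distrib_mat_vec[OF M a b] minus_scalar_prod_distrib[OF a b minus_carrier_vec[OF Ma Mb]]
          scalar_prod_minus_distrib[OF a Ma Mb] scalar_prod_minus_distrib[OF b Ma Mb])
  qed
  have split: "u \<bullet> ((X - W) *\<^sub>v v) = u \<bullet> (X *\<^sub>v v) - u \<bullet> (W *\<^sub>v v)"
    "u \<bullet> ((W - X) *\<^sub>v v) = u \<bullet> (W *\<^sub>v v) - u \<bullet> (X *\<^sub>v v)"
    if u: "u \<in> carrier_vec n" and v: "v \<in> carrier_vec n" for u v
  proof -
    note Xv = mult_mat_vec_carrier[OF X(1) v] and Wv = mult_mat_vec_carrier[OF W(1) v]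
    show "u \<bullet> ((X - W) *\<^sub>v v) = u \<bullet> (X *\<^sub>v v) - u \<bullet> (W *\<^sub>v v)"
      "u \<bullet> ((W - X) *\<^sub>v v) = u \<bullet> (W *\<^sub>v v) - u \<bullet> (X *\<^sub>v v)"
      by (simp_all only: minus_mult_distrib_mat_vec[OF X(1) W(1) v] minus_mult_distrib_mat_vec[OF W(1) X(1) v]
          scalar_prod_minus_distrib[OF u Xv Wv] scalar_prod_minus_distrib[OF u Wv Xv])
  qed
  have "(a @\<^sub>v b) \<bullet> (lyapunov_block X W *\<^sub>v (a @\<^sub>v b)) =
      a \<bullet> (X *\<^sub>v a) + 2 * (b \<bullet> ((W - X) *\<^sub>v a)) + b \<bullet> ((X - W) *\<^sub>v b)"
    using two_block_form[OF X(1) WX XW a b] by (simp only: lyapunov_block_def sym)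
  then show "(a @\<^sub>v b) \<bullet> (lyapunov_block X W *\<^sub>v (a @\<^sub>v b)) = a \<bullet> (W *\<^sub>v a) + (a - b) \<bullet> ((X - W) *\<^sub>v (a - b))"
    by (simp only: quad[OF XW] split a b cross) simp
qed

lemma pos_def_inv_mat_pos_def:
  assumes M: "M \<in> carrier_mat n n" and pd: "pos_def M"
  shows "pos_def (inv_mat M)"
proof -
  note N = pos_def_inv_mat[OF M pd]
  show ?thesis
    unfolding pos_def_iff[OF N(1)]
  proof (intro conjI N(2) ballI impI)
    fix v :: "real vec" assume v: "v \<in> carrier_vec n" "v \<noteq> 0\<^sub>v n"
    note Nv = mult_mat_vec_carrier[OF N(1) v(1)]
    have "inv_mat M *\<^sub>v v \<noteq> 0\<^sub>v n"
    proof
      assume "inv_mat M *\<^sub>v v = 0\<^sub>v n"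
      then have "v = 0\<^sub>v n" using N(3)[OF v(1)] mult_mat_vec_zero[OF M] by simp
      then show False using v(2) by simp
    qed
    from pos_def_form_nonneg(2)[OF M pd Nv this]
    have "(inv_mat M *\<^sub>v v) \<bullet> v > 0" by (simp only: N(3)[OF v(1)])
    then show "v \<bullet> (inv_mat M *\<^sub>v v) > 0" by (simp only: comm_scalar_prod[OF Nv v(1)])
  qed
qed

text \<open>By a Schur complement the coupling condition yields Y > 0 and X > W, and these are the
  two diagonal blocks of the Lyapunov matrix in suitable coordinates. The last claim computes the
  preimage of (x, 0), the kind of vector on which the input kernel is tested.\<close>

lemma coupling_condition:
  fixes X Y :: "real mat" and a b x :: "real vec"
  assumes X: "X \<in> carrier_mat n n" "X\<^sup>T = X" and Y: "Y \<in> carrier_mat n n" "Y\<^sup>T = Y"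
    and pd: "pos_def (four_block_mat Y (1\<^sub>m n) (1\<^sub>m n) X)"
  shows "pos_def Y" "pos_def (lyapunov_block X (inv_mat Y))"
    and "v \<in> carrier_vec n \<Longrightarrow> v \<noteq> 0\<^sub>v n \<Longrightarrow> v \<bullet> ((X - inv_mat Y) *\<^sub>v v) > 0"
    and "a \<in> carrier_vec n \<Longrightarrow> b \<in> carrier_vec n \<Longrightarrow> x \<in> carrier_vec n \<Longrightarrow>
      lyapunov_block X (inv_mat Y) *\<^sub>v (a @\<^sub>v b) = x @\<^sub>v 0\<^sub>v n \<Longrightarrow> a = Y *\<^sub>v x \<and> b = Y *\<^sub>v x"
proof -
  have I: "(1\<^sub>m n :: real mat) \<in> carrier_mat n n" "(1\<^sub>m n :: real mat)\<^sup>T = 1\<^sub>m n" by simp_all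
  let ?M = "four_block_mat Y (1\<^sub>m n) (1\<^sub>m n) X"
  have M: "?M \<in> carrier_mat (n + n) (n + n)" by (rule four_block_carrier_mat[OF Y(1) X(1)])
  have pos: "a \<bullet> (Y *\<^sub>v a) + 2 * (b \<bullet> a) + b \<bullet> (X *\<^sub>v b) > 0"
    if a: "a \<in> carrier_vec n" and b: "b \<in> carrier_vec n" and nz: "\<not> (a = 0\<^sub>v n \<and> b = 0\<^sub>v n)" for a b :: "real vec"
  proof -
    have "a @\<^sub>v b \<noteq> 0\<^sub>v (n + n)" using append_vec_eq_zero_iff[OF a b] nz by blast
    from pos_def_form_nonneg(2)[OF M pd append_carrier_vec[OF a b] this]
    show ?thesis
      using two_block_form[OF Y(1) I(1) X(1) a b] by (simp only: I(2) one_mult_mat_vec[OF a])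
  qed
  show pdY: "pos_def Y"
    unfolding pos_def_iff[OF Y(1)]
  proof (intro conjI Y(2) ballI impI)
    fix v :: "real vec" assume v: "v \<in> carrier_vec n" "v \<noteq> 0\<^sub>v n"
    have "v \<bullet> (Y *\<^sub>v v) + 2 * (0\<^sub>v n \<bullet> v) + 0\<^sub>v n \<bullet> (X *\<^sub>v 0\<^sub>v n) > 0"
      by (rule pos[OF v(1)]) (use v(2) in simp_all)
    then show "v \<bullet> (Y *\<^sub>v v) > 0"
      using v(1) X(1) by simp
  qed
  let ?W = "inv_mat Y"
  note W = pos_def_inv_mat[OF Y(1) pdY]
  show posZ: "v \<bullet> ((X - ?W) *\<^sub>v v) > 0" if v: "v \<in> carrier_vec n" "v \<noteq> 0\<^sub>v n" for v :: "real vec"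
  proof -
    note Wv = mult_mat_vec_carrier[OF W(1) v(1)] and Xv = mult_mat_vec_carrier[OF X(1) v(1)]
    \<comment> \<open>For a fixed second component v the coupling form is minimal at this first
      component, and its minimum is the form of X - W at v.\<close>
    let ?a = "(-1) \<cdot>\<^sub>v (?W *\<^sub>v v)"
    have a: "?a \<in> carrier_vec n" using Wv by simp
    have Ya: "Y *\<^sub>v ?a = (-1) \<cdot>\<^sub>v v"
      by (simp only: mult_mat_vec[OF Y(1) Wv] W(3)[OF v(1)])
    have "?a \<bullet> (Y *\<^sub>v ?a) + 2 * (v \<bullet> ?a) + v \<bullet> (X *\<^sub>v v) > 0"
      by (rule pos[OF a v(1)]) (use v(2) in simp)
    moreover have "?a \<bullet> (Y *\<^sub>v ?a) = v \<bullet> (?W *\<^sub>v v)"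
      unfolding Ya using comm_scalar_prod[OF Wv v(1)] Wv v(1) by simp
    moreover have "v \<bullet> ?a = - (v \<bullet> (?W *\<^sub>v v))" using Wv v(1) by simp
    moreover have "v \<bullet> ((X - ?W) *\<^sub>v v) = v \<bullet> (X *\<^sub>v v) - v \<bullet> (?W *\<^sub>v v)"
      by (simp only: minus_mult_distrib_mat_vec[OF X(1) W(1) v(1)] scalar_prod_minus_distrib[OF v(1) Xv Wv])
    ultimately show ?thesis by linarith
  qed
  note posW = pos_def_form_nonneg(2)[OF W(1) pos_def_inv_mat_pos_def[OF Y(1) pdY]]
  note block = lyapunov_block_form[OF X W(1,2)]
  have XW: "X - ?W \<in> carrier_mat n n" by (rule minus_carrier_mat[OF W(1)])
  have zero_form: "0\<^sub>v n \<bullet> (S *\<^sub>v 0\<^sub>v n) = 0" if "S \<in> carrier_mat n n" for S :: "real mat"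
    using that by simp
  show "pos_def (lyapunov_block X ?W)"
    unfolding pos_def_iff[OF block(1)]
  proof (intro conjI block(2) ballI impI)
    fix v :: "real vec" assume v: "v \<in> carrier_vec (n + n)" "v \<noteq> 0\<^sub>v (n + n)"
    obtain a b where a: "a \<in> carrier_vec n" and b: "b \<in> carrier_vec n" and v_eq: "v = a @\<^sub>v b"
      using append_vec_cases[OF v(1)] .
    have ab: "a - b \<in> carrier_vec n" using a b by simp
    show "v \<bullet> (lyapunov_block X ?W *\<^sub>v v) > 0"
    proof (cases "a = 0\<^sub>v n")
      case True
      then have "b \<noteq> 0\<^sub>v n" using v(2) append_vec_eq_zero_iff[OF a b] v_eq by blast
      then have "a - b \<noteq> 0\<^sub>v n" using minus_vec_eq_zero[OF a b] True by metis
      from posZ[OF ab this] show ?thesis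
        unfolding v_eq block(3)[OF a b] using True zero_form[OF W(1)] by simp
    next
      case False
      have "(a - b) \<bullet> ((X - ?W) *\<^sub>v (a - b)) \<ge> 0"
        using posZ[OF ab] zero_form[OF XW] by (cases "a - b = 0\<^sub>v n") auto
      then show ?thesis
        unfolding v_eq block(3)[OF a b] using posW[OF a False] by linarith
    qed
  qed
  show "a = Y *\<^sub>v x \<and> b = Y *\<^sub>v x"
    if a: "a \<in> carrier_vec n" and b: "b \<in> carrier_vec n" and x: "x \<in> carrier_vec n"
      and eq: "lyapunov_block X ?W *\<^sub>v (a @\<^sub>v b) = x @\<^sub>v 0\<^sub>v n"
  proof -
    have ab: "a - b \<in> carrier_vec n" using a b by simp
    note WX = minus_carrier_mat[OF X(1), of ?W]
    note Xa = mult_mat_vec_carrier[OF X(1) a] and Wa = mult_mat_vec_carrier[OF W(1) a]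
      and WXa = mult_mat_vec_carrier[OF WX a] and WXb = mult_mat_vec_carrier[OF WX b]
      and XWb = mult_mat_vec_carrier[OF XW b] and XWa = mult_mat_vec_carrier[OF XW a]
    have rows: "X *\<^sub>v a + (?W - X) *\<^sub>v b = x" "(?W - X) *\<^sub>v a + (X - ?W) *\<^sub>v b = 0\<^sub>v n"
      using eq append_vec_eq[OF add_carrier_vec[OF Xa WXb] x]
      unfolding lyapunov_block_def four_block_mat_mult_vec[OF X(1) WX WX XW a b] by blast+
    \<comment> \<open>The second block row is (X - W) (b - a) = 0. Testing it with a - b and using
      that X - W is positive forces a = b.\<close>
    have "b = a"
    proof -
      have "(a - b) \<bullet> ((?W - X) *\<^sub>v a + (X - ?W) *\<^sub>v b) = - ((a - b) \<bullet> ((X - ?W) *\<^sub>v (a - b)))"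
      proof -
        have "(?W - X) *\<^sub>v a = ?W *\<^sub>v a - X *\<^sub>v a" "(X - ?W) *\<^sub>v a = X *\<^sub>v a - ?W *\<^sub>v a"
          by (simp_all only: minus_mult_distrib_mat_vec[OF X(1) W(1) a] minus_mult_distrib_mat_vec[OF W(1) X(1) a])
        then have "(a - b) \<bullet> ((?W - X) *\<^sub>v a) = - ((a - b) \<bullet> ((X - ?W) *\<^sub>v a))"
          using scalar_prod_minus_distrib[OF ab Wa Xa] scalar_prod_minus_distrib[OF ab Xa Wa] by simp
        then show ?thesis
          by (simp only: scalar_prod_add_distrib[OF ab WXa XWb] mult_minus_distrib_mat_vec[OF XW a b]
              scalar_prod_minus_distrib[OF ab XWa XWb])
      qed
      then have "(a - b) \<bullet> ((X - ?W) *\<^sub>v (a - b)) = 0"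
        using ab by (simp add: rows(2))
      then have "a - b = 0\<^sub>v n" using posZ[OF ab] by force
      then show ?thesis by (rule minus_vec_eq_zero[OF a b])
    qed
    moreover have "a = Y *\<^sub>v x"
    proof -
      have "X *\<^sub>v a + (?W *\<^sub>v a - X *\<^sub>v a) = x"
        using rows(1) unfolding \<open>b = a\<close> minus_mult_distrib_mat_vec[OF W(1) X(1) a] .
      moreover have "p + (r - p) = r" if "p \<in> carrier_vec n" "r \<in> carrier_vec n" for p r :: "real vec"
        using that by (intro eq_vecI) auto
      note this[OF Xa Wa]
      ultimately have "?W *\<^sub>v a = x" by simp
      then show ?thesis using W(3)[OF a] by simp
    qed
    ultimately show ?thesis by simp
  qed
qed

section \<open>From the projected inequalities to a controller\<close>

text \<open>What remains of the closed loop when all gains are zero: the plant runs freely and the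
  controller state does not contribute.\<close>

definition drift :: "nat \<Rightarrow> real mat \<Rightarrow> real mat" where
  "drift n A = four_block_mat A (0\<^sub>m n n) (0\<^sub>m n n) (0\<^sub>m n n)"

lemma drift_carrier: "A \<in> carrier_mat n n \<Longrightarrow> drift n A \<in> carrier_mat (n + n) (n + n)"
  unfolding drift_def by (rule four_block_carrier_mat) simp_all

lemma drift_mult_vec:
  assumes A: "A \<in> carrier_mat n n" and a: "a \<in> carrier_vec n" and b: "b \<in> carrier_vec n"
  shows "drift n A *\<^sub>v (a @\<^sub>v b) = (A *\<^sub>v a) @\<^sub>v 0\<^sub>v n"
proof -
  have Z: "(0\<^sub>m n n :: real mat) \<in> carrier_mat n n" by simp
  have zero: "(0\<^sub>m n n :: real mat) *\<^sub>v a = 0\<^sub>v n" "(0\<^sub>m n n :: real mat) *\<^sub>v b = 0\<^sub>v n"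
    using a b by (auto intro!: eq_vecI)
  show ?thesis
    using mult_mat_vec_carrier[OF A a]
    by (simp add: drift_def four_block_mat_mult_vec[OF A Z Z Z a b] zero)
qed

text \<open>The values on the two families of vectors that elimination tests: a zero controller
  state sees X only, and equal components see W only. For fixed vectors these identities hold at
  every time, so they can be differentiated.\<close>

lemma lyapunov_block_corner:
  fixes X W :: "real mat" and a b :: "real vec"
  assumes X: "X \<in> carrier_mat n n" "X\<^sup>T = X" and W: "W \<in> carrier_mat n n" "W\<^sup>T = W"
    and a: "a \<in> carrier_vec n" and b: "b \<in> carrier_vec n"
  shows "(b @\<^sub>v 0\<^sub>v n) \<bullet> (lyapunov_block X W *\<^sub>v (a @\<^sub>v 0\<^sub>v n)) = b \<bullet> (X *\<^sub>v a)"
    and "(a @\<^sub>v a) \<bullet> (lyapunov_block X W *\<^sub>v (a @\<^sub>v a)) = a \<bullet> (W *\<^sub>v a)"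
proof -
  have z: "(0\<^sub>v n :: real vec) \<in> carrier_vec n" by simp
  note WX = minus_carrier_mat[OF X(1), of W] and XW = minus_carrier_mat[OF W(1), of X]
  note car = mult_mat_vec_carrier[OF X(1) a] mult_mat_vec_carrier[OF WX a]
  have "lyapunov_block X W *\<^sub>v (a @\<^sub>v 0\<^sub>v n) = (X *\<^sub>v a) @\<^sub>v ((W - X) *\<^sub>v a)"
    using car by (simp add: lyapunov_block_def four_block_mat_mult_vec[OF X(1) WX WX XW a z]
        mult_mat_vec_zero[OF WX] mult_mat_vec_zero[OF XW])
  then show "(b @\<^sub>v 0\<^sub>v n) \<bullet> (lyapunov_block X W *\<^sub>v (a @\<^sub>v 0\<^sub>v n)) = b \<bullet> (X *\<^sub>v a)"
    by (simp only: scalar_prod_append_zero(2)[OF car b])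
  have "a - a = 0\<^sub>v n" using a by simp
  then show "(a @\<^sub>v a) \<bullet> (lyapunov_block X W *\<^sub>v (a @\<^sub>v a)) = a \<bullet> (W *\<^sub>v a)"
    using XW by (simp add: lyapunov_block_form(3)[OF X W a a] mult_mat_vec_zero[OF XW])
qed

lemma C1_lyapunov_block:
  assumes ab: "a < b" and X: "C1_mat_on {a..b} n n X" and W: "C1_mat_on {a..b} n n W"
  shows "C1_mat_on {a..b} (n + n) (n + n) (\<lambda>t. lyapunov_block (X t) (W t))"
proof -
  note X' = X[unfolded C1_mat_on_iff[OF ab]] and W' = W[unfolded C1_mat_on_iff[OF ab]]
  show ?thesis
    unfolding C1_mat_on_iff[OF ab] lyapunov_block_def
    by (rule C1.mat_entries_four_block[OF X' C1.mat_entries_diff[OF W' X'] C1.mat_entries_diff[OF W' X']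
          C1.mat_entries_diff[OF X' W']])
qed

text \<open>Completing the square at a - Y g in the form of the inverse, with equality for a = Y g.
  It relates the doubled jump inequality, which involves W, to the projected one, which involves
  Y.\<close>

lemma young_inequality:
  fixes Y :: "real mat" and a g :: "real vec"
  assumes Y: "Y \<in> carrier_mat n n" "pos_def Y" and a: "a \<in> carrier_vec n" and g: "g \<in> carrier_vec n"
  shows "2 * (g \<bullet> a) \<le> a \<bullet> (inv_mat Y *\<^sub>v a) + g \<bullet> (Y *\<^sub>v g)"
proof -
  let ?W = "inv_mat Y"
  note W = pos_def_inv_mat[OF Y]
  note Yg = mult_mat_vec_carrier[OF Y(1) g] and Wa = mult_mat_vec_carrier[OF W(1) a]
  have c: "a - Y *\<^sub>v g \<in> carrier_vec n" using a Yg by simp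
  have "0 \<le> (a - Y *\<^sub>v g) \<bullet> (?W *\<^sub>v (a - Y *\<^sub>v g))"
    by (rule pos_def_form_nonneg(1)[OF W(1) pos_def_inv_mat_pos_def[OF Y] c])
  also have "\<dots> = a \<bullet> (?W *\<^sub>v a) - a \<bullet> g - ((Y *\<^sub>v g) \<bullet> (?W *\<^sub>v a) - (Y *\<^sub>v g) \<bullet> g)"
    by (simp only: mult_minus_distrib_mat_vec[OF W(1) a Yg] W(4)[OF g] minus_scalar_prod_distrib[OF a Yg minus_carrier_vec[OF Wa g]]
        scalar_prod_minus_distrib[OF a Wa g] scalar_prod_minus_distrib[OF Yg Wa g])
  also have "(Y *\<^sub>v g) \<bullet> (?W *\<^sub>v a) = g \<bullet> a"
    using scalar_prod_mult_transpose[OF Y(1) g Wa] by (simp only: pos_def_symmetric[OF Y(2)] W(3)[OF a])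
  also have "(Y *\<^sub>v g) \<bullet> g = g \<bullet> (Y *\<^sub>v g)" by (rule comm_scalar_prod[OF Yg g])
  also have "a \<bullet> g = g \<bullet> a" by (rule comm_scalar_prod[OF a g])
  finally show ?thesis by linarith
qed

text \<open>Elimination is applied once to the flow and once to the jumps. On the output side the
  test vectors are (a, 0) with a in the kernel of C or of CJ; on the input side they are the
  preimages (Y x, Y x) of (x, 0) with x in the kernel of B^T or of BJ^T. The four resulting cases
  are the four projected inequalities.\<close>

lemma controller_exists:
  fixes A B C AJ BJ CJ :: "real mat" and X Y :: "real \<Rightarrow> real mat"
  assumes T: "0 < Tmin" "Tmin < Tmax"
    and plant: "A \<in> carrier_mat n n" "B \<in> carrier_mat n m" "C \<in> carrier_mat q n"
    and jump: "AJ \<in> carrier_mat n n" "BJ \<in> carrier_mat n mJ" "CJ \<in> carrier_mat qJ n"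
    and X: "C1_sym_mat_on {0..Tmax} n X" and Y: "C1_sym_mat_on {0..Tmax} n Y"
    and coupling: "\<And>t. t \<in> {0..Tmax} \<Longrightarrow> pos_def (four_block_mat (Y t) (1\<^sub>m n) (1\<^sub>m n) (X t))"
    and flow_X: "\<And>t x. t \<in> {0..Tmax} \<Longrightarrow> x \<in> mat_kernel C \<Longrightarrow> x \<noteq> 0\<^sub>v n \<Longrightarrow>
      x \<bullet> (mat_deriv {0..Tmax} X t *\<^sub>v x) + 2 * ((A *\<^sub>v x) \<bullet> (X t *\<^sub>v x)) < 0"
    and flow_Y: "\<And>t x. t \<in> {0..Tmax} \<Longrightarrow> x \<in> mat_kernel B\<^sup>T \<Longrightarrow> x \<noteq> 0\<^sub>v n \<Longrightarrow>
      x \<bullet> (mat_deriv {0..Tmax} Y t *\<^sub>v x) - 2 * ((A\<^sup>T *\<^sub>v x) \<bullet> (Y t *\<^sub>v x)) > 0"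
    and jump_X: "\<And>t x. t \<in> {Tmin..Tmax} \<Longrightarrow> x \<in> mat_kernel CJ \<Longrightarrow> x \<noteq> 0\<^sub>v n \<Longrightarrow>
      (AJ *\<^sub>v x) \<bullet> (X 0 *\<^sub>v (AJ *\<^sub>v x)) < x \<bullet> (X t *\<^sub>v x)"
    and jump_Y: "\<And>t x. t \<in> {Tmin..Tmax} \<Longrightarrow> x \<in> mat_kernel BJ\<^sup>T \<Longrightarrow> x \<noteq> 0\<^sub>v n \<Longrightarrow>
      (AJ\<^sup>T *\<^sub>v x) \<bullet> (Y t *\<^sub>v (AJ\<^sup>T *\<^sub>v x)) < x \<bullet> (Y 0 *\<^sub>v x)"
  shows "\<exists>K. clock_dependent_controller Tmin Tmax m q mJ qJ K \<and>
    clock_LMIs_feasible Tmin Tmax (n + order_c K) (closed_loop_flow A B C K) (closed_loop_jump AJ BJ CJ K)"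
proof -
  let ?S = "{0..Tmax}" and ?J = "{Tmin..Tmax}"
  have T0: "0 < Tmax" using T by linarith
  have JS: "t \<in> ?S" if "t \<in> ?J" for t using that T by auto
  have zeroS: "0 \<in> ?S" using T0 by simp
  have X1: "C1_mat_on ?S n n X" and Xs: "\<And>t. t \<in> ?S \<Longrightarrow> (X t)\<^sup>T = X t"
    using X unfolding C1_sym_mat_on_def by blast+
  have Y1: "C1_mat_on ?S n n Y" and Ys: "\<And>t. t \<in> ?S \<Longrightarrow> (Y t)\<^sup>T = Y t"
    using Y unfolding C1_sym_mat_on_def by blast+
  note Xc = C1_mat_on_carrier[OF X1] and Yc = C1_mat_on_carrier[OF Y1]
  have couple: "pos_def (Y t)" "pos_def (lyapunov_block (X t) (inv_mat (Y t)))" if t: "t \<in> ?S" for t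
    using coupling_condition(1,2)[OF Xc[OF t] Xs[OF t] Yc[OF t] Ys[OF t] coupling[OF t]] by blast+
  define W where "W t = inv_mat (Y t)" for t
  define XX where "XX t = lyapunov_block (X t) (W t)" for t
  have W_eq: "W = (\<lambda>t. inv_mat (Y t))" and XX_eq: "XX = (\<lambda>t. lyapunov_block (X t) (W t))"
    by (simp_all add: fun_eq_iff W_def XX_def)
  have W1: "C1_mat_on ?S n n W"
    unfolding W_eq by (rule C1_inv_mat[OF T0 Y1 couple(1)])
  note Wc = C1_mat_on_carrier[OF W1]
  have Ws: "(W t)\<^sup>T = W t" if t: "t \<in> ?S" for t
    unfolding W_def by (rule pos_def_inv_mat(2)[OF Yc[OF t] couple(1)[OF t]])
  have XX1: "C1_mat_on ?S (n + n) (n + n) XX"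
    unfolding XX_eq by (rule C1_lyapunov_block[OF T0 X1 W1])
  note XXc = C1_mat_on_carrier[OF XX1]
  have XXs: "(XX t)\<^sup>T = XX t" if t: "t \<in> ?S" for t
    unfolding XX_def by (rule lyapunov_block_form(2)[OF Xc[OF t] Xs[OF t] Wc[OF t] Ws[OF t]])
  have XXpd: "pos_def (XX t)" if t: "t \<in> ?S" for t
    using couple(2)[OF t] unfolding XX_def W_def .
  have XX_top: "a = Y t *\<^sub>v x \<and> b = Y t *\<^sub>v x"
    if t: "t \<in> ?S" and a: "a \<in> carrier_vec n" and b: "b \<in> carrier_vec n" and x: "x \<in> carrier_vec n"
      and "XX t *\<^sub>v (a @\<^sub>v b) = x @\<^sub>v 0\<^sub>v n" for t and a b x :: "real vec"
    using coupling_condition(4)[OF Xc[OF t] Xs[OF t] Yc[OF t] Ys[OF t] coupling[OF t] a b x] that(5)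
    unfolding XX_def W_def by blast
  have corner: "(b @\<^sub>v 0\<^sub>v n) \<bullet> (XX t *\<^sub>v (a @\<^sub>v 0\<^sub>v n)) = b \<bullet> (X t *\<^sub>v a)"
      "(a @\<^sub>v a) \<bullet> (XX t *\<^sub>v (a @\<^sub>v a)) = a \<bullet> (W t *\<^sub>v a)"
    if t: "t \<in> ?S" and a: "a \<in> carrier_vec n" and b: "b \<in> carrier_vec n" for t and a b :: "real vec"
    unfolding XX_def by (rule lyapunov_block_corner[OF Xc[OF t] Xs[OF t] Wc[OF t] Ws[OF t] a b])+
  let ?D = "mat_deriv ?S XX"
  have Dc: "?D t \<in> carrier_mat (n + n) (n + n)" if t: "t \<in> ?S" for t
    by (rule mat_deriv_carrier[of XX t, OF XXc[OF t]])
  have Ds: "(?D t)\<^sup>T = ?D t" if t: "t \<in> ?S" for t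
    by (rule mat_deriv_symmetric[OF T0 XX1 XXs t])
  have BT: "B\<^sup>T \<in> carrier_mat m n" and BJT: "BJ\<^sup>T \<in> carrier_mat mJ n" using plant(2) jump(2) by simp_all
  have AT: "A\<^sup>T \<in> carrier_mat n n" and AJT: "AJ\<^sup>T \<in> carrier_mat n n" using plant(1) jump(1) by simp_all
  have z: "(0\<^sub>v n :: real vec) \<in> carrier_vec n" by simp
  have zero_append: "(0\<^sub>v n :: real vec) @\<^sub>v 0\<^sub>v n = 0\<^sub>v (n + n)"
    using append_vec_eq_zero_iff[OF z z] by blast
  note dA = drift_carrier[OF plant(1)] and dAJ = drift_carrier[OF jump(1)]
  note cB = channel_carrier[OF BT] and cC = channel_carrier[OF plant(3)]
    and cBJ = channel_carrier[OF BJT] and cCJ = channel_carrier[OF jump(3)]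

  let ?Q = "\<lambda>t. ?D t + (drift n A)\<^sup>T * XX t + XX t * drift n A"
  have dAT: "(drift n A)\<^sup>T \<in> carrier_mat (n + n) (n + n)" using dA by simp
  have XXcont: "cont.mat_entries ?S (n + n) (n + n) XX"
    using C1_mat_on_continuous[OF T0 XX1] by (simp only: continuous_mat_on_iff)
  have Dcont: "cont.mat_entries ?S (n + n) (n + n) ?D"
    using XX1 unfolding C1_mat_on_def continuous_mat_on_iff by blast
  have Qcont: "continuous_mat_on ?S (n + n) (n + n) ?Q"
    unfolding continuous_mat_on_iff
    by (rule cont.mat_entries_add[OF cont.mat_entries_add[OF Dcont
          cont.mat_entries_mult[OF cont.mat_entries_const[OF dAT] XXcont]]
          cont.mat_entries_mult[OF XXcont cont.mat_entries_const[OF dA]]])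
  have Gcont: "continuous_mat_on ?S (n + m) (n + n) (\<lambda>t. channel n B\<^sup>T * XX t)"
    unfolding continuous_mat_on_iff by (rule cont.mat_entries_mult[OF cont.mat_entries_const[OF cB] XXcont])
  have Ccont: "continuous_mat_on ?S (n + q) (n + n) (\<lambda>t. channel n C)"
    unfolding continuous_mat_on_iff by (rule cont.mat_entries_const[OF cC])
  have "\<exists>K. continuous_mat_on ?S (n + m) (n + q) K \<and> (\<forall>t\<in>?S. \<forall>v\<in>carrier_vec (n + n). v \<noteq> 0\<^sub>v (n + n) \<longrightarrow>
      v \<bullet> (?Q t *\<^sub>v v) + 2 * (((channel n B\<^sup>T * XX t) *\<^sub>v v) \<bullet> (K t *\<^sub>v (channel n C *\<^sub>v v))) < 0)"
  proof (rule continuous_elimination[OF compact_Icc Qcont _ Gcont Ccont])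
    fix t assume t: "t \<in> ?S"
    note Qt = lyapunov_form[OF Dc[OF t] Ds[OF t] XXc[OF t] XXs[OF t] dA]
    show "(?Q t)\<^sup>T = ?Q t" by (rule Qt(2))
    fix v :: "real vec" assume v: "v \<in> carrier_vec (n + n)" "v \<noteq> 0\<^sub>v (n + n)"
    obtain a b where a: "a \<in> carrier_vec n" and b: "b \<in> carrier_vec n" and v_eq: "v = a @\<^sub>v b"
      using append_vec_cases[OF v(1)] .
    note Aa = mult_mat_vec_carrier[OF plant(1) a]
    \<comment> \<open>Here the Lyapunov matrix maps v to (x, 0) with x in ker B^T. Hence v = (Y x, Y
      x), and the form at v is minus the left side of \<open>flow_Y\<close>.\<close>
    show "v \<bullet> (?Q t *\<^sub>v v) < 0" if G0: "(channel n B\<^sup>T * XX t) *\<^sub>v v = 0\<^sub>v (n + m)"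
    proof -
      obtain x y where x: "x \<in> carrier_vec n" and y: "y \<in> carrier_vec n" and xy: "XX t *\<^sub>v v = x @\<^sub>v y"
        using append_vec_cases[OF mult_mat_vec_carrier[OF XXc[OF t] v(1)]] .
      have "channel n B\<^sup>T *\<^sub>v (x @\<^sub>v y) = 0\<^sub>v (n + m)"
        using G0 by (simp only: assoc_mult_mat_vec[OF cB XXc[OF t] v(1)] xy)
      note ker = channel_eq_zero[OF BT x y this]
      have top: "XX t *\<^sub>v (a @\<^sub>v b) = x @\<^sub>v 0\<^sub>v n"
        using xy unfolding v_eq ker(1) .
      note abx = XX_top[OF t a b x top]
      have "x \<noteq> 0\<^sub>v n"
      proof
        assume "x = 0\<^sub>v n"
        then have "a = 0\<^sub>v n" "b = 0\<^sub>v n" using abx mult_mat_vec_zero[OF Yc[OF t]] by simp_all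
        then show False using v(2) zero_append unfolding v_eq by simp
      qed
      note less = flow_Y[OF t ker(2) this]
      have v_eq': "v = a @\<^sub>v a" and a_eq: "a = Y t *\<^sub>v x" using abx v_eq by simp_all
      \<comment> \<open>The vector a keeps its value Y(t) x while the matrices are differentiated.
        On (a, a) the block matrix is seen as W, and conjugation by Y then turns W' into -
        Y'.\<close>
      have "v \<bullet> (?D t *\<^sub>v v) = 1 * (a \<bullet> (mat_deriv ?S W t *\<^sub>v a))"
        by (rule bilinear_form_deriv_cong[OF T0 XX1 W1 t v(1) v(1) a a])
          (simp only: v_eq' corner(2)[OF _ a a] mult_1)
      also have "\<dots> = - (x \<bullet> (mat_deriv ?S Y t *\<^sub>v x))"
        using inv_mat_deriv_form[OF T0 Y1 couple(1) t x] unfolding W_eq a_eq by simp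
      finally have 1: "v \<bullet> (?D t *\<^sub>v v) = - (x \<bullet> (mat_deriv ?S Y t *\<^sub>v x))" .
      have "(XX t *\<^sub>v v) \<bullet> (drift n A *\<^sub>v v) = x \<bullet> (A *\<^sub>v a)"
        unfolding v_eq top drift_mult_vec[OF plant(1) a b] by (rule scalar_prod_append_zero(1)[OF x z Aa])
      also have "\<dots> = (A\<^sup>T *\<^sub>v x) \<bullet> (Y t *\<^sub>v x)"
        using transpose_vec_mult_scalar[OF plant(1) a x] a_eq by simp
      finally show ?thesis
        using less by (simp only: Qt(3)[OF v(1)] 1)
    qed
    show "v \<bullet> (?Q t *\<^sub>v v) < 0" if C0: "channel n C *\<^sub>v v = 0\<^sub>v (n + q)"
    proof -
      note ker = channel_eq_zero[OF plant(3) a b C0[unfolded v_eq]]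
      have v_eq': "v = a @\<^sub>v 0\<^sub>v n" using v_eq ker(1) by simp
      have "a \<noteq> 0\<^sub>v n" using v(2) zero_append unfolding v_eq' by metis
      note less = flow_X[OF t ker(2) this]
      have 1: "v \<bullet> (?D t *\<^sub>v v) = 1 * (a \<bullet> (mat_deriv ?S X t *\<^sub>v a))"
        by (rule bilinear_form_deriv_cong[OF T0 XX1 X1 t v(1) v(1) a a])
          (simp only: v_eq' corner(1)[OF _ a a] mult_1)
      have "(XX t *\<^sub>v v) \<bullet> (drift n A *\<^sub>v v) = (drift n A *\<^sub>v v) \<bullet> (XX t *\<^sub>v v)"
        by (rule comm_scalar_prod[OF mult_mat_vec_carrier[OF XXc[OF t] v(1)] mult_mat_vec_carrier[OF dA v(1)]])
      also have "\<dots> = (A *\<^sub>v a) \<bullet> (X t *\<^sub>v a)"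
        unfolding v_eq' drift_mult_vec[OF plant(1) a z] by (rule corner(1)[OF t a Aa])
      finally show ?thesis
        using less by (simp only: Qt(3)[OF v(1)] 1 mult_1)
    qed
  qed
  then obtain KF where KF: "continuous_mat_on ?S (n + m) (n + q) KF"
    and KF_neg: "\<forall>t\<in>?S. \<forall>v\<in>carrier_vec (n + n). v \<noteq> 0\<^sub>v (n + n) \<longrightarrow>
      v \<bullet> (?Q t *\<^sub>v v) + 2 * (((channel n B\<^sup>T * XX t) *\<^sub>v v) \<bullet> (KF t *\<^sub>v (channel n C *\<^sub>v v))) < 0"
    by (elim exE conjE)

  have XXJ: "continuous_mat_on ?J (n + n) (n + n) XX"
    using C1_mat_on_continuous[OF T0 XX1] JS continuous_on_subset[of ?S _ ?J]
    unfolding continuous_mat_on_def by (metis subsetI)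
  have "\<exists>K. continuous_mat_on ?J (n + mJ) (n + qJ) K \<and>
      (\<forall>t\<in>?J. \<forall>v\<in>carrier_vec (n + n). \<forall>w\<in>carrier_vec (n + n). v \<noteq> 0\<^sub>v (n + n) \<longrightarrow>
        2 * ((XX 0 *\<^sub>v w) \<bullet> (drift n AJ *\<^sub>v v) + (channel n BJ\<^sup>T *\<^sub>v (XX 0 *\<^sub>v w)) \<bullet> (K t *\<^sub>v (channel n CJ *\<^sub>v v))) <
        v \<bullet> (XX t *\<^sub>v v) + w \<bullet> (XX 0 *\<^sub>v w))"
  proof (rule continuous_jump_elimination[OF compact_Icc XXc[OF zeroS] XXpd[OF zeroS] XXJ _ dAJ cBJ cCJ])
    fix t assume tJ: "t \<in> ?J"
    note t = JS[OF tJ]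
    show "pos_def (XX t)" by (rule XXpd[OF t])
    fix v :: "real vec" assume v: "v \<in> carrier_vec (n + n)"
    obtain a b where a: "a \<in> carrier_vec n" and b: "b \<in> carrier_vec n" and v_eq: "v = a @\<^sub>v b"
      using append_vec_cases[OF v] .
    note Aa = mult_mat_vec_carrier[OF jump(1) a]
    show "(drift n AJ *\<^sub>v v) \<bullet> (XX 0 *\<^sub>v (drift n AJ *\<^sub>v v)) < v \<bullet> (XX t *\<^sub>v v)"
      if nz: "v \<noteq> 0\<^sub>v (n + n)" and C0: "channel n CJ *\<^sub>v v = 0\<^sub>v (n + qJ)"
    proof -
      note ker = channel_eq_zero[OF jump(3) a b C0[unfolded v_eq]]
      have v_eq': "v = a @\<^sub>v 0\<^sub>v n" using v_eq ker(1) by simp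
      have "a \<noteq> 0\<^sub>v n" using nz zero_append unfolding v_eq' by metis
      from jump_X[OF tJ ker(2) this] show ?thesis
        unfolding v_eq' drift_mult_vec[OF jump(1) a z] corner(1)[OF t a a] corner(1)[OF zeroS Aa Aa] .
    qed
    fix w :: "real vec" assume w: "w \<in> carrier_vec (n + n)" "w \<noteq> 0\<^sub>v (n + n)"
      and G0: "channel n BJ\<^sup>T *\<^sub>v (XX 0 *\<^sub>v w) = 0\<^sub>v (n + mJ)"
    obtain c d where c: "c \<in> carrier_vec n" and d: "d \<in> carrier_vec n" and w_eq: "w = c @\<^sub>v d"
      using append_vec_cases[OF w(1)] .
    obtain x y where x: "x \<in> carrier_vec n" and y: "y \<in> carrier_vec n" and xy: "XX 0 *\<^sub>v w = x @\<^sub>v y"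
      using append_vec_cases[OF mult_mat_vec_carrier[OF XXc[OF zeroS] w(1)]] .
    note ker = channel_eq_zero[OF BJT x y G0[unfolded xy]]
    have top: "XX 0 *\<^sub>v w = x @\<^sub>v 0\<^sub>v n" using xy unfolding ker(1) .
    note cdx = XX_top[OF zeroS c d x top[unfolded w_eq]]
    have nz: "x \<noteq> 0\<^sub>v n"
    proof
      assume "x = 0\<^sub>v n"
      then have "c = 0\<^sub>v n" "d = 0\<^sub>v n" using cdx mult_mat_vec_zero[OF Yc[OF zeroS]] by simp_all
      then show False using w(2) zero_append unfolding w_eq by simp
    qed
    let ?g = "AJ\<^sup>T *\<^sub>v x"
    have g: "?g \<in> carrier_vec n" by (rule mult_mat_vec_carrier[OF AJT x])
    have "(XX 0 *\<^sub>v w) \<bullet> (drift n AJ *\<^sub>v v) = x \<bullet> (AJ *\<^sub>v a)"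
      unfolding top v_eq drift_mult_vec[OF jump(1) a b] by (rule scalar_prod_append_zero(1)[OF x z Aa])
    also have "\<dots> = ?g \<bullet> a"
      by (rule transpose_vec_mult_scalar[OF jump(1) a x, symmetric])
    finally have 1: "(XX 0 *\<^sub>v w) \<bullet> (drift n AJ *\<^sub>v v) = ?g \<bullet> a" .
    have "w \<bullet> (XX 0 *\<^sub>v w) = c \<bullet> x"
      unfolding w_eq top[unfolded w_eq] by (rule scalar_prod_append_zero(1)[OF c d x])
    also have "\<dots> = x \<bullet> (Y 0 *\<^sub>v x)"
      using cdx comm_scalar_prod[OF c x] by simp
    finally have 2: "w \<bullet> (XX 0 *\<^sub>v w) = x \<bullet> (Y 0 *\<^sub>v x)" .
    \<comment> \<open>With g = AJ^T x the left side of the goal is 2 g^T a, at most a^T W a + g^T Y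
      g. The block form at v dominates the first term, and \<open>jump_Y\<close> puts the second
      strictly below x^T Y(0) x, which equals the Lyapunov form at w.\<close>
    have 3: "2 * (?g \<bullet> a) \<le> a \<bullet> (W t *\<^sub>v a) + ?g \<bullet> (Y t *\<^sub>v ?g)"
      unfolding W_def by (rule young_inequality[OF Yc[OF t] couple(1)[OF t] a g])
    have ab: "a - b \<in> carrier_vec n" using a b by simp
    have XW: "X t - W t \<in> carrier_mat n n" by (rule minus_carrier_mat[OF Wc[OF t]])
    have 4: "(a - b) \<bullet> ((X t - W t) *\<^sub>v (a - b)) \<ge> 0"
    proof (cases "a - b = 0\<^sub>v n")
      case True
      then show ?thesis using mult_mat_vec_zero[OF XW] by simp
    next
      case False
      from coupling_condition(3)[OF Xc[OF t] Xs[OF t] Yc[OF t] Ys[OF t] coupling[OF t] ab False]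
      show ?thesis unfolding W_def by linarith
    qed
    have 5: "v \<bullet> (XX t *\<^sub>v v) = a \<bullet> (W t *\<^sub>v a) + (a - b) \<bullet> ((X t - W t) *\<^sub>v (a - b))"
      unfolding v_eq XX_def by (rule lyapunov_block_form(3)[OF Xc[OF t] Xs[OF t] Wc[OF t] Ws[OF t] a b])
    show "2 * ((XX 0 *\<^sub>v w) \<bullet> (drift n AJ *\<^sub>v v)) < v \<bullet> (XX t *\<^sub>v v) + w \<bullet> (XX 0 *\<^sub>v w)"
      using 3 4 jump_Y[OF tJ ker(2) nz] unfolding 1 2 5 by linarith
  qed
  then obtain KJ where KJ: "continuous_mat_on ?J (n + mJ) (n + qJ) KJ"
    and KJ_neg: "\<forall>t\<in>?J. \<forall>v\<in>carrier_vec (n + n). \<forall>w\<in>carrier_vec (n + n). v \<noteq> 0\<^sub>v (n + n) \<longrightarrow>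
        2 * ((XX 0 *\<^sub>v w) \<bullet> (drift n AJ *\<^sub>v v) + (channel n BJ\<^sup>T *\<^sub>v (XX 0 *\<^sub>v w)) \<bullet> (KJ t *\<^sub>v (channel n CJ *\<^sub>v v))) <
        v \<bullet> (XX t *\<^sub>v v) + w \<bullet> (XX 0 *\<^sub>v w)"
    by (elim exE conjE)

  obtain Ac Bc Cc Dc where F: "continuous_mat_on ?S n n Ac" "continuous_mat_on ?S n q Bc"
    "continuous_mat_on ?S m n Cc" "continuous_mat_on ?S m q Dc"
    and KF_eq: "\<And>t. t \<in> ?S \<Longrightarrow> KF t = four_block_mat (Ac t) (Bc t) (Cc t) (Dc t)"
    using split_gain[OF KF] by metis
  obtain AcJ BcJ CcJ DcJ where J: "continuous_mat_on ?J n n AcJ" "continuous_mat_on ?J n qJ BcJ"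
    "continuous_mat_on ?J mJ n CcJ" "continuous_mat_on ?J mJ qJ DcJ"
    and KJ_eq: "\<And>t. t \<in> ?J \<Longrightarrow> KJ t = four_block_mat (AcJ t) (BcJ t) (CcJ t) (DcJ t)"
    using split_gain[OF KJ] by metis
  have Fc: "Ac t \<in> carrier_mat n n" "Bc t \<in> carrier_mat n q" "Cc t \<in> carrier_mat m n" "Dc t \<in> carrier_mat m q"
    if "t \<in> ?S" for t
    using F that unfolding continuous_mat_on_def by blast+
  have Jc: "AcJ t \<in> carrier_mat n n" "BcJ t \<in> carrier_mat n qJ" "CcJ t \<in> carrier_mat mJ n" "DcJ t \<in> carrier_mat mJ qJ"
    if "t \<in> ?J" for t
    using J that unfolding continuous_mat_on_def by blast+
  define K where "K = \<lparr>order_c = n, A_c = Ac, B_c = Bc, C_c = Cc, D_c = Dc,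
    AJ_c = AcJ, BJ_c = BcJ, CJ_c = CcJ, DJ_c = DcJ\<rparr>"
  have flow_eq: "closed_loop_flow A B C K t = closed_loop A B C (Ac t) (Bc t) (Cc t) (Dc t)" for t
    by (simp add: closed_loop_flow_def closed_loop_def K_def)
  have jump_eq: "closed_loop_jump AJ BJ CJ K t = closed_loop AJ BJ CJ (AcJ t) (BcJ t) (CcJ t) (DcJ t)" for t
    by (simp add: closed_loop_jump_def closed_loop_def K_def)
  have flow_neg: "neg_def (?D t + (closed_loop_flow A B C K t)\<^sup>T * XX t + XX t * closed_loop_flow A B C K t)"
    if t: "t \<in> ?S" for t
  proof -
    let ?A = "closed_loop A B C (Ac t) (Bc t) (Cc t) (Dc t)"
    note form = lyapunov_form[OF Dc[OF t] Ds[OF t] XXc[OF t] XXs[OF t] closed_loop_carrier[OF plant Fc[OF t]]]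
    show ?thesis
      unfolding flow_eq neg_def_iff[OF form(1)]
    proof (intro conjI form(2) ballI impI)
      fix v :: "real vec" assume v: "v \<in> carrier_vec (n + n)" "v \<noteq> 0\<^sub>v (n + n)"
      note XXv = mult_mat_vec_carrier[OF XXc[OF t] v(1)]
      note as_channel = closed_loop_as_channel[OF plant Fc[OF t] XXv v(1), folded drift_def]
      have "v \<bullet> (?Q t *\<^sub>v v) + 2 * (((channel n B\<^sup>T * XX t) *\<^sub>v v) \<bullet> (KF t *\<^sub>v (channel n C *\<^sub>v v))) < 0"
        using KF_neg t v by blast
      then show "v \<bullet> ((?D t + ?A\<^sup>T * XX t + XX t * ?A) *\<^sub>v v) < 0"
        unfolding form(3)[OF v(1)] as_channel lyapunov_form(3)[OF Dc[OF t] Ds[OF t] XXc[OF t] XXs[OF t] dA v(1)]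
          assoc_mult_mat_vec[OF cB XXc[OF t] v(1)] KF_eq[OF t] by (simp only: distrib_left add.assoc)
    qed
  qed
  have jump_neg: "neg_def ((closed_loop_jump AJ BJ CJ K t)\<^sup>T * XX 0 * closed_loop_jump AJ BJ CJ K t - XX t)"
    if tJ: "t \<in> ?J" for t
  proof -
    note t = JS[OF tJ]
    let ?A = "closed_loop AJ BJ CJ (AcJ t) (BcJ t) (CcJ t) (DcJ t)"
    note Acl = closed_loop_carrier[OF jump Jc[OF tJ]]
    note form = stein_form[OF XXc[OF zeroS] XXs[OF zeroS] XXc[OF t] XXs[OF t] Acl]
    show ?thesis
      unfolding jump_eq neg_def_iff[OF form(1)]
    proof (intro conjI form(2) ballI impI)
      fix v :: "real vec" assume v: "v \<in> carrier_vec (n + n)" "v \<noteq> 0\<^sub>v (n + n)"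
      note w = mult_mat_vec_carrier[OF Acl v(1)]
      note XXw = mult_mat_vec_carrier[OF XXc[OF zeroS] w]
      \<comment> \<open>For w the image of v under the jump, the left side is twice the Lyapunov
        form at w. One copy cancels against the right side, and the quadratic jump inequality
        remains.\<close>
      have "2 * ((XX 0 *\<^sub>v (?A *\<^sub>v v)) \<bullet> (drift n AJ *\<^sub>v v) +
          (channel n BJ\<^sup>T *\<^sub>v (XX 0 *\<^sub>v (?A *\<^sub>v v))) \<bullet> (KJ t *\<^sub>v (channel n CJ *\<^sub>v v))) <
          v \<bullet> (XX t *\<^sub>v v) + (?A *\<^sub>v v) \<bullet> (XX 0 *\<^sub>v (?A *\<^sub>v v))"
        using KJ_neg tJ v w by blast
      then have "2 * ((XX 0 *\<^sub>v (?A *\<^sub>v v)) \<bullet> (?A *\<^sub>v v)) <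
          v \<bullet> (XX t *\<^sub>v v) + (?A *\<^sub>v v) \<bullet> (XX 0 *\<^sub>v (?A *\<^sub>v v))"
        unfolding KJ_eq[OF tJ] drift_def closed_loop_as_channel[OF jump Jc[OF tJ] XXw v(1), symmetric] .
      moreover have "(XX 0 *\<^sub>v (?A *\<^sub>v v)) \<bullet> (?A *\<^sub>v v) = (?A *\<^sub>v v) \<bullet> (XX 0 *\<^sub>v (?A *\<^sub>v v))"
        by (rule comm_scalar_prod[OF XXw w])
      ultimately show "v \<bullet> ((?A\<^sup>T * XX 0 * ?A - XX t) *\<^sub>v v) < 0"
        unfolding form(3)[OF v(1)] by linarith
    qed
  qed
  have controller: "clock_dependent_controller Tmin Tmax m q mJ qJ K"
    using F J by (simp add: clock_dependent_controller_def K_def)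
  have order: "order_c K = n" by (simp add: K_def)
  have "clock_LMIs_feasible Tmin Tmax (n + order_c K) (closed_loop_flow A B C K) (closed_loop_jump AJ BJ CJ K)"
    unfolding clock_LMIs_feasible_def order C1_sym_mat_on_def
    using XX1 XXs XXpd flow_neg jump_neg by blast
  then show ?thesis using controller by blast
qed

section \<open>From a controller to the projected inequalities\<close>

definition corner :: "nat \<Rightarrow> real mat \<Rightarrow> real mat" where
  "corner n M = Matrix.mat n n (\<lambda>(i, j). M $$ (i, j))"

lemma corner_carrier: "corner n M \<in> carrier_mat n n"
  by (simp add: corner_def)

lemma corner_symmetric:
  assumes "M \<in> carrier_mat (n + k) (n + k)" "M\<^sup>T = M"
  shows "(corner n M)\<^sup>T = corner n M"
proof (rule eq_matI)
  fix i j assume "i < dim_row (corner n M)" "j < dim_col (corner n M)"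
  then have ij: "i < n" "j < n" by (simp_all add: corner_def)
  have "M $$ (j, i) = M\<^sup>T $$ (i, j)" using assms(1) ij by simp
  then show "(corner n M)\<^sup>T $$ (i, j) = corner n M $$ (i, j)"
    using ij by (simp add: corner_def assms(2))
qed (simp_all add: corner_def)

lemma corner_form:
  fixes M :: "real mat" and x y :: "real vec"
  assumes M: "M \<in> carrier_mat (n + k) (n + k)" and x: "x \<in> carrier_vec n" and y: "y \<in> carrier_vec n"
  shows "x \<bullet> (corner n M *\<^sub>v y) = (x @\<^sub>v 0\<^sub>v k) \<bullet> (M *\<^sub>v (y @\<^sub>v 0\<^sub>v k))"
proof -
  let ?M2 = "Matrix.mat n k (\<lambda>(i, j). M $$ (i, n + j))" and ?M3 = "Matrix.mat k n (\<lambda>(i, j). M $$ (n + i, j))"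
    and ?M4 = "Matrix.mat k k (\<lambda>(i, j). M $$ (n + i, n + j))"
  have M2: "?M2 \<in> carrier_mat n k" and M3: "?M3 \<in> carrier_mat k n" and M4: "?M4 \<in> carrier_mat k k"
    by simp_all
  have z: "(0\<^sub>v k :: real vec) \<in> carrier_vec k" by simp
  have M_eq: "M = four_block_mat (corner n M) ?M2 ?M3 ?M4"
    using M by (intro eq_matI) (auto simp: corner_def Let_def)
  note car = mult_mat_vec_carrier[OF corner_carrier y, of M] mult_mat_vec_carrier[OF M3 y]
  have "four_block_mat (corner n M) ?M2 ?M3 ?M4 *\<^sub>v (y @\<^sub>v 0\<^sub>v k) = (corner n M *\<^sub>v y) @\<^sub>v (?M3 *\<^sub>v y)"
    by (simp only: four_block_mat_mult_vec[OF corner_carrier M2 M3 M4 y z] mult_mat_vec_zero[OF M2]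
        mult_mat_vec_zero[OF M4] right_zero_vec[OF car(1)] right_zero_vec[OF car(2)])
  then have "M *\<^sub>v (y @\<^sub>v 0\<^sub>v k) = (corner n M *\<^sub>v y) @\<^sub>v (?M3 *\<^sub>v y)"
    by (simp only: M_eq[symmetric])
  then show ?thesis
    by (simp only: scalar_prod_append_zero(2)[OF car x])
qed

lemma C1_corner:
  assumes ab: "a < b" and F: "C1_mat_on {a..b} (n + k) (n + k) F"
  shows "C1_mat_on {a..b} n n (\<lambda>t. corner n (F t))"
proof -
  note F' = F[unfolded C1_mat_on_iff[OF ab]]
  have "C1.mat_entries {a..b} n n (\<lambda>t. Matrix.mat n n (\<lambda>(i, j). F t $$ (i, j)))"
    by (rule C1.mat_entries_submatrix[OF F', of n "\<lambda>i. i" n "\<lambda>j. j"]) simp_all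
  then show ?thesis
    by (simp only: C1_mat_on_iff[OF ab] corner_def)
qed

text \<open>Young's inequality for vectors padded with zeros bounds - 2 b^T a by the form of P^(-1)
  at a plus the form of P at b. The doubled corner contributes a second copy of the latter, which is
  positive for nonzero b; for b = 0 the form of P^(-1) at a is positive.\<close>

lemma coupling_of_corners:
  fixes P :: "real mat"
  assumes P: "P \<in> carrier_mat (n + k) (n + k)" and pd: "pos_def P"
  shows "pos_def (four_block_mat (corner n (inv_mat P)) (1\<^sub>m n) (1\<^sub>m n) (2 \<cdot>\<^sub>m corner n P))"
proof -
  note N = pos_def_inv_mat[OF P pd]
  let ?X = "2 \<cdot>\<^sub>m corner n P" and ?Y = "corner n (inv_mat P)"
  have X: "?X \<in> carrier_mat n n" using corner_carrier by simp
  note Y = corner_carrier[of n "inv_mat P"]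
  have I: "(1\<^sub>m n :: real mat) \<in> carrier_mat n n" "(1\<^sub>m n :: real mat)\<^sup>T = 1\<^sub>m n" by simp_all
  have Xs: "?X\<^sup>T = ?X" by (simp only: smult_transpose corner_symmetric[OF P pos_def_symmetric[OF pd]])
  have Ys: "?Y\<^sup>T = ?Y" by (rule corner_symmetric[OF N(1,2)])
  let ?M = "four_block_mat ?Y (1\<^sub>m n) (1\<^sub>m n) ?X"
  have M: "?M \<in> carrier_mat (n + n) (n + n)" by (rule four_block_carrier_mat[OF Y X])
  have z: "(0\<^sub>v k :: real vec) \<in> carrier_vec k" by simp
  show ?thesis
    unfolding pos_def_iff[OF M]
  proof (intro conjI ballI impI)
    show "?M\<^sup>T = ?M"
      by (simp only: transpose_four_block_mat[OF Y I(1) I(1) X] I(2) Xs Ys)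
    fix v :: "real vec" assume v: "v \<in> carrier_vec (n + n)" "v \<noteq> 0\<^sub>v (n + n)"
    obtain a b where a: "a \<in> carrier_vec n" and b: "b \<in> carrier_vec n" and v_eq: "v = a @\<^sub>v b"
      using append_vec_cases[OF v(1)] .
    let ?a = "a @\<^sub>v 0\<^sub>v k" and ?b = "b @\<^sub>v 0\<^sub>v k"
    have a': "?a \<in> carrier_vec (n + k)" and b': "?b \<in> carrier_vec (n + k)"
      using a b by simp_all
    note Pb = mult_mat_vec_carrier[OF P b']
    have mb: "(-1) \<cdot>\<^sub>v ?b \<in> carrier_vec (n + k)" using b' by (rule smult_carrier_vec[THEN iffD2])
    have form: "v \<bullet> (?M *\<^sub>v v) = ?a \<bullet> (inv_mat P *\<^sub>v ?a) + 2 * (b \<bullet> a) + 2 * (?b \<bullet> (P *\<^sub>v ?b))"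
    proof -
      have "b \<bullet> (?X *\<^sub>v b) = 2 * (b \<bullet> (corner n P *\<^sub>v b))"
        by (simp only: smult_mat_mult_vec[OF corner_carrier b]
            scalar_prod_smult_distrib[OF b mult_mat_vec_carrier[OF corner_carrier b]])
      then show ?thesis
        using two_block_form[OF Y I(1) X a b]
        by (simp only: v_eq I(2) one_mult_mat_vec[OF a] corner_form[OF P b b] corner_form[OF N(1) a a])
    qed
    \<comment> \<open>The inequality is applied to minus b, so that its cross term can be moved over
      with the sign it has in the coupling form.\<close>
    have "2 * (((-1) \<cdot>\<^sub>v ?b) \<bullet> ?a) \<le> ?a \<bullet> (inv_mat P *\<^sub>v ?a) + ((-1) \<cdot>\<^sub>v ?b) \<bullet> (P *\<^sub>v ((-1) \<cdot>\<^sub>v ?b))"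
      by (rule young_inequality[OF P pd a' mb])
    moreover have "((-1) \<cdot>\<^sub>v ?b) \<bullet> ?a = - (b \<bullet> a)"
      using scalar_prod_append_zero(2)[OF a z b] smult_scalar_prod_distrib[OF b' a', of "-1"] by simp
    moreover have "((-1) \<cdot>\<^sub>v ?b) \<bullet> (P *\<^sub>v ((-1) \<cdot>\<^sub>v ?b)) = ?b \<bullet> (P *\<^sub>v ?b)"
    proof -
      have "(-1) \<cdot>\<^sub>v (P *\<^sub>v ?b) \<in> carrier_vec (n + k)" using Pb by (rule smult_carrier_vec[THEN iffD2])
      note smult_scalar_prod_distrib[OF b' this, of "-1"] scalar_prod_smult_distrib[OF b' Pb, of "-1"]
      then show ?thesis by (simp only: mult_mat_vec[OF P b'])
    qed
    ultimately have young: "?a \<bullet> (inv_mat P *\<^sub>v ?a) + 2 * (b \<bullet> a) + ?b \<bullet> (P *\<^sub>v ?b) \<ge> 0"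
      by linarith
    show "v \<bullet> (?M *\<^sub>v v) > 0"
    proof (cases "b = 0\<^sub>v n")
      case True
      then have "a \<noteq> 0\<^sub>v n" using v(2) append_vec_eq_zero_iff[OF a b] v_eq by blast
      then have "?a \<noteq> 0\<^sub>v (n + k)" using append_vec_eq_zero_iff[OF a z] by blast
      from pos_def_form_nonneg(2)[OF N(1) pos_def_inv_mat_pos_def[OF P pd] a' this]
      have "?a \<bullet> (inv_mat P *\<^sub>v ?a) > 0" .
      moreover have "b \<bullet> a = 0" using True a by simp
      moreover have "?b \<bullet> (P *\<^sub>v ?b) \<ge> 0" by (rule pos_def_form_nonneg(1)[OF P pd b'])
      ultimately show ?thesis unfolding form by linarith
    next
      case False
      then have "?b \<noteq> 0\<^sub>v (n + k)" using append_vec_eq_zero_iff[OF b z] by blast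
      from pos_def_form_nonneg(2)[OF P pd b' this] young show ?thesis unfolding form by linarith
    qed
  qed
qed

text \<open>With zero controller state and zero output every controller signal vanishes. Dually, a
  covector that annihilates the range of B and has no controller component sees neither the inputs
  nor the controller dynamics.\<close>

lemma closed_loop_on_kernel:
  fixes A B C :: "real mat"
  assumes plant: "A \<in> carrier_mat n n" "B \<in> carrier_mat n m" "C \<in> carrier_mat q n"
    and gains: "Ac \<in> carrier_mat k k" "Bc \<in> carrier_mat k q" "Cc \<in> carrier_mat m k" "Dc \<in> carrier_mat m q"
  shows "x \<in> mat_kernel C \<Longrightarrow> closed_loop A B C Ac Bc Cc Dc *\<^sub>v (x @\<^sub>v 0\<^sub>v k) = (A *\<^sub>v x) @\<^sub>v 0\<^sub>v k"
    and "x \<in> mat_kernel B\<^sup>T \<Longrightarrow> a \<in> carrier_vec n \<Longrightarrow> b \<in> carrier_vec k \<Longrightarrow>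
      (x @\<^sub>v 0\<^sub>v k) \<bullet> (closed_loop A B C Ac Bc Cc Dc *\<^sub>v (a @\<^sub>v b)) = (A\<^sup>T *\<^sub>v x) \<bullet> a"
proof -
  have z: "(0\<^sub>v k :: real vec) \<in> carrier_vec k" by simp
  show "closed_loop A B C Ac Bc Cc Dc *\<^sub>v (x @\<^sub>v 0\<^sub>v k) = (A *\<^sub>v x) @\<^sub>v 0\<^sub>v k" if "x \<in> mat_kernel C"
  proof -
    note x = mat_kernelD[OF plant(3) that]
    have zz: "0\<^sub>v m + 0\<^sub>v m = (0\<^sub>v m :: real vec)" "0\<^sub>v k + 0\<^sub>v k = (0\<^sub>v k :: real vec)" by simp_all
    show ?thesis
      by (simp only: closed_loop_mult_vec[OF plant gains x(1) z] x(2) mult_mat_vec_zero[OF gains(1)]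
          mult_mat_vec_zero[OF gains(2)] mult_mat_vec_zero[OF gains(3)] mult_mat_vec_zero[OF gains(4)] zz
          mult_mat_vec_zero[OF plant(2)] right_zero_vec[OF mult_mat_vec_carrier[OF plant(1) x(1)]])
  qed
  assume "x \<in> mat_kernel B\<^sup>T" and a: "a \<in> carrier_vec n" and b: "b \<in> carrier_vec k"
  have BT: "B\<^sup>T \<in> carrier_mat m n" using plant(2) by simp
  note x = mat_kernelD[OF BT \<open>x \<in> mat_kernel B\<^sup>T\<close>]
  note Ca = mult_mat_vec_carrier[OF plant(3) a]
  note u = add_carrier_vec[OF mult_mat_vec_carrier[OF gains(3) b] mult_mat_vec_carrier[OF gains(4) Ca]]
  note xc = add_carrier_vec[OF mult_mat_vec_carrier[OF gains(1) b] mult_mat_vec_carrier[OF gains(2) Ca]]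
  show "(x @\<^sub>v 0\<^sub>v k) \<bullet> (closed_loop A B C Ac Bc Cc Dc *\<^sub>v (a @\<^sub>v b)) = (A\<^sup>T *\<^sub>v x) \<bullet> a"
    by (simp only: closed_loop_scalar_prod[OF plant gains a b x(1) z] x(2) scalar_prod_left_zero[OF u]
        scalar_prod_left_zero[OF xc] add_0_right transpose_vec_mult_scalar[OF plant(1) a x(1)])
qed

text \<open>Each projected inequality is a closed-loop inequality at one vector. For X it is (x, 0);
  for the flow inequality of Y it is the preimage of (x, 0) under the Lyapunov matrix; for the jump
  inequality of Y it is the preimage of (AJ^T x, 0).\<close>

lemma necessary_conditions:
  fixes A B C AJ BJ CJ :: "real mat" and XX :: "real \<Rightarrow> real mat"
  assumes T: "0 < Tmin" "Tmin < Tmax"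
    and plant: "A \<in> carrier_mat n n" "B \<in> carrier_mat n m" "C \<in> carrier_mat q n"
    and jump: "AJ \<in> carrier_mat n n" "BJ \<in> carrier_mat n mJ" "CJ \<in> carrier_mat qJ n"
    and controller: "clock_dependent_controller Tmin Tmax m q mJ qJ K"
    and XX1: "C1_mat_on {0..Tmax} (n + order_c K) (n + order_c K) XX"
    and pd: "\<And>t. t \<in> {0..Tmax} \<Longrightarrow> pos_def (XX t)"
    and flow: "\<And>t. t \<in> {0..Tmax} \<Longrightarrow> neg_def (mat_deriv {0..Tmax} XX t +
      (closed_loop_flow A B C K t)\<^sup>T * XX t + XX t * closed_loop_flow A B C K t)"
    and jumps: "\<And>t. t \<in> {Tmin..Tmax} \<Longrightarrow> neg_def ((closed_loop_jump AJ BJ CJ K t)\<^sup>T * XX 0 *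
      closed_loop_jump AJ BJ CJ K t - XX t)"
  defines "X \<equiv> \<lambda>t. 2 \<cdot>\<^sub>m corner n (XX t)" and "Y \<equiv> \<lambda>t. corner n (inv_mat (XX t))"
  shows "C1_sym_mat_on {0..Tmax} n X" "C1_sym_mat_on {0..Tmax} n Y"
    and "\<And>t. t \<in> {0..Tmax} \<Longrightarrow> pos_def (four_block_mat (Y t) (1\<^sub>m n) (1\<^sub>m n) (X t))"
    and "\<And>t x. t \<in> {0..Tmax} \<Longrightarrow> x \<in> mat_kernel C \<Longrightarrow> x \<noteq> 0\<^sub>v n \<Longrightarrow>
      x \<bullet> (mat_deriv {0..Tmax} X t *\<^sub>v x) + 2 * ((A *\<^sub>v x) \<bullet> (X t *\<^sub>v x)) < 0"
    and "\<And>t x. t \<in> {0..Tmax} \<Longrightarrow> x \<in> mat_kernel B\<^sup>T \<Longrightarrow> x \<noteq> 0\<^sub>v n \<Longrightarrow>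
      x \<bullet> (mat_deriv {0..Tmax} Y t *\<^sub>v x) - 2 * ((A\<^sup>T *\<^sub>v x) \<bullet> (Y t *\<^sub>v x)) > 0"
    and "\<And>t x. t \<in> {Tmin..Tmax} \<Longrightarrow> x \<in> mat_kernel CJ \<Longrightarrow> x \<noteq> 0\<^sub>v n \<Longrightarrow>
      (AJ *\<^sub>v x) \<bullet> (X 0 *\<^sub>v (AJ *\<^sub>v x)) < x \<bullet> (X t *\<^sub>v x)"
    and "\<And>t x. t \<in> {Tmin..Tmax} \<Longrightarrow> x \<in> mat_kernel BJ\<^sup>T \<Longrightarrow> x \<noteq> 0\<^sub>v n \<Longrightarrow>
      (AJ\<^sup>T *\<^sub>v x) \<bullet> (Y t *\<^sub>v (AJ\<^sup>T *\<^sub>v x)) < x \<bullet> (Y 0 *\<^sub>v x)"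
proof -
  let ?S = "{0..Tmax}" and ?J = "{Tmin..Tmax}"
  define k where "k = order_c K"
  note XX1 = XX1[folded k_def]
  have T0: "0 < Tmax" using T by linarith
  have JS: "t \<in> ?S" if "t \<in> ?J" for t using that T by auto
  have zeroS: "0 \<in> ?S" using T0 by simp
  note XXc = C1_mat_on_carrier[OF XX1]
  note XXs = pos_def_symmetric[OF pd]
  define YY where "YY t = inv_mat (XX t)" for t
  have YY_eq: "YY = (\<lambda>t. inv_mat (XX t))" by (simp add: fun_eq_iff YY_def)
  have YY1: "C1_mat_on ?S (n + k) (n + k) YY"
    unfolding YY_eq by (rule C1_inv_mat[OF T0 XX1 pd])
  note YYc = C1_mat_on_carrier[OF YY1]
  have YYs: "(YY t)\<^sup>T = YY t" and XXYY: "v \<in> carrier_vec (n + k) \<Longrightarrow> XX t *\<^sub>v (YY t *\<^sub>v v) = v"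
    and YYpd: "pos_def (YY t)" if t: "t \<in> ?S" for t v
    unfolding YY_def by (rule pos_def_inv_mat[OF XXc[OF t] pd[OF t]], erule pos_def_inv_mat[OF XXc[OF t] pd[OF t]],
        rule pos_def_inv_mat_pos_def[OF XXc[OF t] pd[OF t]])
  have X1: "C1_mat_on ?S n n X"
    unfolding X_def C1_mat_on_iff[OF T0]
    by (rule C1.mat_entries_smult[OF C1.const C1_corner[OF T0 XX1, unfolded C1_mat_on_iff[OF T0]]])
  have Y_eq: "Y = (\<lambda>t. corner n (YY t))" unfolding Y_def YY_eq ..
  have Y1: "C1_mat_on ?S n n Y"
    unfolding Y_eq by (rule C1_corner[OF T0 YY1])
  have Xs: "(X t)\<^sup>T = X t" and Ys: "(Y t)\<^sup>T = Y t" if t: "t \<in> ?S" for t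
    unfolding X_def Y_eq
    by (simp only: smult_transpose corner_symmetric[OF XXc[OF t] XXs[OF t]], rule corner_symmetric[OF YYc[OF t] YYs[OF t]])
  show "C1_sym_mat_on ?S n X" "C1_sym_mat_on ?S n Y"
    unfolding C1_sym_mat_on_def using X1 Y1 Xs Ys by blast+
  show "pos_def (four_block_mat (Y t) (1\<^sub>m n) (1\<^sub>m n) (X t))" if t: "t \<in> ?S" for t
    unfolding X_def Y_def by (rule coupling_of_corners[OF XXc[OF t] pd[OF t]])
  have X_form: "x \<bullet> (X t *\<^sub>v y) = 2 * ((x @\<^sub>v 0\<^sub>v k) \<bullet> (XX t *\<^sub>v (y @\<^sub>v 0\<^sub>v k)))"
    if t: "t \<in> ?S" and x: "x \<in> carrier_vec n" and y: "y \<in> carrier_vec n" for t and x y :: "real vec"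
    unfolding X_def smult_mat_mult_vec[OF corner_carrier y]
      scalar_prod_smult_distrib[OF x mult_mat_vec_carrier[OF corner_carrier y]] corner_form[OF XXc[OF t] x y] ..
  have Y_form: "x \<bullet> (Y t *\<^sub>v y) = (x @\<^sub>v 0\<^sub>v k) \<bullet> (YY t *\<^sub>v (y @\<^sub>v 0\<^sub>v k))"
    if t: "t \<in> ?S" and x: "x \<in> carrier_vec n" and y: "y \<in> carrier_vec n" for t and x y :: "real vec"
    unfolding Y_eq by (rule corner_form[OF YYc[OF t] x y])
  have Fc: "A_c K t \<in> carrier_mat k k" "B_c K t \<in> carrier_mat k q" "C_c K t \<in> carrier_mat m k" "D_c K t \<in> carrier_mat m q"
    if "t \<in> ?S" for t
    using controller that unfolding clock_dependent_controller_def continuous_mat_on_def k_def by simp_all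
  have Jc: "AJ_c K t \<in> carrier_mat k k" "BJ_c K t \<in> carrier_mat k qJ" "CJ_c K t \<in> carrier_mat mJ k" "DJ_c K t \<in> carrier_mat mJ qJ"
    if "t \<in> ?J" for t
    using controller that unfolding clock_dependent_controller_def continuous_mat_on_def k_def by simp_all
  let ?A = "\<lambda>t. closed_loop A B C (A_c K t) (B_c K t) (C_c K t) (D_c K t)"
  let ?AJ = "\<lambda>t. closed_loop AJ BJ CJ (AJ_c K t) (BJ_c K t) (CJ_c K t) (DJ_c K t)"
  have flow_eq: "closed_loop_flow A B C K t = ?A t" for t
    by (simp add: closed_loop_flow_def closed_loop_def)
  have jump_eq: "closed_loop_jump AJ BJ CJ K t = ?AJ t" for t
    by (simp add: closed_loop_jump_def closed_loop_def)
  have flow_neg: "v \<bullet> (mat_deriv ?S XX t *\<^sub>v v) + 2 * ((XX t *\<^sub>v v) \<bullet> (?A t *\<^sub>v v)) < 0"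
    if t: "t \<in> ?S" and v: "v \<in> carrier_vec (n + k)" "v \<noteq> 0\<^sub>v (n + k)" for t and v :: "real vec"
  proof -
    have D: "mat_deriv ?S XX t \<in> carrier_mat (n + k) (n + k)"
      by (rule mat_deriv_carrier[of XX t, OF XXc[OF t]])
    have Ds: "(mat_deriv ?S XX t)\<^sup>T = mat_deriv ?S XX t"
      by (rule mat_deriv_symmetric[OF T0 XX1 XXs t])
    note form = lyapunov_form[OF D Ds XXc[OF t] XXs[OF t] closed_loop_carrier[OF plant Fc[OF t]]]
    have "v \<bullet> ((mat_deriv ?S XX t + (?A t)\<^sup>T * XX t + XX t * ?A t) *\<^sub>v v) < 0"
      using flow[OF t] v unfolding flow_eq neg_def_iff[OF form(1)] by blast
    then show ?thesis unfolding form(3)[OF v(1)] .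
  qed
  have jump_neg: "(?AJ t *\<^sub>v v) \<bullet> (XX 0 *\<^sub>v (?AJ t *\<^sub>v v)) < v \<bullet> (XX t *\<^sub>v v)"
    if t: "t \<in> ?J" and v: "v \<in> carrier_vec (n + k)" "v \<noteq> 0\<^sub>v (n + k)" for t and v :: "real vec"
  proof -
    note form = stein_form[OF XXc[OF zeroS] XXs[OF zeroS] XXc[OF JS[OF t]] XXs[OF JS[OF t]]
        closed_loop_carrier[OF jump Jc[OF t]]]
    have "v \<bullet> (((?AJ t)\<^sup>T * XX 0 * ?AJ t - XX t) *\<^sub>v v) < 0"
      using jumps[OF t] v unfolding jump_eq neg_def_iff[OF form(1)] by blast
    then show ?thesis unfolding form(3)[OF v(1)] by linarith
  qed
  have z: "(0\<^sub>v k :: real vec) \<in> carrier_vec k" by simp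
  have BT: "B\<^sup>T \<in> carrier_mat m n" and BJT: "BJ\<^sup>T \<in> carrier_mat mJ n" using plant(2) jump(2) by simp_all
  have AT: "A\<^sup>T \<in> carrier_mat n n" and AJT: "AJ\<^sup>T \<in> carrier_mat n n" using plant(1) jump(1) by simp_all
  have embed: "x @\<^sub>v 0\<^sub>v k \<in> carrier_vec (n + k)" "x \<noteq> 0\<^sub>v n \<Longrightarrow> x @\<^sub>v 0\<^sub>v k \<noteq> 0\<^sub>v (n + k)"
    if "x \<in> carrier_vec n" for x :: "real vec"
    using append_vec_eq_zero_iff[OF that z] append_carrier_vec[OF that z] by blast+
  have YY_nonzero: "YY t *\<^sub>v v \<noteq> 0\<^sub>v (n + k)"
    if t: "t \<in> ?S" and v: "v \<in> carrier_vec (n + k)" "v \<noteq> 0\<^sub>v (n + k)" for t and v :: "real vec"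
    using XXYY[OF t v(1)] v(2) mult_mat_vec_zero[OF XXc[OF t]] by metis

  show "x \<bullet> (mat_deriv ?S X t *\<^sub>v x) + 2 * ((A *\<^sub>v x) \<bullet> (X t *\<^sub>v x)) < 0"
    if t: "t \<in> ?S" and ker: "x \<in> mat_kernel C" and nz: "x \<noteq> 0\<^sub>v n" for t x
  proof -
    note x = mat_kernelD(1)[OF plant(3) ker]
    note Ax = mult_mat_vec_carrier[OF plant(1) x]
    let ?v = "x @\<^sub>v 0\<^sub>v k"
    note v = embed(1)[OF x]
    have 1: "x \<bullet> (mat_deriv ?S X t *\<^sub>v x) = 2 * (?v \<bullet> (mat_deriv ?S XX t *\<^sub>v ?v))"
      by (rule bilinear_form_deriv_cong[OF T0 X1 XX1 t x x v v]) (rule X_form[OF _ x x])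
    have "(XX t *\<^sub>v ?v) \<bullet> (?A t *\<^sub>v ?v) = (?A t *\<^sub>v ?v) \<bullet> (XX t *\<^sub>v ?v)"
      by (rule comm_scalar_prod[OF mult_mat_vec_carrier[OF XXc[OF t] v]
            mult_mat_vec_carrier[OF closed_loop_carrier[OF plant Fc[OF t]] v]])
    also have "2 * \<dots> = (A *\<^sub>v x) \<bullet> (X t *\<^sub>v x)"
      unfolding X_form[OF t Ax x] closed_loop_on_kernel(1)[OF plant Fc[OF t] ker] ..
    finally show ?thesis
      using flow_neg[OF t v embed(2)[OF x nz]] 1 by linarith
  qed
  show "x \<bullet> (mat_deriv ?S Y t *\<^sub>v x) - 2 * ((A\<^sup>T *\<^sub>v x) \<bullet> (Y t *\<^sub>v x)) > 0"
    if t: "t \<in> ?S" and ker: "x \<in> mat_kernel B\<^sup>T" and nz: "x \<noteq> 0\<^sub>v n" for t x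
  proof -
    note x = mat_kernelD(1)[OF BT ker]
    note ATx = mult_mat_vec_carrier[OF AT x]
    let ?x = "x @\<^sub>v 0\<^sub>v k"
    note x' = embed(1)[OF x]
    define v where "v = YY t *\<^sub>v ?x"
    have v: "v \<in> carrier_vec (n + k)" unfolding v_def by (rule mult_mat_vec_carrier[OF YYc[OF t] x'])
    have v_nz: "v \<noteq> 0\<^sub>v (n + k)" unfolding v_def by (rule YY_nonzero[OF t x' embed(2)[OF x nz]])
    have XXv: "XX t *\<^sub>v v = ?x" unfolding v_def by (rule XXYY[OF t x'])
    obtain a b where a: "a \<in> carrier_vec n" and b: "b \<in> carrier_vec k" and v_eq: "v = a @\<^sub>v b"
      using append_vec_cases[OF v] .
    have "x \<bullet> (mat_deriv ?S Y t *\<^sub>v x) = 1 * (?x \<bullet> (mat_deriv ?S YY t *\<^sub>v ?x))"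
      by (rule bilinear_form_deriv_cong[OF T0 Y1 YY1 t x x x' x']) (simp only: Y_form[OF _ x x] mult_1)
    \<comment> \<open>Passing to the inverse reverses the sign of the derivative, which is why the
      inequality for Y points the other way.\<close>
    also have "\<dots> = - (v \<bullet> (mat_deriv ?S XX t *\<^sub>v v))"
      using inv_mat_deriv_form[OF T0 XX1 pd t v] unfolding XXv YY_eq by simp
    finally have 1: "x \<bullet> (mat_deriv ?S Y t *\<^sub>v x) = - (v \<bullet> (mat_deriv ?S XX t *\<^sub>v v))" .
    have "(A\<^sup>T *\<^sub>v x) \<bullet> (Y t *\<^sub>v x) = (A\<^sup>T *\<^sub>v x) \<bullet> a"
      unfolding Y_form[OF t ATx x] v_def[symmetric] v_eq by (rule scalar_prod_append_zero(2)[OF a b ATx])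
    also have "\<dots> = (XX t *\<^sub>v v) \<bullet> (?A t *\<^sub>v v)"
      unfolding XXv unfolding v_eq by (rule closed_loop_on_kernel(2)[OF plant Fc[OF t] ker a b, symmetric])
    finally show ?thesis
      using flow_neg[OF t v v_nz] 1 by linarith
  qed
  show "(AJ *\<^sub>v x) \<bullet> (X 0 *\<^sub>v (AJ *\<^sub>v x)) < x \<bullet> (X t *\<^sub>v x)"
    if t: "t \<in> ?J" and ker: "x \<in> mat_kernel CJ" and nz: "x \<noteq> 0\<^sub>v n" for t x
  proof -
    note x = mat_kernelD(1)[OF jump(3) ker]
    note Ax = mult_mat_vec_carrier[OF jump(1) x]
    show ?thesis
      using jump_neg[OF t embed(1)[OF x] embed(2)[OF x nz]]
      unfolding closed_loop_on_kernel(1)[OF jump Jc[OF t] ker] X_form[OF zeroS Ax Ax] X_form[OF JS[OF t] x x]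
      by linarith
  qed
  show "(AJ\<^sup>T *\<^sub>v x) \<bullet> (Y t *\<^sub>v (AJ\<^sup>T *\<^sub>v x)) < x \<bullet> (Y 0 *\<^sub>v x)"
    if tJ: "t \<in> ?J" and ker: "x \<in> mat_kernel BJ\<^sup>T" and nz: "x \<noteq> 0\<^sub>v n" for t x
  proof -
    note t = JS[OF tJ]
    note x = mat_kernelD(1)[OF BJT ker]
    let ?g = "AJ\<^sup>T *\<^sub>v x"
    note g = mult_mat_vec_carrier[OF AJT x]
    let ?x = "x @\<^sub>v 0\<^sub>v k"
    \<comment> \<open>Let s = g^T Y(t) g and let u be the image of v under the jump. Then the
      Lyapunov form at v and the pairing of u with (x, 0) both equal s. Young's inequality gives 2 s
      \<le> x^T Y(0) x + u^T Z(0) u with Z the Lyapunov matrix, and the decrease at the jump gives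
      u^T Z(0) u < s, hence s < x^T Y(0) x.\<close>
    define v where "v = YY t *\<^sub>v (?g @\<^sub>v 0\<^sub>v k)"
    note g' = embed(1)[OF g] and x' = embed(1)[OF x]
    have v: "v \<in> carrier_vec (n + k)" unfolding v_def by (rule mult_mat_vec_carrier[OF YYc[OF t] g'])
    have XXv: "XX t *\<^sub>v v = ?g @\<^sub>v 0\<^sub>v k" unfolding v_def by (rule XXYY[OF t g'])
    obtain a b where a: "a \<in> carrier_vec n" and b: "b \<in> carrier_vec k" and v_eq: "v = a @\<^sub>v b"
      using append_vec_cases[OF v] .
    note u = mult_mat_vec_carrier[OF closed_loop_carrier[OF jump Jc[OF tJ]] v]
    let ?u = "?AJ t *\<^sub>v v"
    have s: "?g \<bullet> (Y t *\<^sub>v ?g) = ?g \<bullet> a"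
      unfolding Y_form[OF t g g] v_def[symmetric] v_eq by (rule scalar_prod_append_zero(2)[OF a b g])
    have "v \<bullet> (XX t *\<^sub>v v) = a \<bullet> ?g"
      unfolding XXv unfolding v_eq by (rule scalar_prod_append_zero(1)[OF a b g])
    also have "\<dots> = ?g \<bullet> a" by (rule comm_scalar_prod[OF a g])
    finally have vv: "v \<bullet> (XX t *\<^sub>v v) = ?g \<bullet> a" .
    have "?u \<bullet> ?x = ?x \<bullet> ?u" by (rule comm_scalar_prod[OF u x'])
    also have "\<dots> = ?g \<bullet> a"
      unfolding v_eq by (rule closed_loop_on_kernel(2)[OF jump Jc[OF tJ] ker a b])
    finally have ux: "?u \<bullet> ?x = ?g \<bullet> a" .
    have young: "2 * (?u \<bullet> ?x) \<le> x \<bullet> (Y 0 *\<^sub>v x) + ?u \<bullet> (XX 0 *\<^sub>v ?u)"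
      unfolding Y_form[OF zeroS x x] YY_def by (rule young_inequality[OF XXc[OF zeroS] pd[OF zeroS] x' u])
    show ?thesis
    \<comment> \<open>For g = 0 also v = 0, and the strict decrease at the jump says nothing; the
      claim is then the positivity of Y(0).\<close>
    proof (cases "?g = 0\<^sub>v n")
      case True
      have "?g \<bullet> a = 0" using True a by simp
      moreover have "x \<bullet> (Y 0 *\<^sub>v x) > 0"
        unfolding Y_form[OF zeroS x x]
        by (rule pos_def_form_nonneg(2)[OF YYc[OF zeroS] YYpd[OF zeroS] x' embed(2)[OF x nz]])
      ultimately show ?thesis unfolding s by linarith
    next
      case False
      have "v \<noteq> 0\<^sub>v (n + k)" unfolding v_def by (rule YY_nonzero[OF t g' embed(2)[OF g False]])
      from jump_neg[OF tJ v this] young show ?thesis unfolding s vv ux by linarith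
    qed
  qed
qed

section \<open>The stated matrix inequalities as sign conditions on kernels\<close>

context
  fixes M U A X Y D :: "real mat" and n k :: nat
  assumes M: "M \<in> carrier_mat k n" and U: "basis_matrix n (mat_kernel M) U"
    and A: "A \<in> carrier_mat n n"
    and X: "X \<in> carrier_mat n n" "X\<^sup>T = X" and D: "D \<in> carrier_mat n n" "D\<^sup>T = D"
begin

lemma zero_form: "x \<in> carrier_vec n \<Longrightarrow> y \<in> carrier_vec n \<Longrightarrow> x \<bullet> (0\<^sub>m n n *\<^sub>v y) = (0 :: real)"
proof -
  assume x: "x \<in> carrier_vec n" and y: "y \<in> carrier_vec n"
  have "(0\<^sub>m n n :: real mat) *\<^sub>v y = 0\<^sub>v n" using y by (auto intro!: eq_vecI)
  then show "x \<bullet> (0\<^sub>m n n *\<^sub>v y) = (0 :: real)" using x by simp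
qed

lemma uminus_form: "x \<in> carrier_vec n \<Longrightarrow> x \<bullet> (- X *\<^sub>v x) = - (x \<bullet> (X *\<^sub>v x))"
  using X(1) by simp

text \<open>D is the derivative of the matrix map in the two flow inequalities and its value at
  clock time 0 in the two jump inequalities.\<close>

lemma LMI_iff:
  shows "neg_def (U\<^sup>T * (1\<^sub>m n @\<^sub>r A)\<^sup>T * four_block_mat D X X (0\<^sub>m n n) * (1\<^sub>m n @\<^sub>r A) * U) \<longleftrightarrow>
      (\<forall>x\<in>mat_kernel M. x \<noteq> 0\<^sub>v n \<longrightarrow> x \<bullet> (D *\<^sub>v x) + 2 * ((A *\<^sub>v x) \<bullet> (X *\<^sub>v x)) < 0)" (is ?flow_primal)
    and "pos_def (U\<^sup>T * (- A\<^sup>T @\<^sub>r 1\<^sub>m n)\<^sup>T * four_block_mat (0\<^sub>m n n) X X D * (- A\<^sup>T @\<^sub>r 1\<^sub>m n) * U) \<longleftrightarrow>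
      (\<forall>x\<in>mat_kernel M. x \<noteq> 0\<^sub>v n \<longrightarrow> x \<bullet> (D *\<^sub>v x) - 2 * ((A\<^sup>T *\<^sub>v x) \<bullet> (X *\<^sub>v x)) > 0)" (is ?flow_dual)
    and "neg_def (U\<^sup>T * (1\<^sub>m n @\<^sub>r A)\<^sup>T * four_block_mat (- X) (0\<^sub>m n n) (0\<^sub>m n n) D * (1\<^sub>m n @\<^sub>r A) * U) \<longleftrightarrow>
      (\<forall>x\<in>mat_kernel M. x \<noteq> 0\<^sub>v n \<longrightarrow> (A *\<^sub>v x) \<bullet> (D *\<^sub>v (A *\<^sub>v x)) < x \<bullet> (X *\<^sub>v x))" (is ?jump_primal)
    and "pos_def (U\<^sup>T * (- A\<^sup>T @\<^sub>r 1\<^sub>m n)\<^sup>T * four_block_mat (- X) (0\<^sub>m n n) (0\<^sub>m n n) D * (- A\<^sup>T @\<^sub>r 1\<^sub>m n) * U) \<longleftrightarrow>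
      (\<forall>x\<in>mat_kernel M. x \<noteq> 0\<^sub>v n \<longrightarrow> (A\<^sup>T *\<^sub>v x) \<bullet> (X *\<^sub>v (A\<^sup>T *\<^sub>v x)) < x \<bullet> (D *\<^sub>v x))" (is ?jump_dual)
proof -
  have Z: "(0\<^sub>m n n :: real mat) \<in> carrier_mat n n" "(0\<^sub>m n n :: real mat)\<^sup>T = 0\<^sub>m n n" by simp_all
  have mX: "- X \<in> carrier_mat n n" "(- X)\<^sup>T = - X" using X by (simp_all add: transpose_uminus)
  have AT: "A\<^sup>T \<in> carrier_mat n n" using A by simp
  have cong: "(\<forall>x\<in>mat_kernel M. x \<noteq> 0\<^sub>v n \<longrightarrow> p x) \<longleftrightarrow> (\<forall>x\<in>mat_kernel M. x \<noteq> 0\<^sub>v n \<longrightarrow> r x)"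
    if "\<And>x. x \<in> carrier_vec n \<Longrightarrow> A *\<^sub>v x \<in> carrier_vec n \<Longrightarrow> A\<^sup>T *\<^sub>v x \<in> carrier_vec n \<Longrightarrow> p x \<longleftrightarrow> r x" for p r
  proof -
    have "p x \<longleftrightarrow> r x" if "x \<in> mat_kernel M" for x
      using mat_kernelD(1)[OF M that] mult_mat_vec_carrier[OF A] mult_mat_vec_carrier[OF AT] \<open>\<And>x. x \<in> carrier_vec n \<Longrightarrow> _ \<Longrightarrow> _ \<Longrightarrow> p x \<longleftrightarrow> r x\<close>
      by blast
    then show ?thesis by blast
  qed
  show ?flow_primal
    unfolding block_form_on_kernel(1)[OF M U D X Z A] by (rule cong) (simp only: zero_form add_0_right)
  show ?flow_dual
    unfolding block_form_on_kernel(2)[OF M U Z X D A]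
    by (rule cong) (simp only: zero_form, linarith)
  show ?jump_primal
    unfolding block_form_on_kernel(1)[OF M U mX Z D A]
    by (rule cong) (simp only: zero_form uminus_form, linarith)
  show ?jump_dual
    unfolding block_form_on_kernel(2)[OF M U mX Z D A]
    by (rule cong) (simp only: zero_form uminus_form, linarith)
qed

end

theorem theorem4:
  fixes n m q mJ qJ :: nat
    and Tmin Tmax :: real
    and A B C AJ BJ CJ U V UJ VJ :: "real mat"
  assumes "0 < Tmin" and "Tmin < Tmax"
    and "A \<in> carrier_mat n n" and "B \<in> carrier_mat n m" and "C \<in> carrier_mat q n"
    and "AJ \<in> carrier_mat n n" and "BJ \<in> carrier_mat n mJ" and "CJ \<in> carrier_mat qJ n"
    and "basis_matrix n (mat_kernel B\<^sup>T) U"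
    and "basis_matrix n (mat_kernel C) V"
    and "basis_matrix n (mat_kernel BJ\<^sup>T) UJ"
    and "basis_matrix n (mat_kernel CJ) VJ"
  shows "(\<exists>K. clock_dependent_controller Tmin Tmax m q mJ qJ K \<and>
        clock_LMIs_feasible Tmin Tmax (n + order_c K)
          (closed_loop_flow A B C K) (closed_loop_jump AJ BJ CJ K))
    \<longleftrightarrow>
    (\<exists>X Y. C1_sym_mat_on {0..Tmax} n X \<and> C1_sym_mat_on {0..Tmax} n Y \<and>
      (\<forall>\<tau>\<in>{0..Tmax}.
        pos_def (four_block_mat (Y \<tau>) (1\<^sub>m n) (1\<^sub>m n) (X \<tau>)) \<and>
        neg_def (V\<^sup>T * (1\<^sub>m n @\<^sub>r A)\<^sup>T *
          four_block_mat (mat_deriv {0..Tmax} X \<tau>) (X \<tau>) (X \<tau>) (0\<^sub>m n n) *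
          (1\<^sub>m n @\<^sub>r A) * V) \<and>
        pos_def (U\<^sup>T * (- A\<^sup>T @\<^sub>r 1\<^sub>m n)\<^sup>T *
          four_block_mat (0\<^sub>m n n) (Y \<tau>) (Y \<tau>) (mat_deriv {0..Tmax} Y \<tau>) *
          (- A\<^sup>T @\<^sub>r 1\<^sub>m n) * U)) \<and>
      (\<forall>\<tau>\<in>{Tmin..Tmax}.
        neg_def (VJ\<^sup>T * (1\<^sub>m n @\<^sub>r AJ)\<^sup>T *
          four_block_mat (- X \<tau>) (0\<^sub>m n n) (0\<^sub>m n n) (X 0) *
          (1\<^sub>m n @\<^sub>r AJ) * VJ) \<and>
        pos_def (UJ\<^sup>T * (- AJ\<^sup>T @\<^sub>r 1\<^sub>m n)\<^sup>T *
          four_block_mat (- Y \<tau>) (0\<^sub>m n n) (0\<^sub>m n n) (Y 0) *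
          (- AJ\<^sup>T @\<^sub>r 1\<^sub>m n) * UJ)))"
    (is "?L \<longleftrightarrow> (\<exists>X Y. ?R X Y)")
proof -
  note T = assms(1,2) and plant = assms(3,4,5) and jump = assms(6,7,8)
  have BT: "B\<^sup>T \<in> carrier_mat m n" and BJT: "BJ\<^sup>T \<in> carrier_mat mJ n" using plant(2) jump(2) by simp_all
  have T0: "0 < Tmax" using T by linarith
  \<comment> \<open>Once X and Y are known to be symmetric and continuously differentiable, the
    basis matrices disappear, and both directions of the theorem work with vectors in the
    kernels.\<close>
  have R_iff: "?R X Y \<longleftrightarrow>
      (\<forall>t\<in>{0..Tmax}. pos_def (four_block_mat (Y t) (1\<^sub>m n) (1\<^sub>m n) (X t)) \<and>
        (\<forall>x\<in>mat_kernel C. x \<noteq> 0\<^sub>v n \<longrightarrow>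
          x \<bullet> (mat_deriv {0..Tmax} X t *\<^sub>v x) + 2 * ((A *\<^sub>v x) \<bullet> (X t *\<^sub>v x)) < 0) \<and>
        (\<forall>x\<in>mat_kernel B\<^sup>T. x \<noteq> 0\<^sub>v n \<longrightarrow>
          x \<bullet> (mat_deriv {0..Tmax} Y t *\<^sub>v x) - 2 * ((A\<^sup>T *\<^sub>v x) \<bullet> (Y t *\<^sub>v x)) > 0)) \<and>
      (\<forall>t\<in>{Tmin..Tmax}.
        (\<forall>x\<in>mat_kernel CJ. x \<noteq> 0\<^sub>v n \<longrightarrow> (AJ *\<^sub>v x) \<bullet> (X 0 *\<^sub>v (AJ *\<^sub>v x)) < x \<bullet> (X t *\<^sub>v x)) \<and>
        (\<forall>x\<in>mat_kernel BJ\<^sup>T. x \<noteq> 0\<^sub>v n \<longrightarrow> (AJ\<^sup>T *\<^sub>v x) \<bullet> (Y t *\<^sub>v (AJ\<^sup>T *\<^sub>v x)) < x \<bullet> (Y 0 *\<^sub>v x)))"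
    if X: "C1_sym_mat_on {0..Tmax} n X" and Y: "C1_sym_mat_on {0..Tmax} n Y" for X Y
  proof -
    have car: "Z t \<in> carrier_mat n n" "(Z t)\<^sup>T = Z t" "mat_deriv {0..Tmax} Z t \<in> carrier_mat n n"
      "(mat_deriv {0..Tmax} Z t)\<^sup>T = mat_deriv {0..Tmax} Z t"
      if Z: "C1_sym_mat_on {0..Tmax} n Z" and t: "t \<in> {0..Tmax}" for Z t
    proof -
      have Z1: "C1_mat_on {0..Tmax} n n Z" and Zs: "\<And>t. t \<in> {0..Tmax} \<Longrightarrow> (Z t)\<^sup>T = Z t"
        using Z unfolding C1_sym_mat_on_def by blast+
      show "Z t \<in> carrier_mat n n" by (rule C1_mat_on_carrier[OF Z1 t])
      then show "mat_deriv {0..Tmax} Z t \<in> carrier_mat n n" by (rule mat_deriv_carrier)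
      show "(Z t)\<^sup>T = Z t" by (rule Zs[OF t])
      show "(mat_deriv {0..Tmax} Z t)\<^sup>T = mat_deriv {0..Tmax} Z t"
        by (rule mat_deriv_symmetric[OF T0 Z1 Zs t])
    qed
    have JS: "t \<in> {0..Tmax}" if "t \<in> {Tmin..Tmax}" for t using that T by auto
    have zeroS: "0 \<in> {0..Tmax}" using T0 by simp
    note flow_LMI = LMI_iff(1)[OF plant(3) assms(10) plant(1) car[OF X]] LMI_iff(2)[OF BT assms(9) plant(1) car[OF Y]]
    note jump_LMI =
      LMI_iff(3)[OF jump(3) assms(12) jump(1) car(1,2)[OF X JS] car(1,2)[OF X zeroS]]
      LMI_iff(4)[OF BJT assms(11) jump(1) car(1,2)[OF Y JS] car(1,2)[OF Y zeroS]]
    show ?thesis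
      using X Y by (simp only: flow_LMI jump_LMI simp_thms cong: ball_cong)
  qed
  show ?thesis
  proof
    assume ?L
    then obtain K XX where K: "clock_dependent_controller Tmin Tmax m q mJ qJ K"
      and XX: "C1_sym_mat_on {0..Tmax} (n + order_c K) XX"
      and LMIs: "\<forall>t\<in>{0..Tmax}. pos_def (XX t)"
        "\<forall>t\<in>{0..Tmax}. neg_def (mat_deriv {0..Tmax} XX t +
          (closed_loop_flow A B C K t)\<^sup>T * XX t + XX t * closed_loop_flow A B C K t)"
        "\<forall>t\<in>{Tmin..Tmax}. neg_def ((closed_loop_jump AJ BJ CJ K t)\<^sup>T * XX 0 *
          closed_loop_jump AJ BJ CJ K t - XX t)"
      unfolding clock_LMIs_feasible_def by (elim exE conjE)
    have XX1: "C1_mat_on {0..Tmax} (n + order_c K) (n + order_c K) XX"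
      using XX unfolding C1_sym_mat_on_def by blast
    note an = necessary_conditions[OF T plant jump K XX1 LMIs[THEN bspec]]
    show "\<exists>X Y. ?R X Y"
    proof (rule exI, rule exI, rule R_iff[THEN iffD2])
      show "C1_sym_mat_on {0..Tmax} n (\<lambda>t. 2 \<cdot>\<^sub>m corner n (XX t))"
        by (rule an(1))
      show "C1_sym_mat_on {0..Tmax} n (\<lambda>t. corner n (inv_mat (XX t)))"
        by (rule an(2))
    qed (intro conjI ballI impI; rule an(3-7); assumption)
  next
    assume "\<exists>X Y. ?R X Y"
    then obtain X Y where R: "?R X Y" by (elim exE)
    note X = R[THEN conjunct1] and Y = R[THEN conjunct2, THEN conjunct1]
    note conds = R_iff[OF X Y, THEN iffD1, OF R]
    show ?L
      by (rule controller_exists[OF T plant jump X Y]) (use conds in blast)+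
  qed
qed

end
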